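(* In the setting of the context, assume that $(V_n)$ has a finite moment of order $4$, $\theta_p\ne0$ and $\theta_p^{*}\ne0$. Then, under the null hypothesis $\mathcal{H}_0:\ \rho=0$, $$\frac{n}{4\,\widehat{\theta}_{p,n}^{\,2}}\,(\widehat{D}_n-2)^2\xrightarrow{\ \mathcal{L}\ }\chi^2$$ (convergence in distribution), where $\widehat{\theta}_{p,n}$ is the $p$-th component of $\widehat{\theta}_n$ and $\chi^2$ has a Chi-square distribution with one degree of freedom. In addition, under the alternative hypothesis $\mathcal{H}_1:\ \rho\ne0$, $$\lim_{n\to\infty}\frac{n}{4\,\widehat{\theta}_{p,n}^{\,2}}\,(\widehat{D}_n-2)^2=+\infty\quad\text{almost surely}.$$
   Context: Let $p\ge 1$ be an integer, $\theta=(\theta_1,\dots,\theta_p)'\in\mathbb{R}^p$ a nonzero vector with $\|\theta\|_1=\sum_i|\theta_i|<1$ and $\rho\in\mathbb{R}$ with $|\rho|<1$. A prime denotes transposition. The process is given, for all $n\ge1$, by $$X_n=\theta_1X_{n-1}+\cdots+\theta_pX_{n-p}+\varepsilon_n,\qquad \varepsilon_n=\rho\,\varepsilon_{n-1}+V_n,$$ with square-integrable initial value $X_0=\varepsilon_0$ and $X_{-1}=\cdots=X_{-p}=0$, where $(V_n)$ is a sequence of square-integrable, independent and identically distributed random variables with zero mean and variance $\sigma^2>0$. Let $\Phi_n^p=(X_n,X_{n-1},\dots,X_{n-p+1})'$ and $S_n=\sum_{k=0}^n\Phi_k^p(\Phi_k^p)'+S$, where $S$ is a fixed symmetric positive definite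 $p\times p$ matrix. The least squares estimator of $\theta$ is $\widehat{\theta}_n=(S_{n-1})^{-1}\sum_{k=1}^n\Phi_{k-1}^pX_k$, $n\ge1$. At stage $n$ the residuals are $\widehat{\varepsilon}_0=X_0$ and $\widehat{\varepsilon}_k=X_k-\widehat{\theta}_n'\Phi_{k-1}^p$ for $1\le k\le n$ (they depend on $n$). The Durbin-Watson statistic is, for $n\ge1$, $$\widehat{D}_n=\Bigl(\sum_{k=0}^n\widehat{\varepsilon}_k^{\,2}\Bigr)^{-1}\sum_{k=1}^n(\widehat{\varepsilon}_k-\widehat{\varepsilon}_{k-1})^2.$$ $\theta_p^{*}$ denotes the $p$-th component of $\theta^{*}=\alpha(I_p-\theta_p\rho J_p)\beta$, where $I_p$ is the identity matrix, $J_p$ the exchange matrix of order $p$ (ones on the antidiagonal, zeros elsewhere), and $$\alpha=\frac{1}{(1-\theta_p\rho)(1+\theta_p\rho)},\qquad \beta=(\theta_1+\rho,\ \theta_2-\theta_1\rho,\ \dots,\ \theta_p-\theta_{p-1}\rho)'.$$ *)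

theory Defs
  imports "HOL-Probability.Probability"
    "Jordan_Normal_Form.Gauss_Jordan_Elimination"
begin

(* HOL-Analysis and Jordan_Normal_Form.Matrix both use the infix dollar sign; here it
   always denotes the entries of a Jordan_Normal_Form vector. *)
unbundle no vec_syntax

text \<open>
  Vectors and matrices are those of \<^theory>\<open>Jordan_Normal_Form.Matrix\<close>, whose entries are
  indexed from 0: the component \<open>\<theta>\<^sub>i\<close> of the mathematical text is \<open>\<theta> $ (i - 1)\<close>. A trajectory
  of the observed process is a function \<open>x :: int \<Rightarrow> real\<close>, so that the initial values at
  negative times can be addressed.
\<close>

definition pos_def_mat :: "nat \<Rightarrow> real mat \<Rightarrow> bool" where
  "pos_def_mat p S \<longleftrightarrow> S \<in> carrier_mat p p \<and> transpose_mat S = S \<and>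
     (\<forall>v \<in> carrier_vec p. v \<noteq> 0\<^sub>v p \<longrightarrow> 0 < v \<bullet> (S *\<^sub>v v))"

locale ar_process = prob_space M
  for M :: "'a measure"
    and p :: nat
    and \<theta> :: "real vec"
    and \<rho> \<sigma> :: real
    and S :: "real mat"
    and X :: "int \<Rightarrow> 'a \<Rightarrow> real"
    and \<epsilon> V :: "nat \<Rightarrow> 'a \<Rightarrow> real" +
  assumes p_ge_1: "1 \<le> p"
    and theta_carrier: "\<theta> \<in> carrier_vec p"
    and theta_nonzero: "\<theta> \<noteq> 0\<^sub>v p"
    and theta_norm: "(\<Sum>i = 1..p. \<bar>\<theta> $ (i - 1)\<bar>) < 1"
    and rho: "\<bar>\<rho>\<bar> < 1"
    and S_pos_def: "pos_def_mat p S"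
    and X_rec: "\<And>n \<omega>. 1 \<le> n \<Longrightarrow> \<omega> \<in> space M \<Longrightarrow>
      X (int n) \<omega> = (\<Sum>i = 1..p. \<theta> $ (i - 1) * X (int n - int i) \<omega>) + \<epsilon> n \<omega>"
    and eps_rec: "\<And>n \<omega>. 1 \<le> n \<Longrightarrow> \<omega> \<in> space M \<Longrightarrow> \<epsilon> n \<omega> = \<rho> * \<epsilon> (n - 1) \<omega> + V n \<omega>"
    and X_0_eps: "\<And>\<omega>. \<omega> \<in> space M \<Longrightarrow> X 0 \<omega> = \<epsilon> 0 \<omega>"
    and X_neg: "\<And>j \<omega>. j \<in> {1..p} \<Longrightarrow> \<omega> \<in> space M \<Longrightarrow> X (- int j) \<omega> = 0"
    and X_0_rv: "random_variable borel (X 0)"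
    and X_0_square: "integrable M (\<lambda>\<omega>. (X 0 \<omega>)\<^sup>2)"
    and V_indep: "indep_vars (\<lambda>_. borel) V {1..}"
    and V_ident: "\<And>n. 1 \<le> n \<Longrightarrow> distr M borel (V n) = distr M borel (V 1)"
    and V_square: "\<And>n. 1 \<le> n \<Longrightarrow> integrable M (\<lambda>\<omega>. (V n \<omega>)\<^sup>2)"
    and V_mean: "\<And>n. 1 \<le> n \<Longrightarrow> expectation (V n) = 0"
    and V_variance: "\<And>n. 1 \<le> n \<Longrightarrow> variance (V n) = \<sigma>\<^sup>2"
    and sigma_pos: "0 < \<sigma>\<^sup>2"

definition Phi :: "nat \<Rightarrow> (int \<Rightarrow> real) \<Rightarrow> nat \<Rightarrow> real vec" where
  "Phi p x n = Matrix.vec p (\<lambda>i. x (int n - int i))"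

definition S_mat :: "nat \<Rightarrow> real mat \<Rightarrow> (int \<Rightarrow> real) \<Rightarrow> nat \<Rightarrow> real mat" where
  "S_mat p S x n = Matrix.mat p p (\<lambda>(i, j). \<Sum>k = 0..n. Phi p x k $ i * Phi p x k $ j) + S"

text \<open>
  \<open>S_mat p S x n\<close> is positive definite whenever \<open>S\<close> is, so that \<^const>\<open>mat_inverse\<close> does not
  return \<^const>\<open>None\<close> below. The estimator and the statistics built from it are meant for
  \<open>n \<ge> 1\<close>.
\<close>

definition theta_hat :: "nat \<Rightarrow> real mat \<Rightarrow> (int \<Rightarrow> real) \<Rightarrow> nat \<Rightarrow> real vec" where
  "theta_hat p S x n =
     the (mat_inverse (S_mat p S x (n - 1))) *\<^sub>v
       Matrix.vec p (\<lambda>i. \<Sum>k = 1..n. Phi p x (k - 1) $ i * x (int k))"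

definition eps_hat :: "nat \<Rightarrow> real mat \<Rightarrow> (int \<Rightarrow> real) \<Rightarrow> nat \<Rightarrow> nat \<Rightarrow> real" where
  "eps_hat p S x n k =
     (if k = 0 then x 0 else x (int k) - theta_hat p S x n \<bullet> Phi p x (k - 1))"

definition durbin_watson :: "nat \<Rightarrow> real mat \<Rightarrow> (int \<Rightarrow> real) \<Rightarrow> nat \<Rightarrow> real" where
  "durbin_watson p S x n =
     inverse (\<Sum>k = 0..n. (eps_hat p S x n k)\<^sup>2) *
       (\<Sum>k = 1..n. (eps_hat p S x n k - eps_hat p S x n (k - 1))\<^sup>2)"

definition dw_test :: "nat \<Rightarrow> real mat \<Rightarrow> (int \<Rightarrow> real) \<Rightarrow> nat \<Rightarrow> real" where
  "dw_test p S x n =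
     real n / (4 * (theta_hat p S x n $ (p - 1))\<^sup>2) * (durbin_watson p S x n - 2)\<^sup>2"

definition exchange_mat :: "nat \<Rightarrow> real mat" where
  "exchange_mat p = Matrix.mat p p (\<lambda>(i, j). if i + j + 1 = p then 1 else 0)"

definition beta_vec :: "nat \<Rightarrow> real vec \<Rightarrow> real \<Rightarrow> real vec" where
  "beta_vec p \<theta> \<rho> =
     Matrix.vec p (\<lambda>i. if i = 0 then \<theta> $ 0 + \<rho> else \<theta> $ i - \<theta> $ (i - 1) * \<rho>)"

definition theta_star :: "nat \<Rightarrow> real vec \<Rightarrow> real \<Rightarrow> real vec" where
  "theta_star p \<theta> \<rho> = (let t = \<theta> $ (p - 1) in
     (1 / ((1 - t * \<rho>) * (1 + t * \<rho>))) \<cdot>\<^sub>v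
       ((1\<^sub>m p - (t * \<rho>) \<cdot>\<^sub>m exchange_mat p) *\<^sub>v beta_vec p \<theta> \<rho>))"

text \<open>
  The Chi-square law with \<open>d\<close> degrees of freedom: the law of the sum of the squares of \<open>d\<close>
  independent standard normal variables.
\<close>

definition chi_square_distribution :: "nat \<Rightarrow> real measure" where
  "chi_square_distribution d =
     distr (PiM {..<d} (\<lambda>_. std_normal_distribution)) borel (\<lambda>z. \<Sum>i<d. (z i)\<^sup>2)"

end

theory Submission
  imports Defs "Jordan_Normal_Form.Determinant"
begin

text \<open>
  Everything is read off from empirical second moments along a single trajectory. Extended by zero to
  negative times, the process satisfies an autoregression of order \<open>p + 1\<close> with innovations \<open>V\<^sub>n\<close> and
  last coefficient \<open>- c\<close>, where \<open>c = \<rho> \<theta>\<^sub>p\<close> (lemma \<open>autoregressive_form\<close>). Two strong laws are needed: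
  \<open>(\<Sum>k\<le>n. V\<^sub>k\<^sup>2) / n\<close> tends to \<open>\<sigma>\<^sup>2\<close>, and \<open>(\<Sum>k\<le>n. V\<^sub>k X\<^sub>k\<^sub>-\<^sub>j) / n\<close> tends to \<open>0\<close> for \<open>1 \<le> j \<le> p + 1\<close>. The rest
  of the first-order analysis is linear algebra up to errors \<open>o(n)\<close>, and the limits of the empirical
  autocovariances never have to be identified; it is enough that their matrix is Toeplitz up to \<open>o(n)\<close>,
  hence invariant under reversal of time.
  
  Let \<open>E\<close> be the error of predicting \<open>X\<^sub>k\<close> from its \<open>p\<close> predecessors with the coefficients \<open>\<theta>\<^sup>*\<close>, and \<open>B\<close>
  the error of predicting \<open>X\<^sub>k\<^sub>-\<^sub>p\<^sub>-\<^sub>1\<close> from its \<open>p\<close> successors with the same coefficients in reverse order.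
  The formula for \<open>\<theta>\<^sup>*\<close> says exactly that \<open>E = V - c B\<close>. Reversing time exchanges \<open>E\<close> and \<open>B\<close>, so that
  the empirical correlations \<open>e\<^sub>j\<close> of \<open>E\<close> with \<open>X\<^sub>k\<^sub>-\<^sub>j\<close> satisfy \<open>e\<^sub>j = - c e\<^sub>p\<^sub>+\<^sub>1\<^sub>-\<^sub>j + o(n)\<close>. Applying this twice
  and using \<open>c\<^sup>2 < 1\<close> gives \<open>e\<^sub>j = o(n)\<close> (\<open>E_orthogonal\<close>). Since the Gram matrix of the regressors is bounded
  below by a multiple of \<open>n\<close> (\<open>persistent_excitation\<close>), the estimator converges to \<open>\<theta>\<^sup>*\<close>. The same
  reflection argument gives the lag-one autocorrelation \<open>c \<theta>\<^sub>p\<^sup>*\<close> of \<open>E\<close>, so the Durbin-Watson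
  statistic tends to \<open>2 - 2 c \<theta>\<^sub>p\<^sup>*\<close>. Consequently the test statistic divided by \<open>n\<close> tends to \<open>c\<^sup>2\<close>, which is
  positive under the alternative (\<open>statistic_diverges\<close>).
  
  Under the null hypothesis \<open>c = 0\<close> and \<open>E = V\<close>. The lagged innovation \<open>V\<^sub>k\<^sub>-\<^sub>1\<close> is a combination of the
  regressors minus \<open>\<theta>\<^sub>p B\<^sub>k\<close>, and the normal equations cancel the contribution of the regressors to the
  lag-one sum of the residuals. What remains is \<open>- \<theta>\<^sub>p (\<Sum>k\<le>n. V\<^sub>k B\<^sub>k)\<close> up to \<open>o(\<surd>n)\<close>
  (\<open>studentized_statistic_expansion\<close>), a martingale because \<open>B\<^sub>k\<close> only involves values before time \<open>k\<close>,
  and \<open>(\<Sum>k\<le>n. B\<^sub>k\<^sup>2) / n\<close> tends to \<open>\<sigma>\<^sup>2\<close>. The central limit theorem \<open>martingale_transform_clt\<close>, Levy's continuity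
  theorem and the continuous mapping \<open>z \<mapsto> z\<^sup>2\<close> yield the Chi-square law.
  
  The initial value \<open>X\<^sub>0\<close> may depend on the noise. Subtracting its deterministic response from the
  process leaves an autoregression driven by \<open>V\<^sub>1, V\<^sub>2, \<dots>\<close> alone, to which the independence arguments apply;
  the response is summable and does not affect any limit.
\<close>

section \<open>Empirical inner products\<close>

text \<open>
  Paths are indexed by the integers and vanish at negative times (\<open>causal\<close>), so that shifts need no case
  distinction and recursions can be assumed at every time.
\<close>

definition lag :: "nat \<Rightarrow> (int \<Rightarrow> real) \<Rightarrow> int \<Rightarrow> real" where
  "lag j f k = f (k - int j)"

definition ip :: "(int \<Rightarrow> real) \<Rightarrow> (int \<Rightarrow> real) \<Rightarrow> nat \<Rightarrow> real" where
  "ip f g n = (\<Sum>k\<le>n. f (int k) * g (int k))"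

definition causal :: "(int \<Rightarrow> real) \<Rightarrow> bool" where
  "causal f \<longleftrightarrow> (\<forall>k<0. f k = 0)"

lemma lag_0 [simp]: "lag 0 f = f"
  by (simp add: lag_def fun_eq_iff)

lemma lag_lag [simp]: "lag i (lag j f) = lag (i + j) f"
  by (simp add: lag_def fun_eq_iff algebra_simps)

lemma ip_commute: "ip f g n = ip g f n"
  by (simp add: ip_def mult.commute)

lemma ip_add_left: "ip (\<lambda>k. f k + g k) h n = ip f h n + ip g h n"
  by (simp add: ip_def algebra_simps sum.distrib)

lemma ip_diff_left: "ip (\<lambda>k. f k - g k) h n = ip f h n - ip g h n"
  by (simp add: ip_def algebra_simps sum_subtractf)

lemma ip_cmult_left: "ip (\<lambda>k. c * f k) h n = c * ip f h n"
  by (simp add: ip_def algebra_simps sum_distrib_left)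

lemma ip_sum_left: "ip (\<lambda>k. \<Sum>i\<in>I. w i * f i k) h n = (\<Sum>i\<in>I. w i * ip (f i) h n)"
proof -
  have "ip (\<lambda>k. \<Sum>i\<in>I. w i * f i k) h n = (\<Sum>k\<le>n. \<Sum>i\<in>I. w i * (f i (int k) * h (int k)))"
    by (simp add: ip_def sum_distrib_right mult.assoc)
  also have "\<dots> = (\<Sum>i\<in>I. \<Sum>k\<le>n. w i * (f i (int k) * h (int k)))"
    by (rule sum.swap)
  finally show ?thesis by (simp add: ip_def sum_distrib_left)
qed

lemma ip_add_right: "ip h (\<lambda>k. f k + g k) n = ip h f n + ip h g n"
  by (simp add: ip_def algebra_simps sum.distrib)

lemma ip_diff_right: "ip h (\<lambda>k. f k - g k) n = ip h f n - ip h g n"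
  by (simp add: ip_def algebra_simps sum_subtractf)

lemma ip_cmult_right: "ip h (\<lambda>k. c * f k) n = c * ip h f n"
  by (simp add: ip_def algebra_simps sum_distrib_left)

lemma ip_sum_right: "ip h (\<lambda>k. \<Sum>i\<in>I. w i * f i k) n = (\<Sum>i\<in>I. w i * ip h (f i) n)"
  using ip_sum_left[where I = I and w = w and f = f and h = h and n = n] by (simp add: ip_commute)

lemmas ip_linear = ip_add_left ip_diff_left ip_cmult_left ip_sum_left
  ip_add_right ip_diff_right ip_cmult_right ip_sum_right

lemma ip_self_nonneg: "0 \<le> ip f f n"
  by (simp add: ip_def sum_nonneg)

lemma ip_Cauchy_Schwarz: "\<bar>ip f g n\<bar> \<le> sqrt (ip f f n) * sqrt (ip g g n)"
proof -
  have "(ip f g n)\<^sup>2 \<le> ip f f n * ip g g n"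
    using Cauchy_Schwarz_ineq_sum[of "\<lambda>k. f (int k)" "\<lambda>k. g (int k)" "{..n}"]
    by (simp add: ip_def power2_eq_square)
  then have "sqrt ((ip f g n)\<^sup>2) \<le> sqrt (ip f f n * ip g g n)"
    by (rule real_sqrt_le_mono)
  then show ?thesis by (simp add: real_sqrt_mult)
qed

text \<open>
  The two sums differ only in their last term: shifting a summation range costs one boundary value.
\<close>

lemma sum_shift_1:
  fixes F :: "int \<Rightarrow> real"
  assumes "F (-1) = 0"
  shows "(\<Sum>k\<le>n. F (int k - 1)) = (\<Sum>k\<le>n. F (int k)) - F (int n)"
  using assms by (induction n) auto

lemma sum_shift_le:
  fixes F :: "int \<Rightarrow> real"
  assumes "\<And>k. k < 0 \<Longrightarrow> F k = 0" "\<And>k. 0 \<le> F k"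
  shows "(\<Sum>k\<le>n. F (int k - int j)) \<le> (\<Sum>k\<le>n. F (int k))"
proof (induction j)
  case (Suc j)
  have "(\<Sum>k\<le>n. F (int k - int (Suc j))) = (\<Sum>k\<le>n. F (int k - 1 - int j))"
    by (simp add: algebra_simps)
  also have "\<dots> = (\<Sum>k\<le>n. F (int k - int j)) - F (int n - int j)"
    using sum_shift_1[of "\<lambda>k. F (k - int j)" n] assms(1) by simp
  finally show ?case using Suc assms(2)[of "int n - int j"] by linarith
qed auto

lemma ip_shift:
  assumes "causal f"
  shows "ip (lag (Suc a) f) (lag (Suc b) g) n
    = ip (lag a f) (lag b g) n - f (int n - int a) * g (int n - int b)"
  using sum_shift_1[of "\<lambda>k. lag a f k * lag b g k" n] assms
  by (simp add: ip_def lag_def causal_def algebra_simps)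

lemma ip_lag_self_le:
  assumes "causal f"
  shows "ip (lag j f) (lag j f) n \<le> ip f f n"
  using sum_shift_le[where F = "\<lambda>k. f k * f k" and n = n and j = j] assms by (simp add: ip_def lag_def causal_def)

subsection \<open>Sequences of smaller order than the sample size\<close>

text \<open>
  Errors of order \<open>o(n)\<close>. They form a vector space, and \<open>near\<close> is equality modulo this space.
\<close>

definition negl :: "(nat \<Rightarrow> real) \<Rightarrow> bool" where
  "negl f \<longleftrightarrow> (\<lambda>n. f n / real n) \<longlonglongrightarrow> 0"

lemma negl_zero [simp]: "negl (\<lambda>n. 0)"
  by (simp add: negl_def)

lemma negl_add: "negl f \<Longrightarrow> negl g \<Longrightarrow> negl (\<lambda>n. f n + g n)"
  unfolding negl_def using tendsto_add[of "\<lambda>n. f n / real n" 0 _ "\<lambda>n. g n / real n" 0]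
  by (simp add: add_divide_distrib)

lemma negl_diff: "negl f \<Longrightarrow> negl g \<Longrightarrow> negl (\<lambda>n. f n - g n)"
  unfolding negl_def using tendsto_diff[of "\<lambda>n. f n / real n" 0 _ "\<lambda>n. g n / real n" 0]
  by (simp add: diff_divide_distrib)

lemma negl_cmult: "negl f \<Longrightarrow> negl (\<lambda>n. c * f n)"
  unfolding negl_def using tendsto_mult_left[of "\<lambda>n. f n / real n" 0 _ c] by simp

lemma negl_cmult_iff: "c \<noteq> 0 \<Longrightarrow> negl (\<lambda>n. c * f n) \<longleftrightarrow> negl f"
  using negl_cmult[of f c] negl_cmult[of "\<lambda>n. c * f n" "1 / c"] by auto

lemma negl_sum: "(\<And>i. i \<in> I \<Longrightarrow> negl (f i)) \<Longrightarrow> negl (\<lambda>n. \<Sum>i\<in>I. f i n)"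
  unfolding negl_def using tendsto_sum[of I "\<lambda>i n. f i n / real n" "\<lambda>_. 0"]
  by (simp add: sum_divide_distrib)

lemma negl_abs: "negl f \<Longrightarrow> negl (\<lambda>n. \<bar>f n\<bar>)"
  unfolding negl_def using tendsto_rabs[of "\<lambda>n. f n / real n" 0] by simp

lemma negl_bound:
  assumes "negl g" "\<And>n. \<bar>f n\<bar> \<le> g n"
  shows "negl f"
  unfolding negl_def
proof (rule tendsto_rabs_zero_cancel, rule tendsto_sandwich[OF _ _ tendsto_const])
  show "(\<lambda>n. g n / real n) \<longlonglongrightarrow> 0" using assms(1) by (simp add: negl_def)
qed (use assms(2) in \<open>auto intro!: always_eventually divide_right_mono\<close>)

lemma negl_const [simp]: "negl (\<lambda>n. c)"
  unfolding negl_def by (rule lim_const_over_n)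

definition near :: "(nat \<Rightarrow> real) \<Rightarrow> (nat \<Rightarrow> real) \<Rightarrow> bool" where
  "near f g \<longleftrightarrow> negl (\<lambda>n. f n - g n)"

lemma near_refl [simp]: "near f f"
  by (simp add: near_def)

lemma near_sym: "near f g \<Longrightarrow> near g f"
  unfolding near_def using negl_cmult[of "\<lambda>n. f n - g n" "-1"] by simp

lemma near_trans [trans]: "near f g \<Longrightarrow> near g h \<Longrightarrow> near f h"
  unfolding near_def using negl_add[of "\<lambda>n. f n - g n" "\<lambda>n. g n - h n"] by simp

lemma near_add: "near f g \<Longrightarrow> near f' g' \<Longrightarrow> near (\<lambda>n. f n + f' n) (\<lambda>n. g n + g' n)"
  unfolding near_def using negl_add[of "\<lambda>n. f n - g n" "\<lambda>n. f' n - g' n"]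
  by (simp add: algebra_simps)

lemma near_diff: "near f g \<Longrightarrow> near f' g' \<Longrightarrow> near (\<lambda>n. f n - f' n) (\<lambda>n. g n - g' n)"
  unfolding near_def using negl_diff[of "\<lambda>n. f n - g n" "\<lambda>n. f' n - g' n"]
  by (simp add: algebra_simps)

lemma near_cmult: "near f g \<Longrightarrow> near (\<lambda>n. c * f n) (\<lambda>n. c * g n)"
  unfolding near_def using negl_cmult[of "\<lambda>n. f n - g n" c] by (simp add: algebra_simps)

lemma near_sum: "(\<And>i. i \<in> I \<Longrightarrow> near (f i) (g i)) \<Longrightarrow> near (\<lambda>n. \<Sum>i\<in>I. f i n) (\<lambda>n. \<Sum>i\<in>I. g i n)"
  unfolding near_def using negl_sum[of I "\<lambda>i n. f i n - g i n"] by (simp add: sum_subtractf)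

lemma near_zero_iff: "near f (\<lambda>n. 0) \<longleftrightarrow> negl f"
  by (simp add: near_def)

lemma near_negl: "near f g \<Longrightarrow> negl g \<Longrightarrow> negl f"
  unfolding near_def using negl_add[of "\<lambda>n. f n - g n" g] by simp

lemma near_linear_iff: "near f (\<lambda>n. s * real n) \<longleftrightarrow> (\<lambda>n. f n / real n) \<longlonglongrightarrow> s"
proof -
  have *: "eventually (\<lambda>n. (f n - s * real n) / real n = f n / real n - s) sequentially"
    using eventually_gt_at_top[of 0] by eventually_elim (simp add: field_simps)
  show ?thesis
    unfolding near_def negl_def filterlim_cong[OF refl refl *]
    by (simp add: LIM_zero_iff)
qed

text \<open>
  The growth condition under which the boundary values left by a shift are negligible.
\<close>

definition slow :: "(int \<Rightarrow> real) \<Rightarrow> bool" where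
  "slow f \<longleftrightarrow> negl (\<lambda>n. (f (int n))\<^sup>2)"

lemma slow_lag:
  assumes "slow f"
  shows "slow (lag j f)"
proof (induction j)
  case (Suc j)
  have "(\<lambda>n. (lag j f (int n))\<^sup>2 / real n * (real n / real (Suc n))) \<longlonglongrightarrow> 0 * 1"
    using Suc LIMSEQ_n_over_Suc_n by (intro tendsto_mult) (auto simp: slow_def negl_def)
  also have "(\<lambda>n. (lag j f (int n))\<^sup>2 / real n * (real n / real (Suc n)))
      = (\<lambda>n. if n = 0 then 0 else (lag (Suc j) f (int (Suc n)))\<^sup>2 / real (Suc n))"
    by (auto simp: lag_def fun_eq_iff)
  finally have "(\<lambda>n. if n = 0 then 0 else (lag (Suc j) f (int (Suc n)))\<^sup>2 / real (Suc n)) \<longlonglongrightarrow> 0"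
    by simp
  then have "(\<lambda>n. (lag (Suc j) f (int (Suc n)))\<^sup>2 / real (Suc n)) \<longlonglongrightarrow> 0"
    by (rule Lim_transform_eventually)
      (use eventually_gt_at_top[of 0] in eventually_elim, simp)
  then show ?case by (simp add: slow_def negl_def LIMSEQ_imp_Suc)
qed (use assms in simp)

lemma slow_mult:
  assumes "slow f" "slow g"
  shows "negl (\<lambda>n. f (int n) * g (int n))"
proof (rule negl_bound)
  show "negl (\<lambda>n. (f (int n))\<^sup>2 + (g (int n))\<^sup>2)"
    using assms by (auto simp: slow_def intro: negl_add)
  show "\<bar>f (int n) * g (int n)\<bar> \<le> (f (int n))\<^sup>2 + (g (int n))\<^sup>2" for n
    using sum_squares_bound[of "\<bar>f (int n)\<bar>" "\<bar>g (int n)\<bar>"]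
      mult_nonneg_nonneg[of "\<bar>f (int n)\<bar>" "\<bar>g (int n)\<bar>"] unfolding abs_mult power2_abs by linarith
qed

text \<open>
  The increment of a sum whose averages converge is of smaller order than its length.
\<close>

lemma slow_of_mean_square:
  assumes "(\<lambda>n. ip f f n / real n) \<longlonglongrightarrow> s"
  shows "slow f"
proof -
  have 1: "(\<lambda>n. ip f f (Suc n) / real (Suc n)) \<longlonglongrightarrow> s"
    using assms by (rule LIMSEQ_Suc)
  have 2: "(\<lambda>n. ip f f n / real n * (real n / real (Suc n))) \<longlonglongrightarrow> s * 1"
    by (intro tendsto_mult assms LIMSEQ_n_over_Suc_n)
  have "(\<lambda>n. ip f f (Suc n) / real (Suc n) - ip f f n / real n * (real n / real (Suc n))) \<longlonglongrightarrow> s - s * 1"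
    by (intro tendsto_diff 1 2)
  then have "(\<lambda>n. (f (int (Suc n)))\<^sup>2 / real (Suc n)) \<longlonglongrightarrow> 0"
    unfolding right_minus_eq mult_1_right diff_self
    by (rule Lim_transform_eventually)
      (use eventually_gt_at_top[of 0] in eventually_elim,
        simp add: ip_def power2_eq_square add_divide_distrib del: of_nat_Suc)
  then show ?thesis unfolding slow_def negl_def by (rule LIMSEQ_imp_Suc)
qed

text \<open>
  Each unit shift of both paths changes the inner product by one product of boundary values. Hence
  empirical covariances depend only on the difference of the lags, up to \<open>o(n)\<close>.
\<close>

lemma ip_shift_near:
  assumes "causal f" "slow f" "slow g"
  shows "near (ip (lag a f) (lag b g)) (ip (lag (a + m) f) (lag (b + m) g))"
proof (induction m)
  case (Suc m)
  have "near (ip (lag (a + m) f) (lag (b + m) g)) (ip (lag (Suc (a + m)) f) (lag (Suc (b + m)) g))"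
    using slow_mult[OF slow_lag[OF assms(2), of "a + m"] slow_lag[OF assms(3), of "b + m"]]
    by (simp add: near_def ip_shift[OF assms(1)] lag_def)
  with Suc show ?case by (simp add: near_trans)
qed simp

lemma negl_ip_Cauchy_Schwarz:
  fixes F G :: "nat \<Rightarrow> int \<Rightarrow> real"
  assumes F: "(\<lambda>n. ip (F n) (F n) n / real n) \<longlonglongrightarrow> l" and G: "negl (\<lambda>n. ip (G n) (G n) n)"
  shows "negl (\<lambda>n. ip (F n) (G n) n)"
  unfolding negl_def
proof (rule tendsto_rabs_zero_cancel, rule tendsto_sandwich[OF _ _ tendsto_const])
  show "(\<lambda>n. sqrt (ip (F n) (F n) n / real n) * sqrt (ip (G n) (G n) n / real n)) \<longlonglongrightarrow> 0"
    using tendsto_mult[OF tendsto_real_sqrt[OF F] tendsto_real_sqrt[OF G[unfolded negl_def]]] by simp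
  show "\<forall>\<^sub>F n in sequentially. \<bar>ip (F n) (G n) n / real n\<bar>
      \<le> sqrt (ip (F n) (F n) n / real n) * sqrt (ip (G n) (G n) n / real n)"
    using ip_Cauchy_Schwarz[of "F _" "G _"]
    by (intro always_eventually allI) (simp add: real_sqrt_divide divide_right_mono)
qed simp

section \<open>Contractive recursions\<close>

lemma convex_on_power_nonneg: "convex_on {0..} (\<lambda>x::real. x ^ r)"
proof (induction r)
  case (Suc r)
  then show ?case
    using convex_on_mul[of "{0..}" "\<lambda>x. x" "\<lambda>x. x ^ r"]
    by (auto simp: convex_on_ident mono_on_def power_mono)
qed (simp add: convex_on_const)

text \<open>
  Jensen's inequality for the convex combination of the \<open>\<bar>z\<^sub>i\<bar>\<close> with weights \<open>\<bar>w\<^sub>i\<bar>\<close> and of \<open>\<bar>u\<bar> / (1 - t)\<close>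
  with the remaining weight \<open>1 - t\<close>, where \<open>t = \<Sum>\<bar>w\<^sub>i\<bar>\<close>.
\<close>

lemma contraction_power_le:
  fixes w z :: "'i \<Rightarrow> real"
  assumes fin: "finite I" and t: "(\<Sum>i\<in>I. \<bar>w i\<bar>) < 1"
  shows "\<bar>(\<Sum>i\<in>I. w i * z i) + u\<bar> ^ Suc r
    \<le> (\<Sum>i\<in>I. \<bar>w i\<bar> * \<bar>z i\<bar> ^ Suc r) + \<bar>u\<bar> ^ Suc r / (1 - (\<Sum>i\<in>I. \<bar>w i\<bar>)) ^ r"
proof -
  define t where "t = (\<Sum>i\<in>I. \<bar>w i\<bar>)"
  have t1: "1 - t > 0" using t by (simp add: t_def)
  define A where "A = (\<lambda>i. case i of None \<Rightarrow> 1 - t | Some i \<Rightarrow> \<bar>w i\<bar>)"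
  define Z where "Z = (\<lambda>i. case i of None \<Rightarrow> \<bar>u\<bar> / (1 - t) | Some i \<Rightarrow> \<bar>z i\<bar>)"
  have S: "(\<Sum>i\<in>insert None (Some ` I). F i) = F None + (\<Sum>i\<in>I. F (Some i))" for F :: "'i option \<Rightarrow> real"
    using fin by (subst sum.insert) (auto simp: sum.reindex)
  have "(\<Sum>i\<in>insert None (Some ` I). A i *\<^sub>R Z i) ^ Suc r
      \<le> (\<Sum>i\<in>insert None (Some ` I). A i * Z i ^ Suc r)"
    by (rule convex_on_sum[OF _ _ convex_on_power_nonneg])
      (use fin t1 in \<open>auto simp: S A_def Z_def t_def[symmetric] split: option.splits\<close>)
  also have "\<dots> = (1 - t) * (\<bar>u\<bar> / (1 - t)) ^ Suc r + (\<Sum>i\<in>I. \<bar>w i\<bar> * \<bar>z i\<bar> ^ Suc r)"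
    by (simp add: S A_def Z_def)
  also have "(1 - t) * (\<bar>u\<bar> / (1 - t)) ^ Suc r = \<bar>u\<bar> ^ Suc r / (1 - t) ^ r"
    using t1 by (simp add: power_divide field_simps)
  also have "(\<Sum>i\<in>insert None (Some ` I). A i *\<^sub>R Z i) = \<bar>u\<bar> + (\<Sum>i\<in>I. \<bar>w i * z i\<bar>)"
    using t1 by (simp add: S A_def Z_def abs_mult)
  finally have *: "(\<bar>u\<bar> + (\<Sum>i\<in>I. \<bar>w i * z i\<bar>)) ^ Suc r
      \<le> (\<Sum>i\<in>I. \<bar>w i\<bar> * \<bar>z i\<bar> ^ Suc r) + \<bar>u\<bar> ^ Suc r / (1 - t) ^ r"
    by simp
  have "\<bar>(\<Sum>i\<in>I. w i * z i) + u\<bar> ^ Suc r \<le> (\<bar>u\<bar> + (\<Sum>i\<in>I. \<bar>w i * z i\<bar>)) ^ Suc r"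
    by (intro power_mono) (use sum_abs[of "\<lambda>i. w i * z i" I] in linarith, simp)
  with * show ?thesis by (simp add: t_def)
qed

text \<open>
  Both recursions of the model, the one of order \<open>p\<close> for the process and the one of order 1 for the noise,
  have this form. The bound \<open>power_le\<close> contracts every absolute power, so that sums of powers, growth
  rates and moments of the input are inherited by the output.
\<close>

locale contractive_filter =
  fixes q :: nat and w :: "nat \<Rightarrow> real" and y u :: "int \<Rightarrow> real"
  assumes contr: "(\<Sum>i<q. \<bar>w i\<bar>) < 1"
    and causal_y: "causal y"
    and rec_y: "\<And>k. 0 \<le> k \<Longrightarrow> y k = (\<Sum>i<q. w i * y (k - 1 - int i)) + u k"
begin

definition gap :: real where "gap = 1 - (\<Sum>i<q. \<bar>w i\<bar>)"

lemma gap_pos: "0 < gap"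
  using contr by (simp add: gap_def)

lemma power_le:
  "0 \<le> k \<Longrightarrow> \<bar>y k\<bar> ^ Suc r \<le> (\<Sum>i<q. \<bar>w i\<bar> * \<bar>y (k - 1 - int i)\<bar> ^ Suc r) + \<bar>u k\<bar> ^ Suc r / gap ^ r"
  using contraction_power_le[OF _ contr, where z = "\<lambda>i. y (k - 1 - int i)" and u = "u k"]
  by (simp add: rec_y gap_def)

lemma sum_power_le:
  "(\<Sum>k\<le>n. \<bar>y (int k)\<bar> ^ Suc r) \<le> (\<Sum>k\<le>n. \<bar>u (int k)\<bar> ^ Suc r) / gap ^ Suc r"
proof -
  define A where "A = (\<Sum>k\<le>n. \<bar>y (int k)\<bar> ^ Suc r)"
  have sh: "(\<Sum>k\<le>n. \<bar>y (int k - 1 - int i)\<bar> ^ Suc r) \<le> A" for i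
    using sum_shift_le[where F = "\<lambda>k. \<bar>y k\<bar> ^ Suc r" and n = n and j = "Suc i"] causal_y
    by (simp add: A_def causal_def algebra_simps)
  have "A \<le> (\<Sum>k\<le>n. (\<Sum>i<q. \<bar>w i\<bar> * \<bar>y (int k - 1 - int i)\<bar> ^ Suc r) + \<bar>u (int k)\<bar> ^ Suc r / gap ^ r)"
    unfolding A_def by (intro sum_mono power_le) simp
  also have "\<dots> = (\<Sum>i<q. \<bar>w i\<bar> * (\<Sum>k\<le>n. \<bar>y (int k - 1 - int i)\<bar> ^ Suc r)) + (\<Sum>k\<le>n. \<bar>u (int k)\<bar> ^ Suc r) / gap ^ r"
    unfolding sum.distrib sum_divide_distrib sum_distrib_left by (subst sum.swap) simp
  also have "(\<Sum>i<q. \<bar>w i\<bar> * (\<Sum>k\<le>n. \<bar>y (int k - 1 - int i)\<bar> ^ Suc r)) \<le> (\<Sum>i<q. \<bar>w i\<bar> * A)"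
    by (intro sum_mono mult_left_mono sh) simp
  also have "\<dots> = (1 - gap) * A" by (simp add: gap_def sum_distrib_right)
  finally have "gap * A \<le> (\<Sum>k\<le>n. \<bar>u (int k)\<bar> ^ Suc r) / gap ^ r"
    by (simp add: algebra_simps)
  then show ?thesis using gap_pos by (simp add: A_def field_simps)
qed

lemma ip_le: "ip y y n \<le> ip u u n / gap\<^sup>2"
  using sum_power_le[where r = 1 and n = n] by (simp add: ip_def power2_eq_square)

lemma slow_output:
  assumes "slow u"
  shows "slow y"
  unfolding slow_def negl_def
proof (rule LIMSEQ_I)
  fix e :: real assume e: "0 < e"
  (* The input satisfies a bound u_n^2 <= eta * n + K with arbitrarily small slope eta, and such an
     affine bound passes to the output with the factor 1 / gap^2. *)
  define \<eta> where "\<eta> = e * gap\<^sup>2 / 2"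
  have \<eta>: "\<eta> > 0" using e gap_pos by (simp add: \<eta>_def)
  have "(\<lambda>n. (u (int n))\<^sup>2 / real n) \<longlonglongrightarrow> 0" using assms by (simp add: slow_def negl_def)
  from LIMSEQ_D[OF this \<eta>] obtain N where N: "\<And>n. n \<ge> N \<Longrightarrow> (u (int n))\<^sup>2 / real n < \<eta>"
    by auto
  define K where "K = (\<Sum>k\<le>N. (u (int k))\<^sup>2)"
  have K0: "K \<ge> 0" by (simp add: K_def sum_nonneg)
  have uK: "(u (int n))\<^sup>2 \<le> \<eta> * real n + K" for n
  proof (cases "n \<le> N")
    case True
    then have "(u (int n))\<^sup>2 \<le> K"
      unfolding K_def by (intro member_le_sum[of n "{..N}" "\<lambda>k. (u (int k))\<^sup>2"]) auto
    then show ?thesis using \<eta> by (simp add: add_increasing)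
  next
    case False
    then have "(u (int n))\<^sup>2 \<le> \<eta> * real n" using N[of n] by (auto simp: field_simps)
    then show ?thesis using K0 by simp
  qed
  have bound: "(y k)\<^sup>2 \<le> (\<eta> * real_of_int k + K) / gap\<^sup>2" if "k \<ge> 0" for k
    using that
  proof (induction "nat k" arbitrary: k rule: less_induct)
    case less
    define B where "B = (\<eta> * real_of_int k + K) / gap\<^sup>2"
    have B0: "B \<ge> 0" using \<eta> K0 gap_pos less.prems by (simp add: B_def)
    have past: "(y (k - 1 - int i))\<^sup>2 \<le> B" for i
    proof (cases "k - 1 - int i \<ge> 0")
      case True
      then have "(y (k - 1 - int i))\<^sup>2 \<le> (\<eta> * real_of_int (k - 1 - int i) + K) / gap\<^sup>2"
        by (intro less.hyps) auto
      also have "\<dots> \<le> B" unfolding B_def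
        using \<eta> by (intro divide_right_mono add_right_mono mult_left_mono) auto
      finally show ?thesis .
    next
      case False
      then show ?thesis using B0 causal_y by (simp add: causal_def)
    qed
    have "(y k)\<^sup>2 \<le> (\<Sum>i<q. \<bar>w i\<bar> * (y (k - 1 - int i))\<^sup>2) + (u k)\<^sup>2 / gap"
      using power_le[OF less.prems, of 1] by (simp flip: power2_eq_square)
    also have "(\<Sum>i<q. \<bar>w i\<bar> * (y (k - 1 - int i))\<^sup>2) \<le> (\<Sum>i<q. \<bar>w i\<bar> * B)"
      by (intro sum_mono mult_left_mono past) simp
    also have "\<dots> = (1 - gap) * B" by (simp add: gap_def sum_distrib_right)
    also have "(u k)\<^sup>2 / gap \<le> (\<eta> * real_of_int k + K) / gap"
      using uK[of "nat k"] less.prems gap_pos by (intro divide_right_mono) auto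
    also have "\<dots> = gap * B" using gap_pos by (simp add: B_def power2_eq_square)
    finally have "(y k)\<^sup>2 \<le> B" by (simp add: algebra_simps)
    then show ?case by (simp add: B_def)
  qed
  define M where "M = nat \<lceil>2 * K / (e * gap\<^sup>2)\<rceil> + 1"
  show "\<exists>no. \<forall>n\<ge>no. norm ((y (int n))\<^sup>2 / real n - 0) < e"
  proof (intro exI[of _ M] allI impI)
    fix n assume n: "n \<ge> M"
    then have "2 * K / (e * gap\<^sup>2) < real n" unfolding M_def by linarith
    then have "K < e * gap\<^sup>2 / 2 * real n" using e gap_pos by (simp add: field_simps)
    then have "\<eta> * real n + K < e * gap\<^sup>2 * real n" by (simp add: \<eta>_def)
    then have "(\<eta> * real n + K) / gap\<^sup>2 < e * real n" using gap_pos by (simp add: field_simps)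
    then have "(y (int n))\<^sup>2 < e * real n" using bound[of "int n"] by simp
    moreover have "real n > 0" using n by (simp add: M_def)
    ultimately show "norm ((y (int n))\<^sup>2 / real n - 0) < e" by (simp add: field_simps)
  qed
qed

end

section \<open>The autoregression driven by autoregressive noise\<close>

text \<open>
  The coefficient \<open>a i\<close> is the mathematical \<open>\<theta>\<^sub>i\<^sub>+\<^sub>1\<close>. The recursions hold from time 0 on; there \<open>x 0 = e 0 = v 0\<close>,
  so that \<open>v 0\<close> carries the initial value and \<open>v k\<close> is the innovation \<open>V\<^sub>k\<close> for \<open>k \<ge> 1\<close>.
\<close>

locale autoregression =
  fixes p :: nat and a :: "nat \<Rightarrow> real" and \<rho> :: real and x e v :: "int \<Rightarrow> real"
  assumes p_pos: "1 \<le> p"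
    and a_norm: "(\<Sum>i<p. \<bar>a i\<bar>) < 1"
    and rho_lt: "\<bar>\<rho>\<bar> < 1"
    and causal_x: "causal x" and causal_e: "causal e" and causal_v: "causal v"
    and x_rec: "\<And>k. 0 \<le> k \<Longrightarrow> x k = (\<Sum>i<p. a i * x (k - 1 - int i)) + e k"
    and e_rec: "\<And>k. 0 \<le> k \<Longrightarrow> e k = \<rho> * e (k - 1) + v k"
begin

sublocale fx: contractive_filter p a x e
  by unfold_locales (use a_norm causal_x x_rec in auto)

sublocale fe: contractive_filter 1 "\<lambda>_. \<rho>" e v
  by unfold_locales (use rho_lt causal_e e_rec in auto)

text \<open>
  In the autoregression of order \<open>p + 1\<close>, the numbers \<open>b i\<close> are the first \<open>p\<close> coefficients (the vector \<open>\<beta>\<close>) and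
  \<open>- c\<close> is the last one. The vector \<open>ts\<close> is \<open>\<theta>\<^sup>*\<close>.
\<close>

definition c :: real where "c = \<rho> * a (p - 1)"

definition b :: "nat \<Rightarrow> real" where
  "b i = (if i = 0 then a 0 + \<rho> else a i - \<rho> * a (i - 1))"

definition ts :: "nat \<Rightarrow> real" where
  "ts i = (b i - c * b (p - 1 - i)) / (1 - c\<^sup>2)"

lemma c_square_lt: "c\<^sup>2 < 1"
proof -
  have "\<bar>a (p - 1)\<bar> \<le> (\<Sum>i<p. \<bar>a i\<bar>)"
    by (rule member_le_sum) (use p_pos in auto)
  then have "\<bar>a (p - 1)\<bar> < 1" using a_norm by simp
  then have "\<bar>\<rho>\<bar> * \<bar>a (p - 1)\<bar> < 1" using rho_lt
    by (metis abs_ge_zero mult_less_cancel_left2 mult_strict_mono' mult_1 zero_less_abs_iff abs_mult)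
  then show ?thesis using abs_square_less_1[of c] by (simp add: c_def abs_mult)
qed

text \<open>
  The system of equations that determines \<open>\<theta>\<^sup>*\<close>: it is the step from order \<open>p + 1\<close> to order \<open>p\<close> in the
  Levinson recursion, with partial autocorrelation \<open>- c\<close>.
\<close>

lemma ts_reflected: "i < p \<Longrightarrow> ts i + c * ts (p - 1 - i) = b i"
proof -
  assume i: "i < p"
  have "ts i + c * ts (p - 1 - i) = ((1 - c\<^sup>2) * b i) / (1 - c\<^sup>2)"
    unfolding ts_def times_divide_eq_right add_divide_distrib[symmetric]
    using i by (simp add: algebra_simps power2_eq_square)
  then show ?thesis using c_square_lt by simp
qed

lemma x_rec': "x k = (\<Sum>i<p. a i * x (k - 1 - int i)) + e k"
  using x_rec[of k] causal_x causal_e by (cases "0 \<le> k") (auto simp: causal_def)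

lemma e_rec': "e k = \<rho> * e (k - 1) + v k"
  using e_rec[of k] causal_e causal_v by (cases "0 \<le> k") (auto simp: causal_def)

lemma ip_x_le: "ip x x n \<le> ip v v n / (fx.gap\<^sup>2 * fe.gap\<^sup>2)"
proof -
  have "ip x x n \<le> ip e e n / fx.gap\<^sup>2" by (rule fx.ip_le)
  also have "\<dots> \<le> (ip v v n / fe.gap\<^sup>2) / fx.gap\<^sup>2"
    by (intro divide_right_mono fe.ip_le) simp
  finally show ?thesis by (simp add: mult.commute)
qed

lemma slow_x: "slow v \<Longrightarrow> slow x"
  by (intro fx.slow_output fe.slow_output)

text \<open>
  Solve the recursion at time \<open>k - 1\<close> for the noise and insert it into the noise recursion at time \<open>k\<close>.
\<close>

lemma autoregressive_form:
  "x k = (\<Sum>i<p. b i * x (k - 1 - int i)) - c * x (k - 1 - int p) + v k"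
proof -
  obtain q where q: "p = Suc q" using p_pos by (cases p) auto
  have 1: "e k = x k - (\<Sum>i<p. a i * x (k - 1 - int i))" for k
    using x_rec'[of k] by simp
  have "x k = (\<Sum>i<p. a i * x (k - 1 - int i))
      + \<rho> * (x (k - 1) - (\<Sum>i<p. a i * x (k - 1 - 1 - int i))) + v k"
    using x_rec'[of k] e_rec'[of k] 1[of "k - 1"] by simp
  moreover have "(\<Sum>i<p. b i * x (k - 1 - int i)) = (\<Sum>i<p. a i * x (k - 1 - int i))
      + \<rho> * x (k - 1) - \<rho> * (\<Sum>i<q. a i * x (k - 1 - 1 - int i))"
    unfolding q sum.lessThan_Suc_shift
    by (simp add: b_def algebra_simps sum.distrib sum_subtractf sum_distrib_left)
  moreover have "(\<Sum>i<p. a i * x (k - 1 - 1 - int i))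
      = (\<Sum>i<q. a i * x (k - 1 - 1 - int i)) + a q * x (k - 1 - int p)"
    by (simp add: q algebra_simps)
  moreover have "c = \<rho> * a q" unfolding c_def by (simp add: q)
  ultimately show ?thesis by (simp add: algebra_simps)
qed

text \<open>
  \<open>E\<close> is the error in predicting \<open>x\<^sub>k\<close> from \<open>x\<^sub>k\<^sub>-\<^sub>1, \<dots>, x\<^sub>k\<^sub>-\<^sub>p\<close>, and \<open>B\<close> the error in predicting \<open>x\<^sub>k\<^sub>-\<^sub>p\<^sub>-\<^sub>1\<close> from the
  same \<open>p\<close> values, with the coefficients in reverse order. Writing both with one coefficient family \<open>tc\<close> makes
  \<open>B\<close> the image of \<open>E\<close> under the reflection \<open>l \<mapsto> p + 1 - l\<close> of lags.
\<close>

definition tc :: "nat \<Rightarrow> real" where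
  "tc l = (if l = 0 then 1 else - ts (l - 1))"

definition E :: "int \<Rightarrow> real" where
  "E k = (\<Sum>l\<le>p. tc l * lag l x k)"

definition B :: "int \<Rightarrow> real" where
  "B k = (\<Sum>l\<le>p. tc l * lag (p + 1 - l) x k)"

lemma sum_tc: "(\<Sum>l\<le>p. tc l * F l) = F 0 - (\<Sum>i<p. ts i * F (Suc i))"
  by (simp add: sum.atMost_shift tc_def sum_negf)

lemma E_eq: "E k = x k - (\<Sum>i<p. ts i * x (k - 1 - int i))"
  unfolding E_def sum_tc by (simp add: lag_def algebra_simps)

lemma B_eq: "B k = x (k - 1 - int p) - (\<Sum>i<p. ts (p - 1 - i) * x (k - 1 - int i))"
proof -
  have "(\<Sum>i<p. ts (p - 1 - i) * x (k - 1 - int i))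
      = (\<Sum>i<p. ts (p - Suc i) * lag (p + 1 - Suc (p - Suc i)) x k)"
    by (rule sum.cong) (auto simp: lag_def algebra_simps of_nat_diff)
  also have "\<dots> = (\<Sum>i<p. ts i * lag (p + 1 - Suc i) x k)"
    by (rule sum.nat_diff_reindex)
  finally show ?thesis unfolding B_def sum_tc by (simp add: lag_def algebra_simps)
qed

text \<open>
  By \<open>ts_reflected\<close>, replacing the coefficients \<open>ts\<close> by those of the autoregression of order \<open>p + 1\<close> changes
  the prediction error by \<open>c B\<close>.
\<close>

lemma E_innovation: "E k = v k - c * B k"
proof -
  have "b i - ts i = c * ts (p - 1 - i)" if "i < p" for i
    using ts_reflected[OF that] by simp
  then have "(\<Sum>i<p. b i * x (k - 1 - int i)) - (\<Sum>i<p. ts i * x (k - 1 - int i))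
      = c * (\<Sum>i<p. ts (p - 1 - i) * x (k - 1 - int i))"
    by (simp add: sum_distrib_left flip: sum_subtractf left_diff_distrib mult.assoc)
  then show ?thesis
    unfolding E_eq B_eq by (subst autoregressive_form) (simp add: algebra_simps)
qed

lemma causal_E: "causal E"
  using causal_x by (auto simp: causal_def E_eq)

end

text \<open>
  The two strong laws on which the analysis of a single trajectory rests.
\<close>

locale autoregression_lln = autoregression +
  fixes s2 :: real
  assumes s2_pos: "0 < s2"
    and mean_square_v: "(\<lambda>n. ip v v n / real n) \<longlonglongrightarrow> s2"
    and v_orthogonal: "\<And>j. 1 \<le> j \<Longrightarrow> j \<le> p + 1 \<Longrightarrow> negl (ip v (lag j x))"
begin

lemma slow_v: "slow v"
  using mean_square_v by (rule slow_of_mean_square)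

lemma slow_path: "slow x"
  by (rule slow_x[OF slow_v])

definition r :: "nat \<Rightarrow> nat \<Rightarrow> nat \<Rightarrow> real" where
  "r i j = ip (lag i x) (lag j x)"

text \<open>
  The Toeplitz property together with the symmetry of the inner product: replacing both lags by their
  mirror images \<open>l \<mapsto> m - l\<close> does not change the covariance, up to \<open>o(n)\<close>.
\<close>

lemma r_near:
  assumes "i + i' = j + j'"
  shows "near (r i j) (r i' j')"
proof -
  have *: "near (r i j) (r (i + m) (j + m))" for i j m
    unfolding r_def by (rule ip_shift_near[OF causal_x slow_path slow_path])
  have sym: "r i j = r j i" for i j by (simp add: r_def fun_eq_iff ip_commute)
  show ?thesis
  proof (cases "i \<le> j'")
    case True
    then have "i' = j + (j' - i)" "j' = i + (j' - i)" using assms by auto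
    then show ?thesis using *[of i j "j' - i"] sym by metis
  next
    case False
    then have "i = j' + (i - j')" "j = i' + (i - j')" using assms by auto
    then show ?thesis using *[of j' i' "i - j'"] sym near_sym by metis
  qed
qed

lemma E_ip: "ip f E n = (\<Sum>l\<le>p. tc l * ip f (lag l x) n)"
  unfolding E_def[abs_def] by (rule ip_sum_right)

lemma B_ip: "ip f B n = (\<Sum>l\<le>p. tc l * ip f (lag (p + 1 - l) x) n)"
  unfolding B_def[abs_def] by (rule ip_sum_right)

lemma E_ip_innovation: "ip f E n = ip f v n - c * ip f B n"
  unfolding E_innovation[abs_def] by (simp add: ip_linear)

lemma lag_B_near:
  assumes "j \<le> p + 1"
  shows "near (ip (lag j x) B) (ip (lag (p + 1 - j) x) E)"
  unfolding E_ip[abs_def] B_ip[abs_def]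
  using r_near[unfolded r_def] assms by (intro near_sum near_cmult) auto

text \<open>
  Pairing \<open>E = v - c B\<close> with \<open>x\<^sub>k\<^sub>-\<^sub>j\<close> and reflecting gives \<open>e\<^sub>j = - c e\<^sub>p\<^sub>+\<^sub>1\<^sub>-\<^sub>j\<close> up to \<open>o(n)\<close>. The reflection is an involution,
  so \<open>(1 - c\<^sup>2) e\<^sub>j\<close> is negligible.
\<close>

lemma E_orthogonal:
  assumes j: "1 \<le> j" "j \<le> p"
  shows "negl (ip (lag j x) E)"
proof -
  have *: "negl (\<lambda>n. ip (lag j x) E n + c * ip (lag (p + 1 - j) x) E n)" if "1 \<le> j" "j \<le> p" for j
  proof -
    have "near (\<lambda>n. ip (lag j x) v n - c * ip (lag j x) B n)
        (\<lambda>n. 0 - c * ip (lag (p + 1 - j) x) E n)"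
      using v_orthogonal[of j] lag_B_near[of j] that
      by (intro near_diff near_cmult) (auto simp: near_zero_iff ip_commute[of "lag j x" v, abs_def])
    then show ?thesis by (simp add: near_def E_ip_innovation[of "lag j x"])
  qed
  have "negl (\<lambda>n. (ip (lag j x) E n + c * ip (lag (p + 1 - j) x) E n)
      - c * (ip (lag (p + 1 - j) x) E n + c * ip (lag (p + 1 - (p + 1 - j)) x) E n))"
    using j by (intro negl_diff negl_cmult *) auto
  also have "(\<lambda>n. (ip (lag j x) E n + c * ip (lag (p + 1 - j) x) E n)
      - c * (ip (lag (p + 1 - j) x) E n + c * ip (lag (p + 1 - (p + 1 - j)) x) E n))
      = (\<lambda>n. (1 - c\<^sup>2) * ip (lag j x) E n)"
    using j by (simp add: fun_eq_iff algebra_simps power2_eq_square)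
  finally show ?thesis using c_square_lt by (simp add: negl_cmult_iff)
qed

lemma v_B_negl: "negl (ip v B)"
  unfolding B_ip[abs_def] by (intro negl_sum negl_cmult v_orthogonal) auto

lemma lag_B_negl: "1 \<le> j \<Longrightarrow> j \<le> p \<Longrightarrow> negl (ip (lag j x) B)"
  by (rule near_negl[OF lag_B_near E_orthogonal]) auto

lemma B_mean_square_near: "near (ip B B) (ip E E)"
proof -
  have 1: "ip B B n = (\<Sum>l\<le>p. tc l * (\<Sum>m\<le>p. tc m * r (p + 1 - l) (p + 1 - m) n))" for n
    by (subst B_ip, subst ip_commute, subst B_ip) (simp add: r_def ip_commute)
  have 2: "ip E E n = (\<Sum>l\<le>p. tc l * (\<Sum>m\<le>p. tc m * r l m n))" for n
    by (subst E_ip, subst ip_commute, subst E_ip) (simp add: r_def ip_commute)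
  show ?thesis unfolding 1[abs_def] 2[abs_def]
    by (intro near_sum near_cmult r_near) auto
qed

text \<open>
  Expand the square of \<open>E = v - c B\<close>: the cross term is negligible, and \<open>B\<close> has the same mean square as \<open>E\<close>.
\<close>

lemma E_mean_square: "(\<lambda>n. ip E E n / real n) \<longlonglongrightarrow> s2 / (1 - c\<^sup>2)"
proof -
  have "ip E E n = ip v v n - c * (2 * ip v B n) + c\<^sup>2 * ip B B n" for n
    unfolding E_innovation[abs_def] by (simp add: ip_linear ip_commute[of B v] power2_eq_square algebra_simps)
  then have "(\<lambda>n. (1 - c\<^sup>2) * ip E E n) = (\<lambda>n. ip v v n - c * (2 * ip v B n) + c\<^sup>2 * (ip B B n - ip E E n))"
    by (simp add: fun_eq_iff algebra_simps)
  moreover have "near (\<lambda>n. ip v v n - c * (2 * ip v B n) + c\<^sup>2 * (ip B B n - ip E E n))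
      (\<lambda>n. s2 * real n - 0 + 0)"
  proof (rule near_add[OF near_diff])
    show "near (ip v v) (\<lambda>n. s2 * real n)"
      unfolding near_linear_iff by (rule mean_square_v)
    show "near (\<lambda>n. c * (2 * ip v B n)) (\<lambda>n. 0)"
      unfolding near_zero_iff by (rule negl_cmult[OF negl_cmult[OF v_B_negl]])
    show "near (\<lambda>n. c\<^sup>2 * (ip B B n - ip E E n)) (\<lambda>n. 0)"
      unfolding near_zero_iff by (rule negl_cmult[OF B_mean_square_near[unfolded near_def]])
  qed
  ultimately have "near (\<lambda>n. (1 - c\<^sup>2) * ip E E n) (\<lambda>n. s2 * real n)"
    by (simp only: diff_0_right add_0_right)
  then have "(\<lambda>n. (1 - c\<^sup>2) * ip E E n / real n) \<longlonglongrightarrow> s2"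
    unfolding near_linear_iff .
  then have "(\<lambda>n. ((1 - c\<^sup>2) * ip E E n / real n) / (1 - c\<^sup>2)) \<longlonglongrightarrow> s2 / (1 - c\<^sup>2)"
    using c_square_lt by (intro tendsto_divide tendsto_const) auto
  then show ?thesis using c_square_lt by simp
qed

text \<open>
  Of the lagged error, only its oldest term \<open>- ts (p - 1) * x\<^sub>k\<^sub>-\<^sub>p\<^sub>-\<^sub>1\<close> is correlated with \<open>E\<close>. In the correlation
  of \<open>E\<close> with \<open>x\<^sub>k\<^sub>-\<^sub>p\<^sub>-\<^sub>1\<close> the latter may be replaced by \<open>B\<close>, and \<open>E = v - c B\<close> with \<open>v\<close> orthogonal to \<open>B\<close>.
\<close>

lemma E_autocovariance: "near (ip E (lag 1 E)) (\<lambda>n. ts (p - 1) * c * ip E E n)"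
proof -
  define \<kappa> where "\<kappa> = ip E (lag (p + 1) x)"
  have orth: "negl (ip E (lag j x))" if "1 \<le> j" "j \<le> p" for j
    using E_orthogonal[OF that] by (simp add: ip_commute[of E, abs_def])
  have 1: "ip E (lag 1 E) n = (\<Sum>l\<le>p. tc l * ip E (lag (Suc l) x) n)" for n
  proof -
    have "lag 1 E = (\<lambda>k. \<Sum>l\<le>p. tc l * lag (Suc l) x k)"
      by (simp add: fun_eq_iff lag_def E_def algebra_simps)
    then show ?thesis by (simp add: ip_sum_right)
  qed
  have "near (ip E (lag 1 E)) (\<lambda>n. tc p * \<kappa> n)"
  proof -
    have "near (\<lambda>n. (\<Sum>l<p. tc l * ip E (lag (Suc l) x) n) + tc p * \<kappa> n) (\<lambda>n. 0 + tc p * \<kappa> n)"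
      by (intro near_add near_refl) (auto simp: near_zero_iff intro!: negl_sum negl_cmult orth)
    then show ?thesis unfolding 1[abs_def] by (simp add: lessThan_Suc_atMost[symmetric] \<kappa>_def)
  qed
  also have "near (\<lambda>n. tc p * \<kappa> n) (\<lambda>n. tc p * ip E B n)"
  proof -
    have "near (\<lambda>n. \<kappa> n - (\<Sum>i<p. ts i * ip E (lag (p + 1 - Suc i) x) n)) (\<lambda>n. \<kappa> n - 0)"
      by (intro near_diff near_refl) (auto simp: near_zero_iff intro!: negl_sum negl_cmult orth)
    then have "near (ip E B) \<kappa>"
      unfolding B_ip[abs_def] sum_tc by (simp add: \<kappa>_def)
    then show ?thesis by (rule near_cmult[OF near_sym])
  qed
  also have "near \<dots> (\<lambda>n. tc p * (0 - c * ip E E n))"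
    unfolding ip_commute[of E B] E_ip_innovation[of B]
    using v_B_negl B_mean_square_near
    by (intro near_cmult near_diff) (auto simp: near_zero_iff ip_commute[of B v])
  finally show ?thesis using p_pos by (simp add: tc_def mult.assoc)
qed

end

context autoregression_lln
begin

lemma quadratic_growth:
  obtains C where "0 < C" "\<And>n. 1 \<le> n \<Longrightarrow> ip v v n \<le> C * real n" "\<And>n. 1 \<le> n \<Longrightarrow> ip x x n \<le> C * real n"
proof -
  obtain K where K: "K > 0" "\<And>n. norm (ip v v n / real n) \<le> K"
    using convergent_imp_Bseq[OF convergentI[OF mean_square_v]] by (auto simp: Bseq_def)
  define g where "g = fx.gap\<^sup>2 * fe.gap\<^sup>2"
  have g: "g > 0" using fx.gap_pos fe.gap_pos by (simp add: g_def)
  have v: "ip v v n \<le> K * real n" if "1 \<le> n" for n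
    using K(2)[of n] that ip_self_nonneg[of v n] by (simp add: field_simps)
  have x: "ip x x n \<le> K / g * real n" if "1 \<le> n" for n
  proof -
    have "ip x x n \<le> ip v v n / g" using ip_x_le[of n] by (simp add: g_def)
    also have "\<dots> \<le> K * real n / g" using v[OF that] g by (intro divide_right_mono) auto
    finally show ?thesis by simp
  qed
  show ?thesis
  proof (rule that[of "max K (K / g)"])
    show "ip v v n \<le> max K (K / g) * real n" if "1 \<le> n" for n
      using v[OF that] by (rule order_trans) (intro mult_right_mono, auto)
    show "ip x x n \<le> max K (K / g) * real n" if "1 \<le> n" for n
      using x[OF that] by (rule order_trans) (intro mult_right_mono, auto)
  qed (use K(1) in auto)
qed

lemma innovation_x_near: "near (ip v x) (\<lambda>n. s2 * real n)"
proof -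
  have "x = (\<lambda>k. (\<Sum>i<p. b i * lag (Suc i) x k) - c * lag (Suc p) x k + v k)"
    by (rule ext, subst autoregressive_form) (simp add: lag_def algebra_simps)
  then have "ip v x n = ip v (\<lambda>k. (\<Sum>i<p. b i * lag (Suc i) x k) - c * lag (Suc p) x k + v k) n" for n
    by (rule arg_cong)
  then have "ip v x = (\<lambda>n. (\<Sum>i<p. b i * ip v (lag (Suc i) x) n) - c * ip v (lag (Suc p) x) n + ip v v n)"
    by (intro ext) (simp only: ip_linear)
  moreover have "near (\<lambda>n. (\<Sum>i<p. b i * ip v (lag (Suc i) x) n) - c * ip v (lag (Suc p) x) n + ip v v n)
      (\<lambda>n. 0 - 0 + s2 * real n)"
  proof (rule near_add[OF near_diff])
    show "near (\<lambda>n. \<Sum>i<p. b i * ip v (lag (Suc i) x) n) (\<lambda>n. 0)"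
      unfolding near_zero_iff by (rule negl_sum, rule negl_cmult, rule v_orthogonal) auto
    show "near (\<lambda>n. c * ip v (lag (Suc p) x) n) (\<lambda>n. 0)"
      unfolding near_zero_iff by (rule negl_cmult, rule v_orthogonal) auto
    show "near (ip v v) (\<lambda>n. s2 * real n)"
      unfolding near_linear_iff by (rule mean_square_v)
  qed
  ultimately show ?thesis by (simp only: diff_0_right add_0_left)
qed

lemma lag_innovation_near:
  assumes "j \<le> i"
  shows "near (ip (lag (Suc j) v) (lag (Suc i) x)) (ip v (lag (i - j) x))"
  using ip_shift_near[OF causal_v slow_v slow_path, of 0 "i - j" "Suc j"] assms
  by (simp add: near_sym)

definition lincomb :: "(nat \<Rightarrow> real) \<Rightarrow> int \<Rightarrow> real" where
  "lincomb w k = (\<Sum>i<p. w i * lag (Suc i) x k)"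

lemma ip_lincomb: "ip f (lincomb w) n = (\<Sum>i<p. w i * ip f (lag (Suc i) x) n)"
  unfolding lincomb_def[abs_def] by (rule ip_sum_right)

text \<open>
  Pairing a combination \<open>\<Sum>i<p. w i * x\<^sub>k\<^sub>-\<^sub>1\<^sub>-\<^sub>i\<close> with the innovation \<open>v\<^sub>k\<^sub>-\<^sub>1\<^sub>-\<^sub>j\<close> isolates \<open>w j\<close>: the pairing with \<open>x\<^sub>k\<^sub>-\<^sub>1\<^sub>-\<^sub>i\<close> is
  about \<open>s2 * n\<close> for \<open>i = j\<close>, negligible for \<open>i > j\<close> and of order \<open>n\<close> for \<open>i < j\<close>. The coordinates are therefore
  bounded one after the other, up to an arbitrarily small multiple \<open>\<eta>\<close> of their total size.
\<close>

lemma excitation_step: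
  assumes "j \<le> p" "0 < \<eta>"
  shows "\<exists>K\<ge>0. \<forall>\<^sub>F n in sequentially. \<forall>w.
    (\<Sum>i<j. \<bar>w i\<bar>) \<le> K * sqrt (ip (lincomb w) (lincomb w) n / real n) + \<eta> * (\<Sum>i<p. \<bar>w i\<bar>)"
  using assms
proof (induction j arbitrary: \<eta>)
  case 0
  then show ?case by (intro exI[of _ 0]) (simp add: sum_nonneg)
next
  case (Suc j)
  obtain C where C: "0 < C" "\<And>n. 1 \<le> n \<Longrightarrow> ip v v n \<le> C * real n" "\<And>n. 1 \<le> n \<Longrightarrow> ip x x n \<le> C * real n"
    using quadratic_growth by metis
  define D where "D = 2 / s2"
  have D: "D > 0" using s2_pos by (simp add: D_def)
  (* The induction hypothesis is used with eta1 and the negligible pairings are bounded by eta2; both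
     are chosen so that the two errors, multiplied by the constants of the step, amount to eta / 2 each. *)
  define \<eta>1 where "\<eta>1 = \<eta> / (2 * (1 + D * C))"
  define \<eta>2 where "\<eta>2 = \<eta> / (2 * D)"
  have pos: "\<eta>1 > 0" "\<eta>2 > 0" "1 + D * C > 0" using Suc.prems D C(1)
    by (auto simp: \<eta>1_def \<eta>2_def add_pos_pos)
  obtain K1 where K1: "K1 \<ge> 0" "\<forall>\<^sub>F n in sequentially. \<forall>w.
    (\<Sum>i<j. \<bar>w i\<bar>) \<le> K1 * sqrt (ip (lincomb w) (lincomb w) n / real n) + \<eta>1 * (\<Sum>i<p. \<bar>w i\<bar>)"
    using Suc.IH[of \<eta>1] Suc.prems pos by auto
  define z where "z i n = ip (lag (Suc j) v) (lag (Suc i) x) n" for i n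
  have diag: "\<forall>\<^sub>F n in sequentially. z j n / real n > s2 / 2"
  proof -
    have "near (z j) (\<lambda>n. s2 * real n)"
      using near_trans[OF lag_innovation_near[of j j] ] innovation_x_near by (simp add: z_def[abs_def])
    then have "(\<lambda>n. z j n / real n) \<longlonglongrightarrow> s2" by (simp only: near_linear_iff)
    then show ?thesis by (rule order_tendstoD) (use s2_pos in simp)
  qed
  have off: "\<forall>\<^sub>F n in sequentially. \<bar>z i n\<bar> / real n < \<eta>2" if "j < i" "i < p" for i
  proof -
    have "negl (z i)" unfolding z_def[abs_def]
      by (rule near_negl[OF lag_innovation_near v_orthogonal]) (use that in auto)
    then have "(\<lambda>n. \<bar>z i n\<bar> / real n) \<longlonglongrightarrow> 0" using negl_abs by (simp add: negl_def)
    then show ?thesis by (rule order_tendstoD) (use pos in simp)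
  qed
  have off': "\<forall>\<^sub>F n in sequentially. \<forall>i\<in>{j<..<p}. \<bar>z i n\<bar> / real n < \<eta>2"
    by (intro eventually_ball_finite) (use off in auto)
  have CS: "\<bar>ip (lag (Suc j) v) f n\<bar> / real n \<le> sqrt C * sqrt (ip f f n / real n)" if "1 \<le> n" for f n
  proof -
    have "\<bar>ip (lag (Suc j) v) f n\<bar> \<le> sqrt (ip (lag (Suc j) v) (lag (Suc j) v) n) * sqrt (ip f f n)"
      by (rule ip_Cauchy_Schwarz)
    also have "\<dots> \<le> sqrt (C * real n) * sqrt (ip f f n)"
      using ip_lag_self_le[OF causal_v, of "Suc j" n] C(2)[OF that] ip_self_nonneg
      by (intro mult_right_mono real_sqrt_le_mono) auto
    finally have "\<bar>ip (lag (Suc j) v) f n\<bar> / real n \<le> sqrt (C * real n) * sqrt (ip f f n) / real n"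
      by (intro divide_right_mono) auto
    also have "\<dots> = sqrt C * sqrt (ip f f n / real n)"
      using that by (simp add: real_sqrt_mult real_sqrt_divide field_simps)
    finally show ?thesis .
  qed
  have zC: "\<bar>z i n\<bar> / real n \<le> C" if "1 \<le> n" for i n
  proof -
    have "\<bar>z i n\<bar> / real n \<le> sqrt C * sqrt (ip (lag (Suc i) x) (lag (Suc i) x) n / real n)"
      unfolding z_def by (rule CS[OF that])
    also have "\<dots> \<le> sqrt C * sqrt C"
      using ip_lag_self_le[OF causal_x, of "Suc i" n] C(3)[OF that] C(1) that
      by (intro mult_left_mono real_sqrt_le_mono) (auto simp: field_simps)
    finally show ?thesis using C(1) by simp
  qed
  define K where "K = K1 + D * (sqrt C + C * K1)"
  have "\<forall>\<^sub>F n in sequentially. \<forall>w. (\<Sum>i<Suc j. \<bar>w i\<bar>)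
      \<le> K * sqrt (ip (lincomb w) (lincomb w) n / real n) + \<eta> * (\<Sum>i<p. \<bar>w i\<bar>)"
    using K1(2) diag off' eventually_ge_at_top[of 1]
  proof eventually_elim
    case (elim n)
    show ?case
    proof
      fix w :: "nat \<Rightarrow> real"
      define m where "m = (\<Sum>i<p. \<bar>w i\<bar>)"
      define Q where "Q = sqrt (ip (lincomb w) (lincomb w) n / real n)"
      define s where "s = (\<Sum>i<j. \<bar>w i\<bar>)"
      have s: "s \<le> K1 * Q + \<eta>1 * m" using elim(1) by (simp add: s_def Q_def m_def)
      have j: "j < p" using Suc.prems by simp
      have split: "(\<Sum>i<p. F i) = (\<Sum>i<j. F i) + F j + (\<Sum>i\<in>{j<..<p}. F i)" for F :: "nat \<Rightarrow> real"
      proof -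
        have "{..<p} = insert j ({..<j} \<union> {j<..<p})" using j by auto
        moreover have "sum F ({..<j} \<union> {j<..<p}) = sum F {..<j} + sum F {j<..<p}"
          by (rule sum.union_disjoint) auto
        ultimately show ?thesis by simp
      qed
      have "w j * z j n = ip (lag (Suc j) v) (lincomb w) n
          - (\<Sum>i<j. w i * z i n) - (\<Sum>i\<in>{j<..<p}. w i * z i n)"
        unfolding ip_lincomb z_def[symmetric] split[of "\<lambda>i. w i * z i n"] by simp
      then have "\<bar>w j\<bar> * (z j n / real n) \<le> (\<bar>ip (lag (Suc j) v) (lincomb w) n\<bar>
          + \<bar>\<Sum>i<j. w i * z i n\<bar> + \<bar>\<Sum>i\<in>{j<..<p}. w i * z i n\<bar>) / real n"
        using elim(2) s2_pos elim(4)
        by (simp add: divide_simps flip: abs_mult)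
      also have "\<dots> = \<bar>ip (lag (Suc j) v) (lincomb w) n\<bar> / real n
          + \<bar>\<Sum>i<j. w i * z i n\<bar> / real n + \<bar>\<Sum>i\<in>{j<..<p}. w i * z i n\<bar> / real n"
        by (simp add: add_divide_distrib)
      also have "\<bar>\<Sum>i<j. w i * z i n\<bar> / real n \<le> (\<Sum>i<j. \<bar>w i\<bar> * C)"
      proof -
        have "\<bar>\<Sum>i<j. w i * z i n\<bar> / real n \<le> (\<Sum>i<j. \<bar>w i * z i n\<bar>) / real n"
          by (intro divide_right_mono sum_abs) auto
        also have "\<dots> = (\<Sum>i<j. \<bar>w i\<bar> * (\<bar>z i n\<bar> / real n))"
          by (simp add: sum_divide_distrib abs_mult)
        also have "\<dots> \<le> (\<Sum>i<j. \<bar>w i\<bar> * C)"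
          using zC elim(4) by (intro sum_mono mult_left_mono) auto
        finally show ?thesis .
      qed
      also have "\<bar>\<Sum>i\<in>{j<..<p}. w i * z i n\<bar> / real n \<le> m * \<eta>2"
      proof -
        have "\<bar>\<Sum>i\<in>{j<..<p}. w i * z i n\<bar> / real n \<le> (\<Sum>i\<in>{j<..<p}. \<bar>w i * z i n\<bar>) / real n"
          by (intro divide_right_mono sum_abs) auto
        also have "\<dots> = (\<Sum>i\<in>{j<..<p}. \<bar>w i\<bar> * (\<bar>z i n\<bar> / real n))"
          by (simp add: sum_divide_distrib abs_mult)
        also have "\<dots> \<le> (\<Sum>i\<in>{j<..<p}. \<bar>w i\<bar> * \<eta>2)"
          using elim(3) by (intro sum_mono mult_left_mono) (auto simp: less_imp_le)
        also have "\<dots> \<le> (\<Sum>i<p. \<bar>w i\<bar> * \<eta>2)"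
          using pos by (intro sum_mono2) auto
        finally show ?thesis by (simp add: m_def sum_distrib_right)
      qed
      also have "\<bar>ip (lag (Suc j) v) (lincomb w) n\<bar> / real n \<le> sqrt C * Q"
        unfolding Q_def using CS elim(4) by simp
      finally have 1: "\<bar>w j\<bar> * (z j n / real n) \<le> sqrt C * Q + s * C + m * \<eta>2"
        by (simp add: s_def sum_distrib_right)
      have "\<bar>w j\<bar> * (s2 / 2) \<le> \<bar>w j\<bar> * (z j n / real n)"
        using elim(2) by (intro mult_left_mono) auto
      also note 1
      finally have "D * (\<bar>w j\<bar> * (s2 / 2)) \<le> D * (sqrt C * Q + s * C + m * \<eta>2)"
        using D by (intro mult_left_mono) auto
      then have "\<bar>w j\<bar> \<le> D * (sqrt C * Q + s * C + m * \<eta>2)" using s2_pos by (simp add: D_def)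
      then have "s + \<bar>w j\<bar> \<le> s * (1 + D * C) + D * sqrt C * Q + D * \<eta>2 * m"
        by (simp add: algebra_simps)
      also have "\<dots> \<le> (K1 * Q + \<eta>1 * m) * (1 + D * C) + D * sqrt C * Q + D * \<eta>2 * m"
        using s pos by (intro add_right_mono mult_right_mono) auto
      also have "\<dots> = K * Q + (\<eta>1 * (1 + D * C) + D * \<eta>2) * m"
        by (simp add: K_def algebra_simps)
      also have "\<eta>1 * (1 + D * C) = \<eta> / 2" using pos(3) unfolding \<eta>1_def by (simp add: field_simps)
      also have "D * \<eta>2 = \<eta> / 2" using D unfolding \<eta>2_def by simp
      finally have "s + \<bar>w j\<bar> \<le> K * Q + \<eta> * m" by simp
      then show "(\<Sum>i<Suc j. \<bar>w i\<bar>) \<le> K * sqrt (ip (lincomb w) (lincomb w) n / real n) + \<eta> * (\<Sum>i<p. \<bar>w i\<bar>)"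
        by (simp add: s_def Q_def m_def)
    qed
  qed
  moreover have "K \<ge> 0" using K1(1) C(1) D by (simp add: K_def)
  ultimately show ?case by blast
qed

text \<open>
  The Gram matrix of the regressors is eventually at least a multiple of \<open>n\<close> in every direction at once; this
  uniformity matters because it is applied to the estimation error, which changes with \<open>n\<close>.
\<close>

lemma persistent_excitation:
  obtains K where "0 < K" "\<forall>\<^sub>F n in sequentially. \<forall>w.
    (\<Sum>i<p. \<bar>w i\<bar>)\<^sup>2 * real n \<le> K * ip (lincomb w) (lincomb w) n"
proof -
  obtain K where K: "K \<ge> 0" "\<forall>\<^sub>F n in sequentially. \<forall>w.
    (\<Sum>i<p. \<bar>w i\<bar>) \<le> K * sqrt (ip (lincomb w) (lincomb w) n / real n) + 1/2 * (\<Sum>i<p. \<bar>w i\<bar>)"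
    using excitation_step[of p "1/2"] by auto
  show ?thesis
  proof (rule that[of "4 * K\<^sup>2 + 1"])
    show "\<forall>\<^sub>F n in sequentially. \<forall>w. (\<Sum>i<p. \<bar>w i\<bar>)\<^sup>2 * real n \<le> (4 * K\<^sup>2 + 1) * ip (lincomb w) (lincomb w) n"
      using K(2) eventually_ge_at_top[of 1]
    proof eventually_elim
      case (elim n)
      show ?case
      proof
        fix w :: "nat \<Rightarrow> real"
        have "(\<Sum>i<p. \<bar>w i\<bar>) \<le> 2 * K * sqrt (ip (lincomb w) (lincomb w) n / real n)"
          using spec[OF elim(1), of w] by simp
        then have "(\<Sum>i<p. \<bar>w i\<bar>)\<^sup>2 \<le> (2 * K * sqrt (ip (lincomb w) (lincomb w) n / real n))\<^sup>2"
          by (intro power_mono) (auto simp: sum_nonneg)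
        then have "(\<Sum>i<p. \<bar>w i\<bar>)\<^sup>2 * real n \<le> (4 * K\<^sup>2) * ip (lincomb w) (lincomb w) n"
          using elim(2) ip_self_nonneg[of "lincomb w" n]
          by (simp add: power_mult_distrib field_simps)
        then show "(\<Sum>i<p. \<bar>w i\<bar>)\<^sup>2 * real n \<le> (4 * K\<^sup>2 + 1) * ip (lincomb w) (lincomb w) n"
          using ip_self_nonneg[of "lincomb w" n] by (simp add: algebra_simps)
      qed
    qed
  qed (simp add: add_nonneg_pos)
qed

end

section \<open>Least squares and the Durbin-Watson statistic\<close>

text \<open>
  \<open>th n\<close> is the estimate at stage \<open>n\<close> and \<open>S0\<close> the matrix added to the Gram matrix of the regressors.
\<close>

locale least_squares_path = autoregression_lln +
  fixes S0 :: "nat \<Rightarrow> nat \<Rightarrow> real" and th :: "nat \<Rightarrow> nat \<Rightarrow> real"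
  assumes S0_nonneg: "\<And>w. 0 \<le> (\<Sum>i<p. w i * (\<Sum>j<p. S0 i j * w j))"
    and normal_eq: "\<And>n i. 1 \<le> n \<Longrightarrow> i < p \<Longrightarrow>
      (\<Sum>j<p. (ip (lag (Suc i) x) (lag (Suc j) x) n + S0 i j) * th n j) = ip (lag (Suc i) x) x n"
begin

definition \<delta> :: "nat \<Rightarrow> nat \<Rightarrow> real" where
  "\<delta> n i = th n i - ts i"

abbreviation P :: "nat \<Rightarrow> int \<Rightarrow> real" where
  "P n \<equiv> lincomb (\<delta> n)"

definition m :: "nat \<Rightarrow> real" where
  "m n = (\<Sum>i<p. \<bar>\<delta> n i\<bar>)"

definition bias :: "nat \<Rightarrow> real" where
  "bias i = (\<Sum>j<p. S0 i j * ts j)"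

definition res :: "nat \<Rightarrow> int \<Rightarrow> real" where
  "res n k = x k - (\<Sum>i<p. th n i * x (k - 1 - int i))"

lemma m_nonneg: "0 \<le> m n"
  by (simp add: m_def sum_nonneg)

lemma res_eq: "res n k = E k - P n k"
  by (simp add: res_def E_eq lincomb_def \<delta>_def lag_def algebra_simps sum_subtractf)

text \<open>
  The normal equations for the estimation error \<open>\<delta> n\<close>: the predictor \<open>ts\<close> solves them up to its correlations
  with \<open>E\<close> and up to the bias caused by \<open>S0\<close>.
\<close>

lemma normal_eq_error:
  assumes "1 \<le> n" "i < p"
  shows "ip (lag (Suc i) x) (P n) n + (\<Sum>j<p. S0 i j * \<delta> n j) = ip (lag (Suc i) x) E n - bias i"
proof -
  have 1: "ip (lag (Suc i) x) E n = ip (lag (Suc i) x) x n - (\<Sum>j<p. ts j * ip (lag (Suc i) x) (lag (Suc j) x) n)"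
    unfolding E_ip sum_tc by simp
  have 2: "(\<Sum>j<p. \<delta> n j * ip (lag (Suc i) x) (lag (Suc j) x) n) + (\<Sum>j<p. S0 i j * \<delta> n j)
      = (\<Sum>j<p. (ip (lag (Suc i) x) (lag (Suc j) x) n + S0 i j) * th n j)
        - (\<Sum>j<p. ts j * ip (lag (Suc i) x) (lag (Suc j) x) n) - bias i"
    unfolding bias_def \<delta>_def sum.distrib[symmetric] sum_subtractf[symmetric]
    by (rule sum.cong) (simp_all add: algebra_simps)
  show ?thesis unfolding ip_lincomb 2 normal_eq[OF assms] 1 by simp
qed

text \<open>
  Multiply the normal equations by the estimation error itself and sum. The left-hand side becomes a
  quadratic form, bounded below by persistent excitation, and the right-hand side is linear in the error.
\<close>

lemma estimation_error_bound:
  obtains K where "0 < K" "\<forall>\<^sub>F n in sequentially.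
    m n * real n \<le> K * (\<Sum>i<p. \<bar>ip (lag (Suc i) x) E n\<bar> + \<bar>bias i\<bar>)"
proof -
  obtain K where K: "0 < K" "\<forall>\<^sub>F n in sequentially. \<forall>w.
    (\<Sum>i<p. \<bar>w i\<bar>)\<^sup>2 * real n \<le> K * ip (lincomb w) (lincomb w) n"
    by (rule persistent_excitation)
  have "\<forall>\<^sub>F n in sequentially. m n * real n \<le> K * (\<Sum>i<p. \<bar>ip (lag (Suc i) x) E n\<bar> + \<bar>bias i\<bar>)"
    using K(2) eventually_ge_at_top[of 1]
  proof eventually_elim
    case (elim n)
    define s where "s = (\<Sum>i<p. \<bar>ip (lag (Suc i) x) E n\<bar> + \<bar>bias i\<bar>)"
    have s0: "s \<ge> 0" by (simp add: s_def sum_nonneg)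
    have "ip (P n) (P n) n = (\<Sum>i<p. \<delta> n i * ip (lag (Suc i) x) (P n) n)"
      by (subst (1) ip_lincomb) (simp add: ip_commute)
    also have "\<dots> = (\<Sum>i<p. \<delta> n i * (ip (lag (Suc i) x) E n - bias i - (\<Sum>j<p. S0 i j * \<delta> n j)))"
    proof (rule sum.cong)
      fix i assume "i \<in> {..<p}"
      then have "ip (lag (Suc i) x) (P n) n = ip (lag (Suc i) x) E n - bias i - (\<Sum>j<p. S0 i j * \<delta> n j)"
        using normal_eq_error[OF elim(2), of i] by simp
      then show "\<delta> n i * ip (lag (Suc i) x) (P n) n
          = \<delta> n i * (ip (lag (Suc i) x) E n - bias i - (\<Sum>j<p. S0 i j * \<delta> n j))" by simp
    qed simp
    also have "\<dots> = (\<Sum>i<p. \<delta> n i * (ip (lag (Suc i) x) E n - bias i)) - (\<Sum>i<p. \<delta> n i * (\<Sum>j<p. S0 i j * \<delta> n j))"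
      by (simp add: right_diff_distrib sum_subtractf)
    also have "\<dots> \<le> (\<Sum>i<p. \<delta> n i * (ip (lag (Suc i) x) E n - bias i))"
      using S0_nonneg[of "\<delta> n"] by simp
    also have "\<dots> \<le> (\<Sum>i<p. \<bar>\<delta> n i\<bar> * s)"
    proof (rule sum_mono)
      fix i assume i: "i \<in> {..<p}"
      have "\<bar>ip (lag (Suc i) x) E n\<bar> + \<bar>bias i\<bar> \<le> s"
        unfolding s_def by (rule member_le_sum[OF i]) auto
      then have "\<bar>ip (lag (Suc i) x) E n - bias i\<bar> \<le> s" by linarith
      then have "\<bar>\<delta> n i * (ip (lag (Suc i) x) E n - bias i)\<bar> \<le> \<bar>\<delta> n i\<bar> * s"
        unfolding abs_mult by (intro mult_left_mono) auto
      then show "\<delta> n i * (ip (lag (Suc i) x) E n - bias i) \<le> \<bar>\<delta> n i\<bar> * s" by linarith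
    qed
    also have "\<dots> = m n * s" by (simp add: m_def sum_distrib_right)
    finally have "K * ip (P n) (P n) n \<le> K * (m n * s)" using K(1) by (intro mult_left_mono) auto
    then have "m n * (m n * real n) \<le> m n * (K * s)"
      using spec[OF elim(1), of "\<delta> n"] by (simp add: m_def[symmetric] power2_eq_square algebra_simps)
    then show ?case unfolding s_def[symmetric]
      using m_nonneg[of n] K(1) s0 by (cases "m n = 0") auto
  qed
  with K(1) show ?thesis by (rule that)
qed

lemma m_tendsto_0: "m \<longlonglongrightarrow> 0"
proof -
  obtain K where K: "0 < K" "\<forall>\<^sub>F n in sequentially.
    m n * real n \<le> K * (\<Sum>i<p. \<bar>ip (lag (Suc i) x) E n\<bar> + \<bar>bias i\<bar>)"
    by (rule estimation_error_bound)
  have "negl (\<lambda>n. K * (\<Sum>i<p. \<bar>ip (lag (Suc i) x) E n\<bar> + \<bar>bias i\<bar>))"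
    by (rule negl_cmult, rule negl_sum, rule negl_add) (auto intro!: negl_abs E_orthogonal)
  then have lim: "(\<lambda>n. K * (\<Sum>i<p. \<bar>ip (lag (Suc i) x) E n\<bar> + \<bar>bias i\<bar>) / real n) \<longlonglongrightarrow> 0"
    by (simp add: negl_def)
  show ?thesis
  proof (rule tendsto_sandwich[OF _ _ tendsto_const lim])
    show "\<forall>\<^sub>F n in sequentially. m n \<le> K * (\<Sum>i<p. \<bar>ip (lag (Suc i) x) E n\<bar> + \<bar>bias i\<bar>) / real n"
      using K(2) eventually_ge_at_top[of 1] by eventually_elim (simp add: field_simps)
  qed (simp add: m_nonneg)
qed

lemma th_tendsto:
  assumes "i < p"
  shows "(\<lambda>n. th n i) \<longlonglongrightarrow> ts i"
proof -
  have "(\<lambda>n. th n i - ts i) \<longlonglongrightarrow> 0"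
  proof (rule tendsto_rabs_zero_cancel, rule tendsto_sandwich[OF _ _ tendsto_const m_tendsto_0])
    show "\<forall>\<^sub>F n in sequentially. \<bar>th n i - ts i\<bar> \<le> m n"
      unfolding m_def \<delta>_def using assms
      by (intro always_eventually allI member_le_sum[of i _ "\<lambda>i. \<bar>th _ i - ts i\<bar>"]) auto
  qed simp
  then show ?thesis by (simp add: LIM_zero_iff)
qed

lemma ip_P_bound:
  assumes "\<And>i. i < p \<Longrightarrow> \<bar>ip f (lag (Suc i) x) n\<bar> \<le> M"
  shows "\<bar>ip f (P n) n\<bar> \<le> m n * M"
proof -
  have "\<bar>ip f (P n) n\<bar> \<le> (\<Sum>i<p. \<bar>\<delta> n i * ip f (lag (Suc i) x) n\<bar>)"
    unfolding ip_lincomb by (rule sum_abs)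
  also have "\<dots> \<le> (\<Sum>i<p. \<bar>\<delta> n i\<bar> * M)"
    unfolding abs_mult using assms by (intro sum_mono mult_left_mono) auto
  finally show ?thesis by (simp add: m_def sum_distrib_right)
qed

lemma P_mean_square:
  obtains C where "0 < C" "\<And>n. 1 \<le> n \<Longrightarrow> ip (P n) (P n) n \<le> C * (m n)\<^sup>2 * real n"
proof -
  obtain C where C: "0 < C" "\<And>n. 1 \<le> n \<Longrightarrow> ip v v n \<le> C * real n" "\<And>n. 1 \<le> n \<Longrightarrow> ip x x n \<le> C * real n"
    using quadratic_growth by metis
  have "ip (P n) (P n) n \<le> C * (m n)\<^sup>2 * real n" if n: "1 \<le> n" for n
  proof -
    have r: "\<bar>ip (lag i x) (lag j x) n\<bar> \<le> C * real n" for i j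
    proof -
      have "\<bar>ip (lag i x) (lag j x) n\<bar> \<le> sqrt (ip (lag i x) (lag i x) n) * sqrt (ip (lag j x) (lag j x) n)"
        by (rule ip_Cauchy_Schwarz)
      also have "\<dots> \<le> sqrt (C * real n) * sqrt (C * real n)"
        using order_trans[OF ip_lag_self_le[OF causal_x] C(3)[OF n]] C(1)
        by (intro mult_mono real_sqrt_le_mono) (auto simp: ip_self_nonneg)
      finally show ?thesis using C(1) by simp
    qed
    have "\<bar>ip (P n) (lag (Suc i) x) n\<bar> \<le> m n * (C * real n)" for i
      unfolding ip_commute[of "P n"] by (rule ip_P_bound) (rule r)
    then have "\<bar>ip (P n) (P n) n\<bar> \<le> m n * (m n * (C * real n))" by (rule ip_P_bound)
    then show ?thesis by (simp add: power2_eq_square algebra_simps)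
  qed
  with C(1) show ?thesis by (rule that)
qed

lemma causal_P: "causal (P n)"
  using causal_x by (auto simp: causal_def lincomb_def lag_def)

lemma P_mean_square_negl: "negl (\<lambda>n. ip (P n) (P n) n)"
proof -
  obtain C where C: "0 < C" "\<And>n. 1 \<le> n \<Longrightarrow> ip (P n) (P n) n \<le> C * (m n)\<^sup>2 * real n"
    using P_mean_square by metis
  have lim: "(\<lambda>n. C * (m n)\<^sup>2) \<longlonglongrightarrow> 0"
    using tendsto_mult[OF tendsto_const tendsto_power[OF m_tendsto_0, of 2], of C] by simp
  show ?thesis unfolding negl_def
  proof (rule tendsto_sandwich[OF _ _ tendsto_const lim])
    show "\<forall>\<^sub>F n in sequentially. ip (P n) (P n) n / real n \<le> C * (m n)\<^sup>2"
      using eventually_ge_at_top[of 1] by eventually_elim (use C in \<open>simp add: field_simps\<close>)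
  qed (simp add: ip_self_nonneg)
qed

lemma lag1_E_mean_square: "(\<lambda>n. ip (lag 1 E) (lag 1 E) n / real n) \<longlonglongrightarrow> s2 / (1 - c\<^sup>2)"
proof -
  have "slow E" using E_mean_square by (rule slow_of_mean_square)
  then have "near (ip E E) (ip (lag 1 E) (lag 1 E))"
    using ip_shift_near[OF causal_E, of E 0 0 1] by simp
  moreover have "near (ip E E) (\<lambda>n. s2 / (1 - c\<^sup>2) * real n)"
    unfolding near_linear_iff by (rule E_mean_square)
  ultimately have "near (ip (lag 1 E) (lag 1 E)) (\<lambda>n. s2 / (1 - c\<^sup>2) * real n)"
    by (rule near_trans[OF near_sym])
  then show ?thesis unfolding near_linear_iff .
qed

lemma lag1_P_negl: "negl (\<lambda>n. ip (lag 1 (P n)) (lag 1 (P n)) n)"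
  using P_mean_square_negl
  by (rule negl_bound) (simp add: ip_self_nonneg ip_lag_self_le[OF causal_P])

text \<open>
  \<open>J\<close> is the residual sum of squares, \<open>N\<close> the lag-one sum and \<open>ends\<close> the boundary terms in
  \<open>D - 2 = - (2 N + ends) / J\<close>, where \<open>D\<close> is the Durbin-Watson statistic.
\<close>

definition J :: "nat \<Rightarrow> real" where
  "J n = ip (res n) (res n) n"

definition N :: "nat \<Rightarrow> real" where
  "N n = ip (res n) (lag 1 (res n)) n"

definition ends :: "nat \<Rightarrow> real" where
  "ends n = (res n (int n))\<^sup>2 + (res n 0)\<^sup>2"

definition D :: "nat \<Rightarrow> real" where
  "D n = inverse (J n) * (\<Sum>k = 1..n. (res n (int k) - res n (int k - 1))\<^sup>2)"

lemma causal_res: "causal (res n)"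
  using causal_E causal_P by (auto simp: causal_def res_eq)

lemma res_differences: "(\<Sum>k = 1..n. (f (int k) - f (int k - 1))\<^sup>2)
    = 2 * ip f f n - (f (int n))\<^sup>2 - (f 0)\<^sup>2 - 2 * ip f (lag 1 f) n" if "causal f"
proof -
  have "(\<Sum>k\<le>n. (f (int k) - f (int k - 1))\<^sup>2) = (f 0)\<^sup>2 + (\<Sum>k = 1..n. (f (int k) - f (int k - 1))\<^sup>2)"
    using that by (simp add: atMost_atLeast0 sum.atLeast_Suc_atMost causal_def)
  moreover have "(\<Sum>k\<le>n. (f (int k) - f (int k - 1))\<^sup>2)
      = ip f f n + (\<Sum>k\<le>n. (f (int k - 1))\<^sup>2) - 2 * ip f (lag 1 f) n"
    by (simp add: ip_def lag_def power2_diff sum.distrib sum_subtractf sum_distrib_left power2_eq_square algebra_simps)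
  moreover have "(\<Sum>k\<le>n. (f (int k - 1))\<^sup>2) = ip f f n - (f (int n))\<^sup>2"
    using that sum_shift_1[of "\<lambda>k. (f k)\<^sup>2" n] by (simp add: causal_def ip_def power2_eq_square)
  ultimately show ?thesis by simp
qed

lemma D_minus_2: "J n \<noteq> 0 \<Longrightarrow> D n - 2 = - (2 * N n + ends n) / J n"
  unfolding D_def res_differences[OF causal_res] by (simp add: J_def N_def ends_def field_simps)

lemma J_tendsto: "(\<lambda>n. J n / real n) \<longlonglongrightarrow> s2 / (1 - c\<^sup>2)"
proof -
  have eq: "J n = ip E E n - 2 * ip E (P n) n + ip (P n) (P n) n" for n
    unfolding J_def res_eq[abs_def] by (simp add: ip_linear ip_commute[of "P n" E])
  have "negl (\<lambda>n. ip E (P n) n)"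
    by (rule negl_ip_Cauchy_Schwarz[OF E_mean_square P_mean_square_negl])
  then have "near J (ip E E)" unfolding near_def eq
    using negl_add[OF negl_cmult[of _ "-2"] P_mean_square_negl] by simp
  moreover have "near (ip E E) (\<lambda>n. s2 / (1 - c\<^sup>2) * real n)"
    unfolding near_linear_iff by (rule E_mean_square)
  ultimately have "near J (\<lambda>n. s2 / (1 - c\<^sup>2) * real n)"
    by (rule near_trans)
  then show ?thesis unfolding near_linear_iff .
qed

text \<open>
  The residuals differ from \<open>E\<close> by the fit \<open>P n\<close> of the estimation error, whose mean square vanishes, so
  by Cauchy-Schwarz it may be ignored.
\<close>

lemma N_near: "near N (\<lambda>n. ts (p - 1) * c * ip E E n)"
proof -
  have eq: "N n = ip E (lag 1 E) n - ip E (lag 1 (P n)) n - ip (lag 1 E) (P n) n + ip (lag 1 (P n)) (P n) n" for n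
  proof -
    have "lag 1 (res n) = (\<lambda>k. lag 1 E k - lag 1 (P n) k)" by (simp add: fun_eq_iff lag_def res_eq)
    then show ?thesis unfolding N_def res_eq[abs_def]
      by (simp add: ip_linear ip_commute[of "P n"])
  qed
  have P0: "(\<lambda>n. ip (lag 1 (P n)) (lag 1 (P n)) n / real n) \<longlonglongrightarrow> 0"
    using lag1_P_negl by (simp add: negl_def)
  have "near N (ip E (lag 1 E))"
  proof -
    have 1: "negl (\<lambda>n. ip E (lag 1 (P n)) n)"
      by (rule negl_ip_Cauchy_Schwarz[OF E_mean_square lag1_P_negl])
    have 2: "negl (\<lambda>n. ip (lag 1 E) (P n) n)"
      by (rule negl_ip_Cauchy_Schwarz[OF lag1_E_mean_square P_mean_square_negl])
    have 3: "negl (\<lambda>n. ip (lag 1 (P n)) (P n) n)"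
      by (rule negl_ip_Cauchy_Schwarz[OF P0 P_mean_square_negl])
    show ?thesis unfolding near_def eq
      using negl_diff[OF 3 negl_add[OF 1 2]] by (simp add: algebra_simps)
  qed
  then show ?thesis by (rule near_trans[OF _ E_autocovariance])
qed

lemma ends_negl: "negl ends"
proof (rule negl_bound)
  have "slow E" using E_mean_square by (rule slow_of_mean_square)
  then show "negl (\<lambda>n. 2 * (E (int n))\<^sup>2 + 2 * ip (P n) (P n) n + (x 0)\<^sup>2)"
    unfolding slow_def by (intro negl_add[OF negl_add[OF negl_cmult negl_cmult] negl_const] P_mean_square_negl)
  fix n
  have "(P n (int n))\<^sup>2 \<le> ip (P n) (P n) n"
    unfolding ip_def using member_le_sum[of n "{..n}" "\<lambda>k. P n (int k) * P n (int k)"]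
    by (simp add: power2_eq_square)
  moreover have "(res n (int n))\<^sup>2 \<le> 2 * (E (int n))\<^sup>2 + 2 * (P n (int n))\<^sup>2"
    unfolding res_eq using sum_squares_ge_zero[of "E (int n) + P n (int n)" 0]
    by (simp add: power2_eq_square algebra_simps)
  moreover have "res n 0 = x 0" using causal_x by (simp add: res_def causal_def)
  ultimately show "\<bar>ends n\<bar> \<le> 2 * (E (int n))\<^sup>2 + 2 * ip (P n) (P n) n + (x 0)\<^sup>2"
    by (simp add: ends_def)
qed

lemma limit_variance_pos: "0 < s2 / (1 - c\<^sup>2)"
  using s2_pos c_square_lt by simp

lemma D_tendsto: "(\<lambda>n. D n - 2) \<longlonglongrightarrow> - 2 * ts (p - 1) * c"
proof -
  define l where "l = s2 / (1 - c\<^sup>2)"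
  have l: "l > 0" using limit_variance_pos by (simp add: l_def)
  have "(\<lambda>n. ts (p - 1) * c * (ip E E n / real n)) \<longlonglongrightarrow> ts (p - 1) * c * l"
    using E_mean_square by (intro tendsto_mult_left) (simp add: l_def)
  then have "near (\<lambda>n. ts (p - 1) * c * ip E E n) (\<lambda>n. (ts (p - 1) * c * l) * real n)"
    by (simp add: near_linear_iff)
  then have "near N (\<lambda>n. (ts (p - 1) * c * l) * real n)"
    by (rule near_trans[OF N_near])
  then have "(\<lambda>n. N n / real n) \<longlonglongrightarrow> ts (p - 1) * c * l"
    unfolding near_linear_iff .
  then have "(\<lambda>n. - (2 * (N n / real n) + ends n / real n) / (J n / real n)) \<longlonglongrightarrow> - (2 * (ts (p - 1) * c * l) + 0) / l"
    using ends_negl J_tendsto l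
    by (intro tendsto_divide tendsto_minus tendsto_add tendsto_mult_left) (auto simp: negl_def l_def)
  moreover have "\<forall>\<^sub>F n in sequentially. - (2 * (N n / real n) + ends n / real n) / (J n / real n) = D n - 2"
    using order_tendstoD(1)[OF J_tendsto limit_variance_pos] eventually_gt_at_top[of 0]
  proof eventually_elim
    case (elim n)
    then have "J n \<noteq> 0" by auto
    then show ?case using elim by (simp add: D_minus_2 field_simps)
  qed
  ultimately have "(\<lambda>n. D n - 2) \<longlonglongrightarrow> - (2 * (ts (p - 1) * c * l) + 0) / l"
    by (rule Lim_transform_eventually)
  then show ?thesis using l by (simp add: algebra_simps)
qed

text \<open>
  Divided by \<open>n\<close>, the statistic tends to \<open>(2 * ts (p - 1) * c)\<^sup>2 / (2 * ts (p - 1))\<^sup>2 = c\<^sup>2\<close>.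
\<close>

lemma statistic_diverges:
  assumes "c \<noteq> 0" "ts (p - 1) \<noteq> 0"
  shows "filterlim (\<lambda>n. real n / (4 * (th n (p - 1))\<^sup>2) * (D n - 2)\<^sup>2) at_top sequentially"
proof -
  have "(\<lambda>n. (D n - 2)\<^sup>2 / (4 * (th n (p - 1))\<^sup>2)) \<longlonglongrightarrow> (- 2 * ts (p - 1) * c)\<^sup>2 / (4 * (ts (p - 1))\<^sup>2)"
    using p_pos assms by (intro tendsto_divide tendsto_power D_tendsto tendsto_mult_left th_tendsto) auto
  then have "filterlim (\<lambda>n. (D n - 2)\<^sup>2 / (4 * (th n (p - 1))\<^sup>2) * real n) at_top sequentially"
    by (rule filterlim_tendsto_pos_mult_at_top) (use assms in \<open>auto intro: filterlim_real_sequentially\<close>)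
  then show ?thesis by (simp add: mult.commute)
qed

end

context least_squares_path
begin

text \<open>
  \<open>Z\<close> is the leading term of the studentized statistic under the null hypothesis, and \<open>R\<close> the remainder in
  the approximation of the lag-one sum. The factor \<open>T\<close>, which will stay bounded in probability, collects the
  normalized cross products and the last innovation; the errors below are null sequences times \<open>(1 + T)\<^sup>2\<close>.
\<close>

definition Z :: "nat \<Rightarrow> real" where
  "Z n = ip v B n / (s2 * sqrt (real n))"

definition T :: "nat \<Rightarrow> real" where
  "T n = (\<Sum>j=1..p + 1. \<bar>ip v (lag j x) n\<bar>) / sqrt (real n) + \<bar>v (int n)\<bar>"

definition R :: "nat \<Rightarrow> real" where
  "R n = N n + ts (p - 1) * ip v B n"

lemma c_null: "\<rho> = 0 \<Longrightarrow> c = 0"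
  unfolding c_def by simp

lemma E_null: "\<rho> = 0 \<Longrightarrow> E = v"
  using c_null by (intro ext) (metis E_innovation diff_0_right mult_zero_left)

lemma T_nonneg: "0 \<le> T n"
  by (simp add: T_def sum_nonneg)

lemma T_ge_cross:
  assumes "1 \<le> j" "j \<le> p + 1" "1 \<le> n"
  shows "\<bar>ip v (lag j x) n\<bar> \<le> sqrt (real n) * T n"
proof -
  define s where "s = (\<Sum>j=1..p + 1. \<bar>ip v (lag j x) n\<bar>)"
  have "\<bar>ip v (lag j x) n\<bar> \<le> s"
    unfolding s_def using assms by (intro member_le_sum[of j _ "\<lambda>j. \<bar>ip v (lag j x) n\<bar>"]) auto
  also have "\<dots> \<le> sqrt (real n) * T n"
    unfolding T_def s_def[symmetric] using assms by (simp add: distrib_left)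
  finally show ?thesis .
qed

text \<open>
  The lagged innovation involves \<open>x\<^sub>k\<^sub>-\<^sub>1, \<dots>, x\<^sub>k\<^sub>-\<^sub>p\<^sub>-\<^sub>1\<close>, of which all but the last are regressors at time \<open>k\<close>. The
  last one is expressed through the backward error \<open>B\<close> and the regressors.
\<close>

lemma reconstruction_of_lagged_innovation:
  assumes "\<rho> = 0"
  shows "lag 1 v k = lincomb (\<lambda>i. tc i - ts (p - 1) * ts (p - 1 - i)) k - ts (p - 1) * B k"
proof -
  have "lag 1 v k = E (k - 1)" by (simp add: lag_def E_null[OF assms])
  also have "\<dots> = (\<Sum>l\<le>p. tc l * lag l x (k - 1))" by (rule E_def)
  also have "\<dots> = (\<Sum>l<p. tc l * lag (Suc l) x k) + tc p * lag (Suc p) x k"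
    by (simp add: lag_def algebra_simps flip: lessThan_Suc_atMost)
  also have "tc p = - ts (p - 1)" using p_pos by (simp add: tc_def)
  finally show ?thesis
    unfolding B_eq lincomb_def
    by (simp add: lag_def algebra_simps sum_subtractf sum_distrib_left)
qed

text \<open>
  In the expansion of the lag-one sum, the term of order \<open>\<surd>n\<close> that the estimation error contributes is its
  pairing with the regressor part of the lagged innovation. By the normal equations this equals the pairing of
  \<open>v\<close> with the same regressors, up to bounded terms, and cancels the regressor part of the pairing of \<open>v\<close>
  with its own lag.
\<close>

lemma R_eq:
  assumes "\<rho> = 0" "1 \<le> n"
  shows "R n = (\<Sum>i<p. (tc i - ts (p - 1) * ts (p - 1 - i)) * (bias i + (\<Sum>j<p. S0 i j * \<delta> n j)))
      + ts (p - 1) * ip B (P n) n - ip v (lag 1 (P n)) n + ip (P n) (lag 1 (P n)) n"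
proof -
  define g where "g i = tc i - ts (p - 1) * ts (p - 1 - i)" for i
  have E: "E = v" using assms by (intro E_null)
  have lag1: "lag 1 v = (\<lambda>k. lincomb g k - ts (p - 1) * B k)"
    unfolding g_def by (rule ext, rule reconstruction_of_lagged_innovation[OF assms(1)])
  have "ip (P n) (lincomb g) n = (\<Sum>i<p. g i * (ip v (lag (Suc i) x) n - bias i - (\<Sum>j<p. S0 i j * \<delta> n j)))"
    unfolding ip_lincomb
  proof (rule sum.cong)
    fix i assume "i \<in> {..<p}"
    then have "ip (lag (Suc i) x) (P n) n + (\<Sum>j<p. S0 i j * \<delta> n j) = ip (lag (Suc i) x) v n - bias i"
      using normal_eq_error[OF assms(2), of i] E by simp
    then have "ip (P n) (lag (Suc i) x) n = ip v (lag (Suc i) x) n - bias i - (\<Sum>j<p. S0 i j * \<delta> n j)"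
      unfolding ip_commute[of "P n"] ip_commute[of v] by simp
    then show "g i * ip (P n) (lag (Suc i) x) n
        = g i * (ip v (lag (Suc i) x) n - bias i - (\<Sum>j<p. S0 i j * \<delta> n j))" by simp
  qed simp
  also have "\<dots> = ip v (lincomb g) n - (\<Sum>i<p. g i * (bias i + (\<Sum>j<p. S0 i j * \<delta> n j)))"
    unfolding ip_lincomb sum_subtractf[symmetric] by (rule sum.cong) (simp_all add: algebra_simps)
  finally have G: "ip (P n) (lincomb g) n = ip v (lincomb g) n - (\<Sum>i<p. g i * (bias i + (\<Sum>j<p. S0 i j * \<delta> n j)))" .
  have "lag 1 (res n) = (\<lambda>k. lag 1 v k - lag 1 (P n) k)" by (simp add: fun_eq_iff lag_def res_eq E)
  then have "N n = ip v (lag 1 v) n - ip v (lag 1 (P n)) n - ip (P n) (lag 1 v) n + ip (P n) (lag 1 (P n)) n"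
    unfolding N_def res_eq[abs_def] E by (simp add: ip_linear)
  moreover have "ip v (lag 1 v) n = ip v (lincomb g) n - ts (p - 1) * ip v B n"
    "ip (P n) (lag 1 v) n = ip (P n) (lincomb g) n - ts (p - 1) * ip (P n) B n"
    unfolding lag1 by (simp_all add: ip_linear)
  ultimately show ?thesis
    unfolding R_def g_def[symmetric] using G by (simp add: ip_commute[of B] algebra_simps)
qed

text \<open>
  Under the null hypothesis \<open>E = v\<close>, so the right-hand side of \<open>estimation_error_bound\<close> has order \<open>\<surd>n * T\<close>.
\<close>

lemma m_rate:
  assumes "\<rho> = 0"
  obtains K where "0 < K" "\<forall>\<^sub>F n in sequentially. sqrt (real n) * m n \<le> K * (1 + T n)"
proof -
  have E: "E = v" using assms by (intro E_null)
  obtain K where K: "0 < K" "\<forall>\<^sub>F n in sequentially.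
    m n * real n \<le> K * (\<Sum>i<p. \<bar>ip (lag (Suc i) x) E n\<bar> + \<bar>bias i\<bar>)"
    by (rule estimation_error_bound)
  define s where "s = (\<Sum>i<p. \<bar>bias i\<bar>)"
  have s0: "s \<ge> 0" by (simp add: s_def sum_nonneg)
  define L where "L = K * (real p + s)"
  have ev: "\<forall>\<^sub>F n in sequentially. sqrt (real n) * m n \<le> (L + 1) * (1 + T n)"
    using K(2) eventually_ge_at_top[of 1]
  proof eventually_elim
    case (elim n)
    have r1: "1 \<le> sqrt (real n)" using elim(2) by simp
    have "(\<Sum>i<p. \<bar>ip (lag (Suc i) x) E n\<bar> + \<bar>bias i\<bar>) \<le> (\<Sum>i<p. sqrt (real n) * T n + \<bar>bias i\<bar>)"
      unfolding E using T_ge_cross elim(2) by (intro sum_mono add_right_mono) (simp add: ip_commute[of _ v])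
    also have "\<dots> = sqrt (real n) * (real p * T n) + 1 * s" by (simp add: sum.distrib s_def)
    also have "\<dots> \<le> sqrt (real n) * (real p * T n) + sqrt (real n) * s"
      using s0 r1 by (intro add_left_mono mult_right_mono) auto
    also have "\<dots> = sqrt (real n) * (real p * T n + s)" by (simp add: algebra_simps)
    also have "\<dots> \<le> sqrt (real n) * ((real p + s) * (1 + T n))"
      using s0 T_nonneg[of n] by (intro mult_left_mono) (auto simp: algebra_simps)
    finally have "m n * real n \<le> K * (sqrt (real n) * ((real p + s) * (1 + T n)))"
      using elim(1) K(1) by (meson mult_left_mono less_imp_le order_trans)
    also have "\<dots> = sqrt (real n) * (L * (1 + T n))" by (simp add: L_def algebra_simps)
    also have "m n * real n = sqrt (real n) * (sqrt (real n) * m n)"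
      by (subst mult.assoc[symmetric]) (simp add: mult.commute)
    finally have "sqrt (real n) * (sqrt (real n) * m n) \<le> sqrt (real n) * (L * (1 + T n))" .
    then have "sqrt (real n) * m n \<le> L * (1 + T n)" using r1 by simp
    also have "\<dots> \<le> (L + 1) * (1 + T n)" using T_nonneg[of n] by (intro mult_right_mono) auto
    finally show ?case .
  qed
  have "0 < L + 1" using K(1) s0 by (simp add: L_def add_nonneg_pos)
  then show ?thesis using ev by (rule that)
qed

lemma inverse_sqrt_tendsto: "(\<lambda>n. C / sqrt (real n)) \<longlonglongrightarrow> 0"
  by (rule tendsto_divide_0[OF tendsto_const]) (rule filterlim_at_top_imp_at_infinity,
    rule filterlim_compose[OF sqrt_at_top filterlim_real_sequentially])

text \<open>
  Each term of \<open>R_eq\<close> is either bounded, or the estimation error times a negligible sum, or quadratic in the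
  estimation error; after division by \<open>\<surd>n\<close> all of them vanish up to powers of \<open>1 + T\<close>.
\<close>

lemma R_bound:
  assumes "\<rho> = 0"
  obtains \<epsilon> where "\<epsilon> \<longlonglongrightarrow> 0" "\<forall>\<^sub>F n in sequentially. \<bar>R n\<bar> / sqrt (real n) \<le> \<epsilon> n * (1 + T n)\<^sup>2"
proof -
  obtain K where K: "0 < K" "\<forall>\<^sub>F n in sequentially. sqrt (real n) * m n \<le> K * (1 + T n)"
    using assms by (rule m_rate)
  obtain C where C: "0 < C" "\<And>n. 1 \<le> n \<Longrightarrow> ip (P n) (P n) n \<le> C * (m n)\<^sup>2 * real n"
    using P_mean_square by metis
  define g where "g i = tc i - ts (p - 1) * ts (p - 1 - i)" for i
  define c1 where "c1 = (\<Sum>i<p. \<bar>g i\<bar> * \<bar>bias i\<bar>)"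
  define c2 where "c2 = (\<Sum>i<p. \<bar>g i\<bar> * (\<Sum>j<p. \<bar>S0 i j\<bar>))"
  define A where "A = \<bar>ts (p - 1)\<bar>"
  define w where "w n = A * (\<Sum>i<p. \<bar>ip (lag (Suc i) x) B n\<bar>) + (\<Sum>i<p. \<bar>ip v (lag (Suc (Suc i)) x) n\<bar>)" for n
  have nonneg: "c1 \<ge> 0" "c2 \<ge> 0" "A \<ge> 0" "\<And>n. w n \<ge> 0"
    by (auto simp: c1_def c2_def A_def w_def intro!: sum_nonneg add_nonneg_nonneg)
  have w: "negl w"
    unfolding w_def
  proof (rule negl_add[OF negl_cmult])
    show "negl (\<lambda>n. \<Sum>i<p. \<bar>ip (lag (Suc i) x) B n\<bar>)"
      by (rule negl_sum, rule negl_abs, rule lag_B_negl) auto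
    show "negl (\<lambda>n. \<Sum>i<p. \<bar>ip v (lag (Suc (Suc i)) x) n\<bar>)"
      by (rule negl_sum, rule negl_abs, rule v_orthogonal) auto
  qed
  define \<epsilon> where "\<epsilon> n = (c1 + c2 * K + C * K\<^sup>2) / sqrt (real n) + K * (w n / real n)" for n
  have "\<epsilon> \<longlonglongrightarrow> 0 + K * 0" unfolding \<epsilon>_def
    using w by (intro tendsto_add inverse_sqrt_tendsto tendsto_mult_left) (simp add: negl_def)
  then have lim: "\<epsilon> \<longlonglongrightarrow> 0" by simp
  have ev: "\<forall>\<^sub>F n in sequentially. \<bar>R n\<bar> / sqrt (real n) \<le> \<epsilon> n * (1 + T n)\<^sup>2"
    using K(2) eventually_ge_at_top[of 1]
  proof eventually_elim
    case (elim n)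
    define t where "t = 1 + T n"
    define q where "q = sqrt (real n)"
    have t: "1 \<le> t" using T_nonneg by (simp add: t_def)
    have t2: "t \<le> t\<^sup>2" using t by (simp add: power2_eq_square)
    have q: "1 \<le> q" "q * q = real n" using elim(2) by (auto simp: q_def)
    have qm: "q * m n \<le> K * t" using elim(1) by (simp add: q_def t_def)
    have mle: "m n \<le> K * t" using qm m_nonneg[of n] q mult_right_mono[of 1 q "m n"] by linarith
    have b1: "\<bar>\<Sum>i<p. g i * (bias i + (\<Sum>j<p. S0 i j * \<delta> n j))\<bar> \<le> c1 + c2 * m n"
    proof -
      have "\<bar>\<Sum>j<p. S0 i j * \<delta> n j\<bar> \<le> (\<Sum>j<p. \<bar>S0 i j\<bar>) * m n" for i
      proof -
        have "\<bar>\<Sum>j<p. S0 i j * \<delta> n j\<bar> \<le> (\<Sum>j<p. \<bar>S0 i j * \<delta> n j\<bar>)" by (rule sum_abs)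
        also have "\<dots> \<le> (\<Sum>j<p. \<bar>S0 i j\<bar> * m n)"
          unfolding abs_mult m_def
          by (intro sum_mono mult_left_mono member_le_sum[of _ _ "\<lambda>i. \<bar>\<delta> n i\<bar>"]) auto
        finally show ?thesis by (simp add: sum_distrib_right)
      qed
      then have "\<bar>bias i + (\<Sum>j<p. S0 i j * \<delta> n j)\<bar> \<le> \<bar>bias i\<bar> + (\<Sum>j<p. \<bar>S0 i j\<bar>) * m n" for i
        using abs_triangle_ineq[of "bias i" "\<Sum>j<p. S0 i j * \<delta> n j"]
        by (meson add_left_mono order_trans)
      then have "(\<Sum>i<p. \<bar>g i * (bias i + (\<Sum>j<p. S0 i j * \<delta> n j))\<bar>)
          \<le> (\<Sum>i<p. \<bar>g i\<bar> * (\<bar>bias i\<bar> + (\<Sum>j<p. \<bar>S0 i j\<bar>) * m n))"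
        unfolding abs_mult by (intro sum_mono mult_left_mono) auto
      also have "\<dots> = c1 + c2 * m n"
        by (simp add: c1_def c2_def distrib_left sum.distrib sum_distrib_right mult.assoc)
      finally show ?thesis by (rule order_trans[OF sum_abs])
    qed
    have b2: "\<bar>ts (p - 1) * ip B (P n) n\<bar> \<le> m n * (A * (\<Sum>i<p. \<bar>ip (lag (Suc i) x) B n\<bar>))"
    proof -
      have "\<bar>ip B (P n) n\<bar> \<le> m n * (\<Sum>i<p. \<bar>ip (lag (Suc i) x) B n\<bar>)"
        unfolding ip_commute[of _ B]
        by (intro ip_P_bound member_le_sum[of _ _ "\<lambda>i. \<bar>ip B (lag (Suc i) x) n\<bar>"]) auto
      then have "A * \<bar>ip B (P n) n\<bar> \<le> A * (m n * (\<Sum>i<p. \<bar>ip (lag (Suc i) x) B n\<bar>))"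
        using nonneg by (intro mult_left_mono) auto
      then show ?thesis by (simp add: A_def abs_mult algebra_simps)
    qed
    have b3: "\<bar>ip v (lag 1 (P n)) n\<bar> \<le> m n * (\<Sum>i<p. \<bar>ip v (lag (Suc (Suc i)) x) n\<bar>)"
    proof -
      have "lag 1 (P n) = (\<lambda>k. \<Sum>i<p. \<delta> n i * lag (Suc (Suc i)) x k)"
        by (simp add: fun_eq_iff lag_def lincomb_def algebra_simps)
      then have "ip v (lag 1 (P n)) n = (\<Sum>i<p. \<delta> n i * ip v (lag (Suc (Suc i)) x) n)"
        by (simp only: ip_sum_right)
      also have "\<bar>\<dots>\<bar> \<le> (\<Sum>i<p. \<bar>\<delta> n i\<bar> * \<bar>ip v (lag (Suc (Suc i)) x) n\<bar>)"
        unfolding abs_mult[symmetric] by (rule sum_abs)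
      also have "\<dots> \<le> (\<Sum>i<p. \<bar>\<delta> n i\<bar> * (\<Sum>i<p. \<bar>ip v (lag (Suc (Suc i)) x) n\<bar>))"
        by (intro sum_mono mult_left_mono member_le_sum[of _ _ "\<lambda>i. \<bar>ip v (lag (Suc (Suc i)) x) n\<bar>"]) auto
      finally show ?thesis by (simp add: m_def sum_distrib_right)
    qed
    have b4: "\<bar>ip (P n) (lag 1 (P n)) n\<bar> \<le> C * (K * t)\<^sup>2"
    proof -
      have "\<bar>ip (P n) (lag 1 (P n)) n\<bar> \<le> sqrt (ip (P n) (P n) n) * sqrt (ip (lag 1 (P n)) (lag 1 (P n)) n)"
        by (rule ip_Cauchy_Schwarz)
      also have "\<dots> \<le> sqrt (ip (P n) (P n) n) * sqrt (ip (P n) (P n) n)"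
        by (intro mult_left_mono real_sqrt_le_mono ip_lag_self_le causal_P) (simp add: ip_self_nonneg)
      also have "\<dots> = ip (P n) (P n) n" by (simp add: ip_self_nonneg)
      also have "\<dots> \<le> C * (q * m n)\<^sup>2" using C(2)[OF elim(2)]
        by (simp add: q(2)[symmetric] power2_eq_square algebra_simps)
      also have "\<dots> \<le> C * (K * t)\<^sup>2"
        using C(1) qm q m_nonneg[of n] by (intro mult_left_mono power_mono) auto
      finally show ?thesis .
    qed
    have "\<bar>R n\<bar> \<le> (c1 + c2 * m n) + m n * w n + C * (K * t)\<^sup>2"
      using b1 b2 b3 b4 unfolding R_eq[OF assms elim(2)] g_def[symmetric] w_def distrib_left by linarith
    also have "\<dots> \<le> (c1 * t\<^sup>2 + c2 * (K * t\<^sup>2)) + m n * w n + C * K\<^sup>2 * t\<^sup>2"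
    proof -
      have "c1 * 1 \<le> c1 * t\<^sup>2" using nonneg(1) t t2 by (intro mult_left_mono) auto
      moreover have "m n \<le> K * t\<^sup>2" using mle t2 K(1) by (meson mult_left_mono less_imp_le order_trans)
      then have "c2 * m n \<le> c2 * (K * t\<^sup>2)" using nonneg(2) by (intro mult_left_mono) auto
      ultimately show ?thesis by (simp add: power_mult_distrib)
    qed
    finally have "\<bar>R n\<bar> / q \<le> ((c1 + c2 * K + C * K\<^sup>2) * t\<^sup>2 + m n * w n) / q"
      using q by (intro divide_right_mono) (auto simp: algebra_simps)
    also have "\<dots> = (c1 + c2 * K + C * K\<^sup>2) / q * t\<^sup>2 + (q * m n) * (w n / real n)"
      using q(1) by (simp add: q(2)[symmetric] field_simps)
    also have "(q * m n) * (w n / real n) \<le> (K * t\<^sup>2) * (w n / real n)"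
    proof (rule mult_right_mono)
      show "q * m n \<le> K * t\<^sup>2" using qm t2 K(1) by (meson mult_left_mono less_imp_le order_trans)
    qed (simp add: nonneg)
    finally show ?case by (simp add: \<epsilon>_def q_def t_def algebra_simps)
  qed
  from lim ev show ?thesis by (rule that)
qed

lemma ends_bound:
  assumes "\<rho> = 0"
  obtains \<epsilon> where "\<epsilon> \<longlonglongrightarrow> 0" "\<forall>\<^sub>F n in sequentially. \<bar>ends n\<bar> / sqrt (real n) \<le> \<epsilon> n * (1 + T n)\<^sup>2"
proof -
  have E: "E = v" using assms by (intro E_null)
  obtain K where K: "0 < K" "\<forall>\<^sub>F n in sequentially. sqrt (real n) * m n \<le> K * (1 + T n)"
    using assms by (rule m_rate)
  obtain C where C: "0 < C" "\<And>n. 1 \<le> n \<Longrightarrow> ip (P n) (P n) n \<le> C * (m n)\<^sup>2 * real n"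
    using P_mean_square by metis
  define L where "L = 2 + 2 * C * K\<^sup>2 + (x 0)\<^sup>2"
  have ev: "\<forall>\<^sub>F n in sequentially. \<bar>ends n\<bar> / sqrt (real n) \<le> L / sqrt (real n) * (1 + T n)\<^sup>2"
    using K(2) eventually_ge_at_top[of 1]
  proof eventually_elim
    case (elim n)
    define t where "t = 1 + T n"
    have t: "1 \<le> t" using T_nonneg by (simp add: t_def)
    have "(P n (int n))\<^sup>2 \<le> ip (P n) (P n) n"
      unfolding ip_def using member_le_sum[of n "{..n}" "\<lambda>k. P n (int k) * P n (int k)"]
      by (simp add: power2_eq_square)
    also have "\<dots> \<le> C * (sqrt (real n) * m n)\<^sup>2" using C(2)[OF elim(2)]
      by (simp add: power_mult_distrib algebra_simps)
    also have "\<dots> \<le> C * (K * t)\<^sup>2"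
      using C(1) elim(1) m_nonneg[of n] by (intro mult_left_mono power_mono) (auto simp: t_def)
    finally have P: "(P n (int n))\<^sup>2 \<le> C * K\<^sup>2 * t\<^sup>2" by (simp add: power_mult_distrib)
    have "\<bar>v (int n)\<bar> \<le> t" by (simp add: t_def T_def add_increasing sum_nonneg)
    then have v: "(v (int n))\<^sup>2 \<le> t\<^sup>2" by (rule power2_le_iff_abs_le[THEN iffD2, rotated]) (use t in simp)
    have r: "(res n (int n))\<^sup>2 \<le> 2 * (v (int n))\<^sup>2 + 2 * (P n (int n))\<^sup>2"
      unfolding res_eq E using sum_squares_ge_zero[of "v (int n) + P n (int n)" 0]
      by (simp add: power2_eq_square algebra_simps)
    have x0: "res n 0 = x 0" using causal_x by (simp add: res_def causal_def)
    have "(x 0)\<^sup>2 * 1 \<le> (x 0)\<^sup>2 * t\<^sup>2" using t by (intro mult_left_mono) auto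
    then have "ends n \<le> L * t\<^sup>2" using P v r unfolding ends_def x0 L_def by (simp add: algebra_simps)
    moreover have "ends n \<ge> 0" by (simp add: ends_def)
    ultimately have "\<bar>ends n\<bar> / sqrt (real n) \<le> L * t\<^sup>2 / sqrt (real n)"
      by (intro divide_right_mono) auto
    then show ?case by (simp add: t_def)
  qed
  from inverse_sqrt_tendsto ev show ?thesis by (rule that)
qed

text \<open>
  Insert \<open>N = R - ts (p - 1) * ip v B\<close> into \<open>D - 2 = - (2 N + ends) / J\<close>. The factor of \<open>ip v B\<close> tends to \<open>1 / s2\<close>,
  because \<open>J / n\<close> tends to \<open>s2\<close> and the estimate cancels \<open>ts (p - 1)\<close>.
\<close>

lemma studentized_statistic_expansion:
  assumes rho: "\<rho> = 0" and ts0: "ts (p - 1) \<noteq> 0"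
  obtains \<epsilon> where "\<epsilon> \<longlonglongrightarrow> 0" "\<forall>\<^sub>F n in sequentially.
    \<bar>sqrt (real n) * (D n - 2) / (2 * th n (p - 1)) - Z n\<bar> \<le> \<epsilon> n * (1 + T n)\<^sup>2"
proof -
  obtain \<epsilon>1 where \<epsilon>1: "\<epsilon>1 \<longlonglongrightarrow> 0" "\<forall>\<^sub>F n in sequentially. \<bar>R n\<bar> / sqrt (real n) \<le> \<epsilon>1 n * (1 + T n)\<^sup>2"
    using rho by (rule R_bound)
  obtain \<epsilon>2 where \<epsilon>2: "\<epsilon>2 \<longlonglongrightarrow> 0" "\<forall>\<^sub>F n in sequentially. \<bar>ends n\<bar> / sqrt (real n) \<le> \<epsilon>2 n * (1 + T n)\<^sup>2"
    using rho by (rule ends_bound)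
  have c0: "c = 0" using rho by (rule c_null)
  define A where "A = ts (p - 1)"
  define h where "h n = 1 / (th n (p - 1) * (J n / real n))" for n
  define Q where "Q = (\<Sum>l\<le>p. \<bar>tc l\<bar>)"
  have h: "h \<longlonglongrightarrow> 1 / (A * s2)"
    unfolding h_def A_def using J_tendsto ts0 s2_pos p_pos
    by (intro tendsto_divide tendsto_const tendsto_mult th_tendsto) (auto simp: c0)
  define \<epsilon> where "\<epsilon> n = \<bar>A * h n - 1 / s2\<bar> * Q + \<bar>h n\<bar> * (\<epsilon>1 n + \<epsilon>2 n)" for n
  have "\<epsilon> \<longlonglongrightarrow> \<bar>A * (1 / (A * s2)) - 1 / s2\<bar> * Q + \<bar>1 / (A * s2)\<bar> * (0 + 0)"
    unfolding \<epsilon>_def by (intro tendsto_intros h \<epsilon>1(1) \<epsilon>2(1))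
  then have lim: "\<epsilon> \<longlonglongrightarrow> 0" using ts0 by (simp add: A_def)
  have lt: "p - 1 < p" using p_pos by simp
  have ev: "\<forall>\<^sub>F n in sequentially.
    \<bar>sqrt (real n) * (D n - 2) / (2 * th n (p - 1)) - Z n\<bar> \<le> \<epsilon> n * (1 + T n)\<^sup>2"
    using \<epsilon>1(2) \<epsilon>2(2) eventually_ge_at_top[of 1]
      order_tendstoD(1)[OF J_tendsto limit_variance_pos]
      tendsto_imp_eventually_ne[OF th_tendsto[OF lt] ts0]
  proof eventually_elim
    case (elim n)
    have th0: "th n (p - 1) \<noteq> 0" using elim(5) p_pos by simp
    have J0: "J n \<noteq> 0" using elim(4) by auto
    define q where "q = sqrt (real n)"
    define t where "t = 1 + T n"
    have t: "1 \<le> t" using T_nonneg by (simp add: t_def)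
    have t2: "T n \<le> t\<^sup>2" using t self_le_power[of t 2] by (simp add: t_def)
    have q: "1 \<le> q" "q * q = real n" using elim(3) by (auto simp: q_def)
    have "q * (D n - 2) / (2 * th n (p - 1)) = h n * ((- (2 * N n + ends n) / 2) / q)"
      unfolding D_minus_2[OF J0] h_def using th0 J0 q by (simp add: field_simps q(2)[symmetric])
    also have "- (2 * N n + ends n) / 2 = A * ip v B n - (R n + ends n / 2)"
      by (simp add: R_def A_def)
    finally have W: "q * (D n - 2) / (2 * th n (p - 1)) = h n * ((A * ip v B n - (R n + ends n / 2)) / q)" .
    have "Z n = (1 / s2) * (ip v B n / q)" by (simp add: Z_def q_def)
    then have eq: "q * (D n - 2) / (2 * th n (p - 1)) - Z n
        = (A * h n - 1 / s2) * (ip v B n / q) - h n * ((R n + ends n / 2) / q)"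
      unfolding W by (simp add: diff_divide_distrib left_diff_distrib right_diff_distrib)
    have "\<bar>q * (D n - 2) / (2 * th n (p - 1)) - Z n\<bar> \<le> \<bar>A * h n - 1 / s2\<bar> * (\<bar>ip v B n\<bar> / q) + \<bar>h n\<bar> * (\<bar>R n\<bar> / q + \<bar>ends n\<bar> / q)"
    proof -
      have 1: "\<bar>(R n + ends n / 2) / q\<bar> \<le> \<bar>R n\<bar> / q + \<bar>ends n\<bar> / q"
        using q by (simp add: abs_divide flip: add_divide_distrib) (intro divide_right_mono, auto)
      have "\<bar>(A * h n - 1 / s2) * (ip v B n / q) - h n * ((R n + ends n / 2) / q)\<bar>
          \<le> \<bar>(A * h n - 1 / s2) * (ip v B n / q)\<bar> + \<bar>h n * ((R n + ends n / 2) / q)\<bar>"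
        by (rule abs_triangle_ineq4)
      also have "\<dots> \<le> \<bar>A * h n - 1 / s2\<bar> * (\<bar>ip v B n\<bar> / q) + \<bar>h n\<bar> * (\<bar>R n\<bar> / q + \<bar>ends n\<bar> / q)"
        unfolding abs_mult using 1 q by (intro add_mono mult_left_mono) auto
      finally show ?thesis unfolding eq .
    qed
    also have "\<dots> \<le> \<bar>A * h n - 1 / s2\<bar> * (Q * t\<^sup>2) + \<bar>h n\<bar> * (\<epsilon>1 n * t\<^sup>2 + \<epsilon>2 n * t\<^sup>2)"
    proof -
      have cross: "\<bar>ip v (lag (p + 1 - l) x) n\<bar> \<le> q * T n" if "l \<le> p" for l
        unfolding q_def by (rule T_ge_cross) (use that elim(3) in auto)
      have "\<bar>ip v B n\<bar> \<le> (\<Sum>l\<le>p. \<bar>tc l * ip v (lag (p + 1 - l) x) n\<bar>)"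
        unfolding B_ip by (rule sum_abs)
      also have "\<dots> = (\<Sum>l\<le>p. \<bar>tc l\<bar> * \<bar>ip v (lag (p + 1 - l) x) n\<bar>)"
        by (simp only: abs_mult)
      also have "\<dots> \<le> (\<Sum>l\<le>p. \<bar>tc l\<bar> * (q * T n))"
        by (rule sum_mono, rule mult_left_mono, rule cross) auto
      also have "\<dots> = Q * (q * T n)" unfolding Q_def by (rule sum_distrib_right[symmetric])
      finally have "\<bar>ip v B n\<bar> / q \<le> Q * T n" using q(1) by (simp add: field_simps)
      also have "\<dots> \<le> Q * t\<^sup>2" using t2 by (intro mult_left_mono) (auto simp: Q_def sum_nonneg)
      finally show ?thesis using elim(1,2) unfolding q_def[symmetric] t_def[symmetric]
        by (intro add_mono mult_left_mono) auto
    qed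
    finally show ?case by (simp add: \<epsilon>_def q_def t_def algebra_simps)
  qed
  from lim ev show ?thesis by (rule that)
qed

end

section \<open>A strong law for orthogonal sequences\<close>

lemma integrable_mult_of_squares:
  fixes f g :: "'a \<Rightarrow> real"
  assumes [measurable]: "f \<in> borel_measurable M" "g \<in> borel_measurable M"
    and "integrable M (\<lambda>\<omega>. (f \<omega>)\<^sup>2)" "integrable M (\<lambda>\<omega>. (g \<omega>)\<^sup>2)"
  shows "integrable M (\<lambda>\<omega>. f \<omega> * g \<omega>)"
proof (rule Bochner_Integration.integrable_bound)
  show "integrable M (\<lambda>\<omega>. (f \<omega>)\<^sup>2 + (g \<omega>)\<^sup>2)" using assms by simp
  have "\<bar>x * y\<bar> \<le> x\<^sup>2 + y\<^sup>2" for x y :: real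
    using sum_squares_bound[of "\<bar>x\<bar>" "\<bar>y\<bar>"] mult_nonneg_nonneg[of "\<bar>x\<bar>" "\<bar>y\<bar>"]
    unfolding abs_mult power2_abs by linarith
  then show "AE \<omega> in M. norm (f \<omega> * g \<omega>) \<le> norm ((f \<omega>)\<^sup>2 + (g \<omega>)\<^sup>2)" by simp
qed simp

lemma (in prob_space) expectation_sum_square_le:
  fixes \<xi> :: "nat \<Rightarrow> 'a \<Rightarrow> real"
  assumes meas [measurable]: "\<And>k. \<xi> k \<in> borel_measurable M"
    and sq: "\<And>k. integrable M (\<lambda>\<omega>. (\<xi> k \<omega>)\<^sup>2)"
    and C: "\<And>k. expectation (\<lambda>\<omega>. (\<xi> k \<omega>)\<^sup>2) \<le> C"
    and orth: "\<And>k l. k \<noteq> l \<Longrightarrow> expectation (\<lambda>\<omega>. \<xi> k \<omega> * \<xi> l \<omega>) = 0"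
    and fin: "finite A"
  shows "integrable M (\<lambda>\<omega>. (\<Sum>k\<in>A. \<xi> k \<omega>)\<^sup>2) \<and> expectation (\<lambda>\<omega>. (\<Sum>k\<in>A. \<xi> k \<omega>)\<^sup>2) \<le> C * card A"
  using fin
proof (induction A rule: finite_induct)
  case empty
  then show ?case by simp
next
  case (insert a A)
  have prod: "integrable M (\<lambda>\<omega>. \<xi> k \<omega> * \<xi> l \<omega>)" for k l
    by (rule integrable_mult_of_squares) (use sq in auto)
  have eq: "(\<Sum>k\<in>insert a A. \<xi> k \<omega>)\<^sup>2 = (\<xi> a \<omega>)\<^sup>2 + (2 * (\<Sum>k\<in>A. \<xi> a \<omega> * \<xi> k \<omega>) + (\<Sum>k\<in>A. \<xi> k \<omega>)\<^sup>2)" for \<omega>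
    using insert.hyps by (simp add: power2_sum sum_distrib_left algebra_simps)
  have cross: "expectation (\<lambda>\<omega>. \<Sum>k\<in>A. \<xi> a \<omega> * \<xi> k \<omega>) = 0"
    using prod insert.hyps by (subst Bochner_Integration.integral_sum) (auto intro!: sum.neutral orth)
  show ?case
    unfolding eq using insert.IH sq prod cross C[of a] insert.hyps
    by (auto simp: algebra_simps)
qed

text \<open>
  Along the squares \<open>n = k\<^sup>2\<close> the averages have second moments of order \<open>1 / k\<^sup>2\<close>, which is summable. Between two
  squares lie \<open>2 k\<close> indices, and the squares of all the corresponding increments together have expectation of
  order \<open>k\<^sup>2\<close>, again summable after division by \<open>k\<^sup>4\<close>.
\<close>

lemma (in prob_space) orthogonal_strong_law:
  fixes \<xi> :: "nat \<Rightarrow> 'a \<Rightarrow> real"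
  assumes meas [measurable]: "\<And>k. \<xi> k \<in> borel_measurable M"
    and sq: "\<And>k. integrable M (\<lambda>\<omega>. (\<xi> k \<omega>)\<^sup>2)"
    and C: "\<And>k. expectation (\<lambda>\<omega>. (\<xi> k \<omega>)\<^sup>2) \<le> C"
    and orth: "\<And>k l. k \<noteq> l \<Longrightarrow> expectation (\<lambda>\<omega>. \<xi> k \<omega> * \<xi> l \<omega>) = 0"
  shows "AE \<omega> in M. negl (\<lambda>n. \<Sum>k\<le>n. \<xi> k \<omega>)"
proof -
  have bound: "integrable M (\<lambda>\<omega>. (\<Sum>k\<in>A. \<xi> k \<omega>)\<^sup>2) \<and> expectation (\<lambda>\<omega>. (\<Sum>k\<in>A. \<xi> k \<omega>)\<^sup>2) \<le> C * card A"
    if "finite A" for A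
    by (rule expectation_sum_square_le[OF meas sq C orth that])
  have C0: "C \<ge> 0" using C[of 0] order_trans[OF _ C[of 0]] by simp
  (* W k bounds half the square of every partial sum with index in [k^2, (k+1)^2). *)
  define W where "W k \<omega> = (\<Sum>i\<le>k\<^sup>2. \<xi> i \<omega>)\<^sup>2 + (\<Sum>m\<in>{k\<^sup>2<..<(k+1)\<^sup>2}. (\<Sum>i\<in>{k\<^sup>2<..m}. \<xi> i \<omega>)\<^sup>2)" for k \<omega>
  define U where "U k \<omega> = W k \<omega> / real (k + 1) ^ 4" for k \<omega>
  have W_int: "integrable M (W k)" for k
    unfolding W_def using bound by (intro Bochner_Integration.integrable_add Bochner_Integration.integrable_sum) auto
  have W_le: "expectation (W k) \<le> 5 * C * (real (k + 1))\<^sup>2" for k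
  proof -
    have "expectation (W k) = expectation (\<lambda>\<omega>. (\<Sum>i\<le>k\<^sup>2. \<xi> i \<omega>)\<^sup>2)
        + (\<Sum>m\<in>{k\<^sup>2<..<(k+1)\<^sup>2}. expectation (\<lambda>\<omega>. (\<Sum>i\<in>{k\<^sup>2<..m}. \<xi> i \<omega>)\<^sup>2))"
      unfolding W_def using bound
      by (subst Bochner_Integration.integral_add) (auto intro!: Bochner_Integration.integrable_sum Bochner_Integration.integral_sum)
    also have "\<dots> \<le> C * (real k ^ 2 + 1) + (\<Sum>m\<in>{k\<^sup>2<..<(k+1)\<^sup>2}. C * (2 * real k))"
    proof (intro add_mono sum_mono)
      show "expectation (\<lambda>\<omega>. (\<Sum>i\<le>k\<^sup>2. \<xi> i \<omega>)\<^sup>2) \<le> C * (real k ^ 2 + 1)"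
        using bound[of "{..k\<^sup>2}"] by (simp add: add.commute)
      fix m assume m: "m \<in> {k\<^sup>2<..<(k+1)\<^sup>2}"
      then have "real (m - k\<^sup>2) \<le> 2 * real k"
        by (auto simp: power2_eq_square of_nat_diff algebra_simps simp flip: of_nat_mult of_nat_add)
      then show "expectation (\<lambda>\<omega>. (\<Sum>i\<in>{k\<^sup>2<..m}. \<xi> i \<omega>)\<^sup>2) \<le> C * (2 * real k)"
        using bound[of "{k\<^sup>2<..m}"] C0 by (auto intro: order_trans mult_left_mono)
    qed
    also have "\<dots> = C * ((real k ^ 2 + 1) + (2 * real k) * (2 * real k))"
      by (simp add: algebra_simps power2_eq_square)
    also have "\<dots> \<le> C * (5 * (real (k + 1))\<^sup>2)"
      using C0 by (intro mult_left_mono) (auto simp: power2_eq_square algebra_simps)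
    finally show ?thesis by (simp add: algebra_simps)
  qed
  have U0: "0 \<le> U k \<omega>" for k \<omega> by (simp add: U_def W_def sum_nonneg)
  have U_int: "integrable M (U k)" for k unfolding U_def using W_int by simp
  have U_le: "expectation (U k) \<le> 5 * C * (1 / (real (Suc k))\<^sup>2)" for k
  proof -
    have "expectation (U k) = expectation (W k) / real (k + 1) ^ 4" unfolding U_def[abs_def] by simp
    also have "\<dots> \<le> 5 * C * (real (k + 1))\<^sup>2 / real (k + 1) ^ 4"
      using W_le by (intro divide_right_mono) auto
    also have "\<dots> = 5 * C * (1 / (real (Suc k))\<^sup>2)"
    proof -
      have "5 * C * x\<^sup>2 / x ^ 4 = 5 * C * (1 / x\<^sup>2)" if "x > 0" for x :: real
        using that by (simp add: power4_eq_xxxx power2_eq_square)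
      from this[of "real (Suc k)"] show ?thesis by simp
    qed
    finally show ?thesis .
  qed
  have "summable (\<lambda>k. 5 * C * (1 / (real (Suc k))\<^sup>2))"
    using inverse_power_summable[of 2, where ?'a = real]
    by (intro summable_mult) (subst summable_Suc_iff, simp add: field_simps)
  then have summ: "summable (\<lambda>k. expectation (U k))"
    by (rule summable_comparison_test'[of _ 0]) (use U_le Bochner_Integration.integral_nonneg[of M "U _", OF U0] in auto)
  have "(\<integral>\<^sup>+\<omega>. (\<Sum>k. ennreal (U k \<omega>)) \<partial>M) = (\<Sum>k. \<integral>\<^sup>+\<omega>. ennreal (U k \<omega>) \<partial>M)"
    by (rule nn_integral_suminf) (use U_int in simp)
  also have "\<dots> = (\<Sum>k. ennreal (expectation (U k)))"
    using U_int U0 by (simp add: nn_integral_eq_integral)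
  also have "\<dots> \<noteq> \<infinity>"
    unfolding infinity_ennreal_def
    by (rule ennreal_suminf_neq_top[OF summ]) (rule Bochner_Integration.integral_nonneg, rule U0)
  finally have "AE \<omega> in M. (\<Sum>k. ennreal (U k \<omega>)) \<noteq> \<infinity>"
    using U_int by (intro nn_integral_PInf_AE) auto
  then show ?thesis
  proof eventually_elim
    case (elim \<omega>)
    then have "summable (\<lambda>k. U k \<omega>)" using U0 by (intro summable_suminf_not_top) auto
    then have Ulim: "(\<lambda>k. U k \<omega>) \<longlonglongrightarrow> 0" by (rule summable_LIMSEQ_zero)
    define f where "f n = nat \<lfloor>sqrt (real n)\<rfloor>" for n
    have "filterlim f sequentially sequentially" unfolding f_def
      by (intro filterlim_compose[OF filterlim_nat_sequentially] filterlim_compose[OF filterlim_floor_sequentially]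
          filterlim_compose[OF sqrt_at_top filterlim_real_sequentially])
    then have lim: "(\<lambda>n. 32 * U (f n) \<omega>) \<longlonglongrightarrow> 32 * 0"
      by (intro tendsto_mult_left filterlim_compose[OF Ulim])
    have lim2: "(\<lambda>n. sqrt (32 * U (f n) \<omega>)) \<longlonglongrightarrow> 0"
      using tendsto_real_sqrt[OF lim] by simp
    show ?case unfolding negl_def
    proof (rule tendsto_rabs_zero_cancel, rule tendsto_sandwich[OF _ _ tendsto_const lim2])
      show "\<forall>\<^sub>F n in sequentially. \<bar>(\<Sum>k\<le>n. \<xi> k \<omega>) / real n\<bar> \<le> sqrt (32 * U (f n) \<omega>)"
        using eventually_ge_at_top[of 1]
      proof eventually_elim
        case (elim n)
        define k where "k = f n"
        have s1: "1 \<le> sqrt (real n)" using elim by simp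
        have k1: "1 \<le> k" using s1 unfolding k_def f_def by linarith
        have kle: "real k \<le> sqrt (real n)" "sqrt (real n) < real k + 1"
          using s1 unfolding k_def f_def by linarith+
        have "(real k)\<^sup>2 \<le> (sqrt (real n))\<^sup>2" using kle by (intro power_mono) auto
        then have "real (k\<^sup>2) \<le> real n" by simp
        then have k2: "k\<^sup>2 \<le> n" by (simp only: of_nat_le_iff)
        have "(sqrt (real n))\<^sup>2 < (real k + 1)\<^sup>2" using kle s1 by (intro power_strict_mono) auto
        then have "real n < real ((k + 1)\<^sup>2)" by (simp add: algebra_simps)
        then have k3: "n < (k + 1)\<^sup>2" by (simp only: of_nat_less_iff)
        define A where "A = (\<Sum>i\<le>k\<^sup>2. \<xi> i \<omega>)"
        define B where "B = (\<Sum>i\<in>{k\<^sup>2<..n}. \<xi> i \<omega>)"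
        have "{..n} = {..k\<^sup>2} \<union> {k\<^sup>2<..n}" using k2 by auto
        then have S: "(\<Sum>i\<le>n. \<xi> i \<omega>) = A + B"
          unfolding A_def B_def by (simp add: sum.union_disjoint[symmetric] ivl_disj_int)
        have "B\<^sup>2 \<le> (\<Sum>m\<in>{k\<^sup>2<..<(k+1)\<^sup>2}. (\<Sum>i\<in>{k\<^sup>2<..m}. \<xi> i \<omega>)\<^sup>2)"
        proof (cases "n = k\<^sup>2")
          case True
          then show ?thesis by (simp add: B_def sum_nonneg)
        next
          case False
          then show ?thesis unfolding B_def using k2 k3
            by (intro member_le_sum[of n _ "\<lambda>m. (\<Sum>i\<in>{k\<^sup>2<..m}. \<xi> i \<omega>)\<^sup>2"]) auto
        qed
        then have AB: "A\<^sup>2 + B\<^sup>2 \<le> W k \<omega>" by (simp add: W_def A_def)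
        have "(A + B)\<^sup>2 \<le> 2 * (A\<^sup>2 + B\<^sup>2)"
          using sum_squares_ge_zero[of "A - B" 0] by (simp add: power2_eq_square algebra_simps)
        also have "\<dots> \<le> 2 * W k \<omega>" using AB by simp
        finally have le: "(A + B)\<^sup>2 \<le> 2 * W k \<omega>" .
        have pow: "real (k + 1) ^ 4 \<le> 16 * (real n)\<^sup>2"
        proof -
          have "real (k + 1) \<le> 2 * sqrt (real n)" using kle(1) s1 unfolding of_nat_add of_nat_1 by linarith
          then have "real (k + 1) ^ 4 \<le> (2 * sqrt (real n)) ^ 4"
            by (intro power_mono) auto
          also have "\<dots> = 16 * (sqrt (real n) ^ 2) ^ 2" by (simp add: power_mult_distrib power4_eq_xxxx power2_eq_square)
          also have "\<dots> = 16 * (real n)\<^sup>2" by simp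
          finally show ?thesis .
        qed
        have "((A + B) / real n)\<^sup>2 \<le> 2 * W k \<omega> / (real n)\<^sup>2"
          using le by (simp add: power_divide divide_right_mono)
        also have "\<dots> \<le> 32 * U k \<omega>"
        proof -
          have "W k \<omega> * real (k + 1) ^ 4 \<le> W k \<omega> * (16 * (real n)\<^sup>2)"
            using pow by (intro mult_left_mono) (auto simp: W_def sum_nonneg)
          then show ?thesis using elim unfolding U_def by (simp add: divide_simps mult_ac)
        qed
        finally have "sqrt (((A + B) / real n)\<^sup>2) \<le> sqrt (32 * U k \<omega>)" by (rule real_sqrt_le_mono)
        then show ?case unfolding S k_def by simp
      qed
    qed simp
  qed
qed

section \<open>The past of an independent sequence\<close>

locale independent_sequence = prob_space M for M :: "'a measure" +
  fixes V :: "nat \<Rightarrow> 'a \<Rightarrow> real"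
  assumes V_indep: "indep_vars (\<lambda>_. borel) V {1..}"
begin

lemma V_measurable: "1 \<le> k \<Longrightarrow> V k \<in> borel_measurable M"
  using V_indep by (auto simp: indep_vars_def)

text \<open>
  The sigma-algebra generated by \<open>V\<^sub>1, \<dots>, V\<^sub>k\<^sub>-\<^sub>1\<close>.
\<close>

definition past :: "nat \<Rightarrow> 'a measure" where
  "past k = vimage_algebra (space M) (\<lambda>\<omega>. \<lambda>j\<in>{1..<k}. V j \<omega>) (PiM {1..<k} (\<lambda>_. borel))"

lemma space_past [simp]: "space (past k) = space M"
  by (simp add: past_def)

lemma V_past: "1 \<le> j \<Longrightarrow> j < k \<Longrightarrow> V j \<in> borel_measurable (past k)"
proof -
  assume j: "1 \<le> j" "j < k"
  have "(\<lambda>\<omega>. \<lambda>j\<in>{1..<k}. V j \<omega>) \<in> measurable (past k) (PiM {1..<k} (\<lambda>_. borel))"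
    unfolding past_def by (rule measurable_vimage_algebra1) (auto simp: space_PiM)
  then have "(\<lambda>\<omega>. (\<lambda>j\<in>{1..<k}. V j \<omega>) j) \<in> borel_measurable (past k)"
    by (rule measurable_compose[OF _ measurable_component_singleton]) (use j in auto)
  then show ?thesis using j by simp
qed

lemma past_mono:
  assumes "k \<le> l" "f \<in> measurable (past k) N"
  shows "f \<in> measurable (past l) N"
proof -
  have "sets (past k) \<subseteq> sets (past l)"
    unfolding past_def[of k]
    by (rule sets_image_in_sets) (use assms in \<open>auto intro!: measurable_restrict V_past\<close>)
  then show ?thesis using assms(2) by (auto simp: measurable_def)
qed

lemma past_measurable_M:
  assumes "f \<in> measurable (past k) N"
  shows "f \<in> measurable M N"
proof -
  have "sets (past k) \<subseteq> sets M"
    unfolding past_def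
    by (rule sets_image_in_sets) (auto intro!: measurable_restrict V_measurable)
  then show ?thesis using assms by (auto simp: measurable_def)
qed

lemma past_indep_sets:
  assumes A: "A \<in> sets (past k)" and k: "1 \<le> k" and B: "B \<in> sets borel"
  shows "prob (A \<inter> (V k -` B \<inter> space M)) = prob A * prob (V k -` B \<inter> space M)"
proof -
  have "indep_var (PiM {1..<k} (\<lambda>_. borel)) (\<lambda>\<omega>. \<lambda>j\<in>{1..<k}. V j \<omega>)
      (PiM {k} (\<lambda>_. borel)) (\<lambda>\<omega>. \<lambda>j\<in>{k}. V j \<omega>)"
    by (rule indep_var_restrict[OF V_indep]) (use k in auto)
  then have ind: "indep_set
      (sigma_sets (space M) {(\<lambda>\<omega>. \<lambda>j\<in>{1..<k}. V j \<omega>) -` A \<inter> space M | A. A \<in> sets (PiM {1..<k} (\<lambda>_. borel))})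
      (sigma_sets (space M) {(\<lambda>\<omega>. \<lambda>j\<in>{k}. V j \<omega>) -` A \<inter> space M | A. A \<in> sets (PiM {k} (\<lambda>_. borel))})"
    by (simp add: indep_var_eq)
  have meas: "(\<lambda>z. z k) \<in> measurable (PiM {k} (\<lambda>_. borel)) (borel :: real measure)"
    by (rule measurable_component_singleton) simp
  have "V k -` B \<inter> space M = (\<lambda>\<omega>. \<lambda>j\<in>{k}. V j \<omega>) -` ((\<lambda>z. z k) -` B \<inter> space (PiM {k} (\<lambda>_. borel))) \<inter> space M"
    by (auto simp: space_PiM)
  then have "V k -` B \<inter> space M \<in> sigma_sets (space M)
      {(\<lambda>\<omega>. \<lambda>j\<in>{k}. V j \<omega>) -` A \<inter> space M | A. A \<in> sets (PiM {k} (\<lambda>_. borel))}"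
    using measurable_sets[OF meas B] by blast
  moreover have "A \<in> sigma_sets (space M)
      {(\<lambda>\<omega>. \<lambda>j\<in>{1..<k}. V j \<omega>) -` A \<inter> space M | A. A \<in> sets (PiM {1..<k} (\<lambda>_. borel))}"
    using A by (simp add: past_def sets_vimage_algebra)
  ultimately show ?thesis using indep_setD[OF ind] by blast
qed

text \<open>
  Independence of \<open>V\<^sub>k\<close> from its past, as a product formula for joint laws, for past variables with
  values in an arbitrary space; \<open>condition_on_past\<close> applies it to pairs.
\<close>

lemma past_joint_distribution:
  assumes f: "f \<in> measurable (past k) N" and k: "1 \<le> k"
  shows "distr M (N \<Otimes>\<^sub>M borel) (\<lambda>\<omega>. (f \<omega>, V k \<omega>)) = distr M N f \<Otimes>\<^sub>M distr M borel (V k)"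
proof -
  note [measurable] = past_measurable_M[OF f] V_measurable[OF k]
  interpret F: prob_space "distr M N f" by (rule prob_space_distr) simp
  interpret K: prob_space "distr M borel (V k)" by (rule prob_space_distr) simp
  have "distr M N f \<Otimes>\<^sub>M distr M borel (V k) = distr M (N \<Otimes>\<^sub>M borel) (\<lambda>\<omega>. (f \<omega>, V k \<omega>))"
  proof (rule pair_measure_eqI)
    fix A B assume "A \<in> sets (distr M N f)" "B \<in> sets (distr M borel (V k))"
    then have A [measurable]: "A \<in> sets N" and B [measurable]: "B \<in> sets borel" by auto
    have "(\<lambda>\<omega>. (f \<omega>, V k \<omega>)) -` (A \<times> B) \<inter> space M = (f -` A \<inter> space M) \<inter> (V k -` B \<inter> space M)"
      by auto
    moreover have "prob ((f -` A \<inter> space M) \<inter> (V k -` B \<inter> space M)) = prob (f -` A \<inter> space M) * prob (V k -` B \<inter> space M)"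
      using measurable_sets[OF f A] by (intro past_indep_sets k B) simp
    ultimately show "emeasure (distr M N f) A * emeasure (distr M borel (V k)) B
        = emeasure (distr M (N \<Otimes>\<^sub>M borel) (\<lambda>\<omega>. (f \<omega>, V k \<omega>))) (A \<times> B)"
      by (simp add: emeasure_distr emeasure_eq_measure ennreal_mult'')
  qed (auto intro: F.sigma_finite_measure_axioms K.sigma_finite_measure_axioms)
  then show ?thesis by simp
qed

lemma past_indep_var:
  assumes f: "f \<in> borel_measurable (past k)" and k: "1 \<le> k"
  shows "indep_var borel f borel (V k)"
  unfolding indep_var_distribution_eq
  using past_measurable_M[OF f] V_measurable[OF k] past_joint_distribution[OF f k] by simp

end

section \<open>A central limit theorem for martingale transforms of independent noise\<close>

locale iid_noise = independent_sequence M V for M :: "'a measure" and V +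
  fixes s2 :: real
  assumes V_ident: "\<And>k. 1 \<le> k \<Longrightarrow> distr M borel (V k) = distr M borel (V 1)"
    and V_4: "\<And>k. 1 \<le> k \<Longrightarrow> integrable M (\<lambda>\<omega>. V k \<omega> ^ 4)"
    and V_mean: "\<And>k. 1 \<le> k \<Longrightarrow> expectation (V k) = 0"
    and V_var: "\<And>k. 1 \<le> k \<Longrightarrow> expectation (\<lambda>\<omega>. (V k \<omega>)\<^sup>2) = s2"
    and s2_pos: "0 < s2"
begin

lemma V_moments:
  assumes "1 \<le> k"
  shows "integrable M (V k)" "integrable M (\<lambda>\<omega>. (V k \<omega>)\<^sup>2)" "integrable M (\<lambda>\<omega>. \<bar>V k \<omega>\<bar> ^ 3)"
proof -
  note [measurable] = V_measurable[OF assms]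
  have le: "\<bar>x\<bar> ^ j \<le> 1 + x ^ 4" if "j \<le> 4" for j and x :: real
  proof (cases "\<bar>x\<bar> \<le> 1")
    case True
    then have "\<bar>x\<bar> ^ j \<le> 1" by (simp add: power_le_one)
    then show ?thesis by (simp add: add_increasing2)
  next
    case False
    then have "\<bar>x\<bar> ^ j \<le> \<bar>x\<bar> ^ 4" using that by (intro power_increasing) auto
    then show ?thesis by simp
  qed
  have int: "integrable M (\<lambda>\<omega>. 1 + V k \<omega> ^ 4)" using V_4[OF assms] by simp
  have *: "integrable M (\<lambda>\<omega>. \<bar>V k \<omega>\<bar> ^ j)" if "j \<le> 4" for j
    by (rule Bochner_Integration.integrable_bound[OF int]) (use le[OF that] in \<open>auto intro!: AE_I2 simp: abs_of_nonneg\<close>)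
  show "integrable M (V k)" using *[of 1] by (simp add: integrable_abs_iff)
  show "integrable M (\<lambda>\<omega>. (V k \<omega>)\<^sup>2)" using *[of 2] by simp
  show "integrable M (\<lambda>\<omega>. \<bar>V k \<omega>\<bar> ^ 3)" using *[of 3] by simp
qed

definition \<phi> :: "real \<Rightarrow> complex" where
  "\<phi> u = char (distr M borel (V 1)) u"

text \<open>
  Both the characteristic function of the noise and the Gaussian one agree with \<open>1 - s2 * u\<^sup>2 / 2\<close> up to a
  multiple of \<open>\<bar>u\<bar>\<^sup>3\<close>; for the Gaussian one, \<open>exp (- y) - (1 - y)\<close> lies between 0 and both \<open>y\<close> and \<open>y\<^sup>2\<close>.
\<close>

lemma char_expansion:
  obtains C where "0 \<le> C" "\<And>u. cmod (\<phi> u - of_real (exp (- (s2 * u\<^sup>2 / 2)))) \<le> C * \<bar>u\<bar> ^ 3"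
proof -
  define C3 where "C3 = expectation (\<lambda>\<omega>. \<bar>V 1 \<omega>\<bar> ^ 3)"
  have C3: "C3 \<ge> 0" unfolding C3_def by (rule Bochner_Integration.integral_nonneg) simp
  note V1 = V_measurable[of 1, simplified] V_moments[of 1, simplified]
  note [measurable] = V1(1)
  have "cmod (\<phi> u - of_real (exp (- (s2 * u\<^sup>2 / 2)))) \<le> (C3 / 6 + s2\<^sup>2 + s2) * \<bar>u\<bar> ^ 3" for u
  proof -
    have 1: "cmod (\<phi> u - (1 - u\<^sup>2 * s2 / 2)) \<le> C3 / 6 * \<bar>u\<bar> ^ 3"
    proof -
      have "cmod (\<phi> u - (1 - u\<^sup>2 * s2 / 2)) \<le> (u\<^sup>2 / 6) * expectation (\<lambda>\<omega>. min (6 * (V 1 \<omega>)\<^sup>2) (\<bar>u\<bar> * \<bar>V 1 \<omega>\<bar> ^ 3))"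
        unfolding \<phi>_def using V1 V_mean[of 1] V_var[of 1] by (intro char_approx3') auto
      also have "\<dots> \<le> (u\<^sup>2 / 6) * expectation (\<lambda>\<omega>. \<bar>u\<bar> * \<bar>V 1 \<omega>\<bar> ^ 3)"
        using V1 by (intro mult_left_mono integral_mono integrable_min) auto
      also have "\<dots> = C3 / 6 * \<bar>u\<bar> ^ 3"
        by (simp add: C3_def power3_eq_cube power2_eq_square)
      finally show ?thesis .
    qed
    define y where "y = s2 * u\<^sup>2 / 2"
    have y0: "y \<ge> 0" using s2_pos by (simp add: y_def)
    have "\<bar>exp (- y) - (1 - y)\<bar> \<le> (s2\<^sup>2 + s2) * \<bar>u\<bar> ^ 3"
    proof -
      have lower: "0 \<le> exp (- y) - (1 - y)" using exp_ge_add_one_self[of "- y"] by simp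
      show ?thesis
      proof (cases "\<bar>u\<bar> \<le> 1")
        case True
        have "exp (- y) \<le> 1 / (1 + y)"
          unfolding exp_minus inverse_eq_divide using exp_ge_add_one_self[of y] y0 by (intro divide_left_mono) auto
        also have "\<dots> \<le> 1 - y + y\<^sup>2"
          using y0 by (simp add: divide_simps power2_eq_square algebra_simps)
        finally have "\<bar>exp (- y) - (1 - y)\<bar> \<le> y\<^sup>2" using lower by simp
        also have "\<dots> = s2\<^sup>2 / 4 * (\<bar>u\<bar> ^ 3 * \<bar>u\<bar>)"
          by (simp add: y_def power2_eq_square power3_eq_cube abs_if)
        also have "\<dots> \<le> s2\<^sup>2 * (\<bar>u\<bar> ^ 3 * 1)"
          using True by (intro mult_mono) auto
        also have "\<dots> \<le> (s2\<^sup>2 + s2) * \<bar>u\<bar> ^ 3"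
          using s2_pos by (simp add: distrib_right)
        finally show ?thesis .
      next
        case False
        have "\<bar>exp (- y) - (1 - y)\<bar> \<le> y" using lower y0 by simp
        also have "\<dots> \<le> s2 * \<bar>u\<bar> ^ 2" using s2_pos by (simp add: y_def)
        also have "\<dots> \<le> s2 * \<bar>u\<bar> ^ 3"
          using False s2_pos by (intro mult_left_mono power_increasing) auto
        also have "\<dots> \<le> (s2\<^sup>2 + s2) * \<bar>u\<bar> ^ 3"
          by (simp add: distrib_right)
        finally show ?thesis .
      qed
    qed
    then have 2: "cmod (of_real (1 - y) - of_real (exp (- y))) \<le> (s2\<^sup>2 + s2) * \<bar>u\<bar> ^ 3"
      by (simp add: norm_of_real abs_minus_commute flip: of_real_diff)
    have "(1 - u\<^sup>2 * s2 / 2 :: complex) = of_real (1 - y)" by (simp add: y_def)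
    then have "cmod (\<phi> u - of_real (exp (- y))) \<le> C3 / 6 * \<bar>u\<bar> ^ 3 + (s2\<^sup>2 + s2) * \<bar>u\<bar> ^ 3"
      using norm_triangle_mono[OF 1 2] by simp
    then show ?thesis by (simp add: y_def algebra_simps)
  qed
  moreover have "C3 / 6 + s2\<^sup>2 + s2 \<ge> 0" using C3 s2_pos by simp
  ultimately show ?thesis using that by blast
qed

lemma \<phi>_measurable [measurable]: "\<phi> \<in> borel_measurable borel"
proof -
  interpret D: real_distribution "distr M borel (V 1)"
    using V_measurable[of 1] by (simp add: real_distribution_distr)
  show ?thesis unfolding \<phi>_def[abs_def] by (rule D.char_measurable)
qed

text \<open>
  Integrating out \<open>V\<^sub>k\<close> with the past held fixed.
\<close>

lemma condition_on_past:
  assumes A: "A \<in> borel_measurable (past k)" and u: "u \<in> borel_measurable (past k)" and k: "1 \<le> k"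
    and bnd: "\<And>\<omega>. \<omega> \<in> space M \<Longrightarrow> cmod (A \<omega>) \<le> C"
  shows "expectation (\<lambda>\<omega>. A \<omega> * iexp (u \<omega> * V k \<omega>)) = expectation (\<lambda>\<omega>. A \<omega> * \<phi> (u \<omega>))"
proof -
  note [measurable] = past_measurable_M[OF A] past_measurable_M[OF u] V_measurable[OF k]
  define F where "F \<omega> = (A \<omega>, u \<omega>)" for \<omega>
  have F: "F \<in> measurable (past k) (borel \<Otimes>\<^sub>M borel)" unfolding F_def using A u by measurable
  note [measurable] = past_measurable_M[OF F]
  define \<mu> where "\<mu> = distr M borel (V 1)"
  define \<nu> where "\<nu> = distr M (borel \<Otimes>\<^sub>M borel) F"
  interpret \<mu>: prob_space \<mu> unfolding \<mu>_def by (rule prob_space_distr) (use V_measurable[of 1] in simp)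
  interpret \<nu>: prob_space \<nu> unfolding \<nu>_def by (rule prob_space_distr) simp
  interpret P: pair_prob_space \<nu> \<mu> ..
  have joint: "distr M ((borel \<Otimes>\<^sub>M borel) \<Otimes>\<^sub>M borel) (\<lambda>\<omega>. (F \<omega>, V k \<omega>)) = \<nu> \<Otimes>\<^sub>M \<mu>"
    unfolding past_joint_distribution[OF F k] \<nu>_def \<mu>_def V_ident[OF k] ..
  define g where "g z = fst (fst z) * iexp (snd (fst z) * snd z)" for z :: "(complex \<times> real) \<times> real"
  have g [measurable]: "g \<in> borel_measurable ((borel \<Otimes>\<^sub>M borel) \<Otimes>\<^sub>M borel)" unfolding g_def by measurable
  have s\<nu>: "sets \<nu> = sets (borel \<Otimes>\<^sub>M borel)" "sets \<mu> = sets borel" by (simp_all add: \<nu>_def \<mu>_def)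
  have "integrable M (\<lambda>\<omega>. g (F \<omega>, V k \<omega>))"
    by (rule integrable_const_bound[where B = C]) (use bnd in \<open>auto simp: g_def F_def norm_mult intro!: AE_I2\<close>)
  then have int: "integrable (\<nu> \<Otimes>\<^sub>M \<mu>) g"
    unfolding joint[symmetric] by (subst integrable_distr_eq) auto
  have "expectation (\<lambda>\<omega>. A \<omega> * iexp (u \<omega> * V k \<omega>)) = expectation (\<lambda>\<omega>. g (F \<omega>, V k \<omega>))"
    by (simp add: g_def F_def)
  also have "\<dots> = integral\<^sup>L (\<nu> \<Otimes>\<^sub>M \<mu>) g"
    unfolding joint[symmetric] by (subst integral_distr) auto
  also have "\<dots> = (\<integral>w. (\<integral>y. g (w, y) \<partial>\<mu>) \<partial>\<nu>)"
    using P.integral_fst'[OF int] by simp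
  also have "\<dots> = (\<integral>w. fst w * \<phi> (snd w) \<partial>\<nu>)"
    by (simp add: g_def \<phi>_def char_def \<mu>_def)
  also have "\<dots> = expectation (\<lambda>\<omega>. fst (F \<omega>) * \<phi> (snd (F \<omega>)))"
    unfolding \<nu>_def by (subst integral_distr) auto
  finally show ?thesis by (simp add: F_def)
qed


text \<open>
  Let \<open>u\<^sub>k = t H\<^sub>k / \<surd>n\<close>, set to 0 as soon as \<open>\<Sum>H\<^sub>j\<^sup>2\<close> exceeds \<open>2 L n\<close>. The products
  \<open>P\<^sub>m = exp (\<Sum>k\<le>m. \<i> u\<^sub>k V\<^sub>k + s2 u\<^sub>k\<^sup>2 / 2)\<close> are then uniformly bounded, and by conditioning on the past each factor
  changes the expectation by \<open>O(n\<^sup>-\<^sup>3\<^sup>/\<^sup>2)\<close> only, so \<open>E P\<^sub>n\<close> tends to 1. Almost surely the truncation is eventually void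
  and \<open>\<Sum>u\<^sub>k\<^sup>2\<close> tends to \<open>t\<^sup>2 L\<close>, so the real factor of \<open>P\<^sub>n\<close> can be replaced by a constant.
\<close>

theorem martingale_transform_clt:
  fixes H :: "nat \<Rightarrow> 'a \<Rightarrow> real"
  assumes H: "\<And>k. 1 \<le> k \<Longrightarrow> H k \<in> borel_measurable (past k)"
    and H3: "\<And>k. 1 \<le> k \<Longrightarrow> integrable M (\<lambda>\<omega>. \<bar>H k \<omega>\<bar> ^ 3)"
    and K: "\<And>k. 1 \<le> k \<Longrightarrow> expectation (\<lambda>\<omega>. \<bar>H k \<omega>\<bar> ^ 3) \<le> K"
    and lln: "AE \<omega> in M. (\<lambda>n. (\<Sum>k=1..n. (H k \<omega>)\<^sup>2) / real n) \<longlonglongrightarrow> L"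
    and L: "0 < L"
  shows "(\<lambda>n. expectation (\<lambda>\<omega>. iexp (t * ((\<Sum>k=1..n. V k \<omega> * H k \<omega>) / sqrt (real n)))))
    \<longlonglongrightarrow> of_real (exp (- (s2 * L * t\<^sup>2 / 2)))"
proof -
  note V_M [measurable] = V_measurable
  have H_M [measurable]: "H k \<in> borel_measurable M" if "1 \<le> k" for k using H[OF that] by (rule past_measurable_M)
  obtain C where C: "0 \<le> C" "\<And>u. cmod (\<phi> u - of_real (exp (- (s2 * u\<^sup>2 / 2)))) \<le> C * \<bar>u\<bar> ^ 3"
    using char_expansion by metis
  have K0: "K \<ge> 0" using K[of 1] order_trans[OF _ K[of 1]] by simp
  define \<kappa> where "\<kappa> = s2 * L * t\<^sup>2 / 2"
  define Q where "Q k \<omega> = (\<Sum>j=1..k. (H j \<omega>)\<^sup>2)" for k \<omega>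
  define u where "u n k \<omega> = (if Q k \<omega> \<le> 2 * L * real n then t / sqrt (real n) * H k \<omega> else 0)" for n k \<omega>
  define G where "G n m \<omega> = (\<Sum>k=1..m. (u n k \<omega>)\<^sup>2)" for n m \<omega>
  define P where "P n m \<omega> = exp (\<i> * of_real (\<Sum>k=1..m. u n k \<omega> * V k \<omega>) + of_real (s2 * G n m \<omega> / 2))" for n m \<omega>
  define B where "B = exp (2 * \<kappa>)"
  have Q_past: "Q k \<in> borel_measurable (past l)" if "k \<le> l" for k l
    unfolding Q_def by (intro borel_measurable_sum borel_measurable_power past_mono[OF _ H]) (use that in auto)
  have u_past: "u n k \<in> borel_measurable (past l)" if "1 \<le> k" "k \<le> l" for n k l
  proof -
    note [measurable] = Q_past[OF that(2)] past_mono[OF that(2) H[OF that(1)]]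
    show ?thesis unfolding u_def by measurable
  qed
  have G_past: "G n m \<in> borel_measurable (past l)" if "m \<le> l" for n m l
    unfolding G_def by (intro borel_measurable_sum borel_measurable_power u_past) (use that in auto)
  have P_past: "P n m \<in> borel_measurable (past (Suc m))" for n m
  proof -
    have [measurable]: "(\<lambda>\<omega>. \<Sum>k=1..m. u n k \<omega> * V k \<omega>) \<in> borel_measurable (past (Suc m))"
      by (intro borel_measurable_sum borel_measurable_times u_past V_past) auto
    have [measurable]: "G n m \<in> borel_measurable (past (Suc m))" by (rule G_past) simp
    show ?thesis unfolding P_def by measurable
  qed
  have G_le: "G n m \<omega> \<le> 2 * L * t\<^sup>2" if n: "1 \<le> n" for n m \<omega>
  proof (induction m)
    case (Suc m)
    show ?case
    proof (cases "Q (Suc m) \<omega> \<le> 2 * L * real n")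
      case True
      have "G n (Suc m) \<omega> \<le> (\<Sum>k=1..Suc m. t\<^sup>2 / real n * (H k \<omega>)\<^sup>2)"
        unfolding G_def by (intro sum_mono) (auto simp: u_def power_mult_distrib power_divide)
      also have "\<dots> = t\<^sup>2 / real n * Q (Suc m) \<omega>" by (simp only: Q_def sum_distrib_left)
      also have "\<dots> \<le> t\<^sup>2 / real n * (2 * L * real n)" using True by (intro mult_left_mono) auto
      finally show ?thesis using n by (simp add: mult.commute)
    next
      case False
      then have "u n (Suc m) \<omega> = 0" by (simp add: u_def)
      then show ?thesis using Suc by (simp add: G_def)
    qed
  qed (use L in \<open>simp add: G_def\<close>)
  have norm_P: "cmod (P n m \<omega>) = exp (s2 * G n m \<omega> / 2)" for n m \<omega>
    by (simp add: P_def norm_exp_eq_Re)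
  have exp_G: "exp (s2 * G n m \<omega> / 2) \<le> B" if "1 \<le> n" for n m \<omega>
    using mult_left_mono[OF G_le[OF that, of m \<omega>], of s2] s2_pos by (simp add: B_def \<kappa>_def mult_ac)
  have P_le: "cmod (P n m \<omega>) \<le> B" if "1 \<le> n" for n m \<omega>
    unfolding norm_P by (rule exp_G[OF that])
  have P_M [measurable]: "P n m \<in> borel_measurable M" for n m using P_past by (rule past_measurable_M)
  have P_int: "integrable M (P n m)" if "1 \<le> n" for n m
    by (rule integrable_const_bound[where B = B]) (use P_le[OF that] in auto)
  have step: "cmod (expectation (P n (Suc m)) - expectation (P n m)) \<le> B * C * \<bar>t\<bar> ^ 3 * K / (sqrt (real n)) ^ 3"
    if n: "1 \<le> n" for n m
  proof -
    define A where "A \<omega> = P n m \<omega> * of_real (exp (s2 * (u n (Suc m) \<omega>)\<^sup>2 / 2))" for \<omega>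
    have u' [measurable]: "u n (Suc m) \<in> borel_measurable (past (Suc m))" by (rule u_past) auto
    note [measurable] = P_past[of n m]
    have A: "A \<in> borel_measurable (past (Suc m))" unfolding A_def by measurable
    have uM [measurable]: "u n (Suc m) \<in> borel_measurable M" using u' by (rule past_measurable_M)
    have A_M [measurable]: "A \<in> borel_measurable M" using A by (rule past_measurable_M)
    have norm_A: "cmod (A \<omega>) \<le> B" for \<omega>
    proof -
      have "cmod (A \<omega>) = exp (s2 * G n (Suc m) \<omega> / 2)"
        by (simp add: A_def norm_mult norm_P G_def exp_add[symmetric] algebra_simps add_divide_distrib)
      then show ?thesis using exp_G[OF n] by simp
    qed
    have 1: "P n (Suc m) \<omega> = A \<omega> * iexp (u n (Suc m) \<omega> * V (Suc m) \<omega>)" for \<omega>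
      by (simp add: P_def A_def G_def exp_add[symmetric] exp_of_real[symmetric] algebra_simps add_divide_distrib del: exp_of_real)
    have 2: "P n m \<omega> = A \<omega> * of_real (exp (- (s2 * (u n (Suc m) \<omega>)\<^sup>2 / 2)))" for \<omega>
      by (simp add: A_def exp_minus of_real_inverse)
    have I1: "integrable M (\<lambda>\<omega>. A \<omega> * \<phi> (u n (Suc m) \<omega>))"
    proof (rule integrable_const_bound[where B = B])
      interpret D: real_distribution "distr M borel (V 1)"
        using V_measurable[of 1] by (simp add: real_distribution_distr)
      have "cmod (A \<omega>) * cmod (\<phi> (u n (Suc m) \<omega>)) \<le> B * 1" for \<omega>
        using norm_A D.cmod_char_le_1 by (intro mult_mono) (auto simp: \<phi>_def B_def)
      then show "AE \<omega> in M. cmod (A \<omega> * \<phi> (u n (Suc m) \<omega>)) \<le> B" by (simp add: norm_mult)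
    qed simp
    have I2: "integrable M (\<lambda>\<omega>. A \<omega> * of_real (exp (- (s2 * (u n (Suc m) \<omega>)\<^sup>2 / 2))))"
      using P_int[OF n, of m] by (simp add: 2[abs_def])
    have le: "cmod (A \<omega> * \<phi> (u n (Suc m) \<omega>) - A \<omega> * of_real (exp (- (s2 * (u n (Suc m) \<omega>)\<^sup>2 / 2))))
        \<le> B * C * \<bar>t\<bar> ^ 3 / (sqrt (real n)) ^ 3 * \<bar>H (Suc m) \<omega>\<bar> ^ 3" for \<omega>
    proof -
      have "cmod (A \<omega> * \<phi> (u n (Suc m) \<omega>) - A \<omega> * of_real (exp (- (s2 * (u n (Suc m) \<omega>)\<^sup>2 / 2))))
          = cmod (A \<omega>) * cmod (\<phi> (u n (Suc m) \<omega>) - of_real (exp (- (s2 * (u n (Suc m) \<omega>)\<^sup>2 / 2))))"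
        by (simp add: norm_mult flip: right_diff_distrib)
      also have "\<dots> \<le> B * (C * \<bar>u n (Suc m) \<omega>\<bar> ^ 3)"
        using norm_A C(2) by (intro mult_mono) (auto simp: B_def)
      also have "\<dots> \<le> B * (C * \<bar>t / sqrt (real n) * H (Suc m) \<omega>\<bar> ^ 3)"
        using C(1) by (intro mult_left_mono power_mono) (auto simp: B_def u_def)
      also have "\<dots> = B * C * \<bar>t\<bar> ^ 3 / (sqrt (real n)) ^ 3 * \<bar>H (Suc m) \<omega>\<bar> ^ 3"
        by (simp add: abs_mult power_mult_distrib power_divide)
      finally show ?thesis .
    qed
    have "expectation (P n (Suc m)) - expectation (P n m)
        = expectation (\<lambda>\<omega>. A \<omega> * \<phi> (u n (Suc m) \<omega>) - A \<omega> * of_real (exp (- (s2 * (u n (Suc m) \<omega>)\<^sup>2 / 2))))"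
      unfolding 1[abs_def] 2[abs_def]
      using condition_on_past[OF A u' _ norm_A] I1 I2 by simp
    also have "cmod \<dots> \<le> expectation (\<lambda>\<omega>. cmod (A \<omega> * \<phi> (u n (Suc m) \<omega>) - A \<omega> * of_real (exp (- (s2 * (u n (Suc m) \<omega>)\<^sup>2 / 2)))))"
      by (rule integral_norm_bound)
    also have "\<dots> \<le> expectation (\<lambda>\<omega>. B * C * \<bar>t\<bar> ^ 3 / (sqrt (real n)) ^ 3 * \<bar>H (Suc m) \<omega>\<bar> ^ 3)"
      by (rule integral_mono[OF _ _ le]) (use I1 I2 H3[of "Suc m"] in auto)
    also have "\<dots> = B * C * \<bar>t\<bar> ^ 3 / (sqrt (real n)) ^ 3 * expectation (\<lambda>\<omega>. \<bar>H (Suc m) \<omega>\<bar> ^ 3)"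
      by simp
    also have "\<dots> \<le> B * C * \<bar>t\<bar> ^ 3 / (sqrt (real n)) ^ 3 * K"
      using K[of "Suc m"] C(1) by (intro mult_left_mono) (auto simp: B_def)
    finally show ?thesis by simp
  qed
  have total: "cmod (expectation (P n m) - 1) \<le> real m * (B * C * \<bar>t\<bar> ^ 3 * K / (sqrt (real n)) ^ 3)"
    if n: "1 \<le> n" for n m
  proof (induction m)
    case 0
    then show ?case by (simp add: P_def G_def prob_space)
  next
    case (Suc m)
    have "cmod (expectation (P n (Suc m)) - 1)
        \<le> cmod (expectation (P n (Suc m)) - expectation (P n m)) + cmod (expectation (P n m) - 1)"
      using norm_triangle_ineq[of "expectation (P n (Suc m)) - expectation (P n m)" "expectation (P n m) - 1"] by simp
    also have "\<dots> \<le> B * C * \<bar>t\<bar> ^ 3 * K / (sqrt (real n)) ^ 3 + real m * (B * C * \<bar>t\<bar> ^ 3 * K / (sqrt (real n)) ^ 3)"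
      by (intro add_mono step[OF n] Suc)
    also have "\<dots> = real (Suc m) * (B * C * \<bar>t\<bar> ^ 3 * K / (sqrt (real n)) ^ 3)"
      unfolding of_nat_Suc distrib_right mult_1_left by (rule refl)
    finally show ?case .
  qed
  have P_lim: "(\<lambda>n. expectation (P n n)) \<longlonglongrightarrow> 1"
  proof (rule LIM_zero_cancel, rule tendsto_norm_zero_cancel, rule tendsto_sandwich[OF _ _ tendsto_const])
    show "\<forall>\<^sub>F n in sequentially. cmod (expectation (P n n) - 1) \<le> B * C * \<bar>t\<bar> ^ 3 * K / sqrt (real n)"
      using eventually_ge_at_top[of 1]
    proof eventually_elim
      case (elim n)
      have "real n / (sqrt (real n)) ^ 3 = 1 / sqrt (real n)"
        using elim by (simp add: power3_eq_cube)
      then have "real n * (B * C * \<bar>t\<bar> ^ 3 * K / (sqrt (real n)) ^ 3) = B * C * \<bar>t\<bar> ^ 3 * K / sqrt (real n)"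
        by (metis (no_types, lifting) mult.left_neutral mult_of_nat_commute times_divide_eq_left times_divide_eq_right)
      then show ?case using total[OF elim, of n] by simp
    qed
    show "(\<lambda>n. B * C * \<bar>t\<bar> ^ 3 * K / sqrt (real n)) \<longlonglongrightarrow> 0"
      by (rule tendsto_divide_0[OF tendsto_const]) (rule filterlim_at_top_imp_at_infinity,
        rule filterlim_compose[OF sqrt_at_top filterlim_real_sequentially])
  qed simp
  define Z where "Z n \<omega> = iexp (t * ((\<Sum>k=1..n. V k \<omega> * H k \<omega>) / sqrt (real n)))" for n \<omega>
  have Z_M [measurable]: "Z n \<in> borel_measurable M" for n
  proof -
    have [measurable]: "(\<lambda>\<omega>. \<Sum>k=1..n. V k \<omega> * H k \<omega>) \<in> borel_measurable M"
      by (intro borel_measurable_sum borel_measurable_times V_M H_M) auto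
    show ?thesis unfolding Z_def by measurable
  qed
  have Z_int: "integrable M (Z n)" for n
    by (rule integrable_const_bound[where B = 1]) (auto simp: Z_def)
  have diff: "(\<lambda>n. expectation (\<lambda>\<omega>. Z (Suc n) \<omega> * of_real (exp \<kappa>) - P (Suc n) (Suc n) \<omega>)) \<longlonglongrightarrow> expectation (\<lambda>\<omega>. 0)"
  proof (rule integral_dominated_convergence[where w = "\<lambda>_. exp \<kappa> + B"])
    show "AE \<omega> in M. (\<lambda>n. Z (Suc n) \<omega> * of_real (exp \<kappa>) - P (Suc n) (Suc n) \<omega>) \<longlonglongrightarrow> 0"
      using lln
    proof eventually_elim
      case (elim \<omega>)
      have lim: "(\<lambda>n. Q n \<omega> / real n) \<longlonglongrightarrow> L" using elim by (simp add: Q_def)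
      have "\<forall>\<^sub>F n in sequentially. Q n \<omega> / real n < 2 * L"
        using lim by (rule order_tendstoD) (use L in simp)
      then have ev: "\<forall>\<^sub>F n in sequentially. Z n \<omega> * (of_real (exp \<kappa>) - of_real (exp (s2 * t\<^sup>2 / 2 * (Q n \<omega> / real n))))
          = Z n \<omega> * of_real (exp \<kappa>) - P n n \<omega>"
        using eventually_ge_at_top[of 1]
      proof eventually_elim
        case (elim n)
        have u: "u n k \<omega> = t / sqrt (real n) * H k \<omega>" if "k \<le> n" for k
        proof -
          have "Q k \<omega> \<le> Q n \<omega>" unfolding Q_def using that by (intro sum_mono2) auto
          also have "\<dots> \<le> 2 * L * real n" using elim by (simp add: field_simps)
          finally show ?thesis by (simp add: u_def)
        qed
        have "(\<Sum>k=1..n. u n k \<omega> * V k \<omega>) = t * ((\<Sum>k=1..n. V k \<omega> * H k \<omega>) / sqrt (real n))"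
          by (simp add: u sum_divide_distrib sum_distrib_left mult_ac)
        moreover have "G n n \<omega> = t\<^sup>2 * (Q n \<omega> / real n)"
          by (simp add: G_def u Q_def sum_divide_distrib sum_distrib_left power_mult_distrib power_divide)
        ultimately have "P n n \<omega> = Z n \<omega> * of_real (exp (s2 * t\<^sup>2 / 2 * (Q n \<omega> / real n)))"
          by (simp add: P_def Z_def exp_add exp_of_real[symmetric] mult_ac del: exp_of_real)
        then show ?case by (simp add: algebra_simps)
      qed
      have "(\<lambda>n. Z n \<omega> * (of_real (exp \<kappa>) - of_real (exp (s2 * t\<^sup>2 / 2 * (Q n \<omega> / real n))))) \<longlonglongrightarrow> 0"
      proof (rule tendsto_norm_zero_cancel)
        have "(\<lambda>n. \<bar>exp \<kappa> - exp (s2 * t\<^sup>2 / 2 * (Q n \<omega> / real n))\<bar>) \<longlonglongrightarrow> \<bar>exp \<kappa> - exp (s2 * t\<^sup>2 / 2 * L)\<bar>"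
          by (intro tendsto_intros lim)
        also have "exp \<kappa> - exp (s2 * t\<^sup>2 / 2 * L) = 0" by (simp add: \<kappa>_def mult_ac)
        finally show "(\<lambda>n. cmod (Z n \<omega> * (of_real (exp \<kappa>) - of_real (exp (s2 * t\<^sup>2 / 2 * (Q n \<omega> / real n)))))) \<longlonglongrightarrow> 0"
          by (simp add: norm_mult Z_def del: of_real_diff exp_of_real flip: of_real_diff)
      qed
      then have "(\<lambda>n. Z n \<omega> * of_real (exp \<kappa>) - P n n \<omega>) \<longlonglongrightarrow> 0"
        using ev by (rule Lim_transform_eventually)
      then show ?case by (rule LIMSEQ_Suc)
    qed
    fix n
    have "cmod (Z (Suc n) \<omega> * of_real (exp \<kappa>) - P (Suc n) (Suc n) \<omega>) \<le> exp \<kappa> + B" for \<omega>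
    proof -
      have "cmod (Z (Suc n) \<omega> * of_real (exp \<kappa>) - P (Suc n) (Suc n) \<omega>)
          \<le> cmod (Z (Suc n) \<omega> * of_real (exp \<kappa>)) + cmod (P (Suc n) (Suc n) \<omega>)"
        by (rule norm_triangle_ineq4)
      also have "\<dots> \<le> exp \<kappa> + B"
        using P_le[of "Suc n" "Suc n" \<omega>] by (intro add_mono) (simp_all add: norm_mult Z_def)
      finally show ?thesis .
    qed
    then show "AE \<omega> in M. cmod (Z (Suc n) \<omega> * of_real (exp \<kappa>) - P (Suc n) (Suc n) \<omega>) \<le> exp \<kappa> + B" by simp
  qed auto
  have "(\<lambda>n. expectation (\<lambda>\<omega>. Z (Suc n) \<omega> * of_real (exp \<kappa>) - P (Suc n) (Suc n) \<omega>) + expectation (P (Suc n) (Suc n))) \<longlonglongrightarrow> 0 + 1"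
    using diff LIMSEQ_Suc[OF P_lim] by (intro tendsto_add) auto
  also have "(\<lambda>n. expectation (\<lambda>\<omega>. Z (Suc n) \<omega> * of_real (exp \<kappa>) - P (Suc n) (Suc n) \<omega>) + expectation (P (Suc n) (Suc n)))
      = (\<lambda>n. expectation (Z (Suc n)) * of_real (exp \<kappa>))"
    using Z_int P_int[of "Suc _" "Suc _"] by (intro ext) simp
  finally have "(\<lambda>n. expectation (Z n) * of_real (exp \<kappa>)) \<longlonglongrightarrow> 1"
    unfolding add_0_left by (rule LIMSEQ_imp_Suc)
  then have "(\<lambda>n. expectation (Z n) * of_real (exp \<kappa>) * of_real (exp (- \<kappa>))) \<longlonglongrightarrow> 1 * of_real (exp (- \<kappa>))"
    by (intro tendsto_mult_right)
  then have "(\<lambda>n. expectation (Z n)) \<longlonglongrightarrow> of_real (exp (- \<kappa>))"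
    by (simp add: mult.assoc flip: of_real_mult exp_add del: exp_of_real)
  then show ?thesis unfolding Z_def \<kappa>_def .
qed

end

section \<open>Moments and strong laws for the autoregression\<close>

text \<open>
  Take expectations in \<open>contractive_filter.power_le\<close> and argue by induction on time.
\<close>

lemma (in prob_space) filter_moment_bound:
  fixes y u :: "'a \<Rightarrow> int \<Rightarrow> real"
  assumes filt: "\<And>\<omega>. \<omega> \<in> space M \<Longrightarrow> contractive_filter q w (y \<omega>) (u \<omega>)"
    and meas: "\<And>k. (\<lambda>\<omega>. y \<omega> k) \<in> borel_measurable M"
    and u_int: "\<And>k. 0 \<le> k \<Longrightarrow> integrable M (\<lambda>\<omega>. \<bar>u \<omega> k\<bar> ^ Suc r)"
    and u_le: "\<And>k. 0 \<le> k \<Longrightarrow> expectation (\<lambda>\<omega>. \<bar>u \<omega> k\<bar> ^ Suc r) \<le> C"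
  shows "integrable M (\<lambda>\<omega>. \<bar>y \<omega> k\<bar> ^ Suc r)
    \<and> expectation (\<lambda>\<omega>. \<bar>y \<omega> k\<bar> ^ Suc r) \<le> C / (1 - (\<Sum>i<q. \<bar>w i\<bar>)) ^ Suc r"
proof -
  obtain \<omega>0 where "\<omega>0 \<in> space M" using not_empty by auto
  define gap where "gap = 1 - (\<Sum>i<q. \<bar>w i\<bar>)"
  have gap: "gap > 0" using contractive_filter.contr[OF filt[OF \<open>\<omega>0 \<in> space M\<close>]] by (simp add: gap_def)
  have C0: "0 \<le> C" using order_trans[OF Bochner_Integration.integral_nonneg u_le[of 0]] by simp
  define D where "D = C / gap ^ Suc r"
  have D0: "D \<ge> 0" using C0 gap by (simp add: D_def)
  note [measurable] = meas
  have "\<forall>k<int n. integrable M (\<lambda>\<omega>. \<bar>y \<omega> k\<bar> ^ Suc r) \<and> expectation (\<lambda>\<omega>. \<bar>y \<omega> k\<bar> ^ Suc r) \<le> D" for n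
  proof (induction n)
    case 0
    show ?case
    proof (intro allI impI)
      fix k :: int assume k: "k < int 0"
      have z: "\<bar>y \<omega> k\<bar> ^ Suc r = 0" if "\<omega> \<in> space M" for \<omega>
        using contractive_filter.causal_y[OF filt[OF that]] k by (simp add: causal_def)
      have "integrable M (\<lambda>\<omega>. \<bar>y \<omega> k\<bar> ^ Suc r) = integrable M (\<lambda>\<omega>. 0 :: real)"
        by (rule Bochner_Integration.integrable_cong) (use z in auto)
      moreover have "expectation (\<lambda>\<omega>. \<bar>y \<omega> k\<bar> ^ Suc r) = expectation (\<lambda>\<omega>. 0)"
        by (rule Bochner_Integration.integral_cong) (use z in auto)
      ultimately show "integrable M (\<lambda>\<omega>. \<bar>y \<omega> k\<bar> ^ Suc r) \<and> expectation (\<lambda>\<omega>. \<bar>y \<omega> k\<bar> ^ Suc r) \<le> D"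
        using D0 by simp
    qed
  next
    case (Suc n)
    show ?case
    proof (intro allI impI)
      fix k assume k: "k < int (Suc n)"
      show "integrable M (\<lambda>\<omega>. \<bar>y \<omega> k\<bar> ^ Suc r) \<and> expectation (\<lambda>\<omega>. \<bar>y \<omega> k\<bar> ^ Suc r) \<le> D"
      proof (cases "k < int n")
        case True
        then show ?thesis using Suc by blast
      next
        case False
        then have kn: "k = int n" using k by simp
        define b where "b \<omega> = (\<Sum>i<q. \<bar>w i\<bar> * \<bar>y \<omega> (k - 1 - int i)\<bar> ^ Suc r) + \<bar>u \<omega> k\<bar> ^ Suc r / gap ^ r" for \<omega>
        have past: "integrable M (\<lambda>\<omega>. \<bar>y \<omega> (k - 1 - int i)\<bar> ^ Suc r)"
          "expectation (\<lambda>\<omega>. \<bar>y \<omega> (k - 1 - int i)\<bar> ^ Suc r) \<le> D" for i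
          using Suc kn by auto
        have uk: "integrable M (\<lambda>\<omega>. \<bar>u \<omega> k\<bar> ^ Suc r)" "expectation (\<lambda>\<omega>. \<bar>u \<omega> k\<bar> ^ Suc r) \<le> C"
          using u_int[of k] u_le[of k] kn by auto
        have b_int: "integrable M b" unfolding b_def
          using past(1) uk(1) by (intro Bochner_Integration.integrable_add Bochner_Integration.integrable_sum
              integrable_mult_right integrable_divide_zero) auto
        have le: "\<bar>y \<omega> k\<bar> ^ Suc r \<le> b \<omega>" if "\<omega> \<in> space M" for \<omega>
        proof -
          interpret F: contractive_filter q w "y \<omega>" "u \<omega>" by (rule filt[OF that])
          show ?thesis using F.power_le[of k r] kn by (simp add: b_def F.gap_def gap_def)
        qed
        have int: "integrable M (\<lambda>\<omega>. \<bar>y \<omega> k\<bar> ^ Suc r)"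
        proof (rule Bochner_Integration.integrable_bound[OF b_int])
          show "AE \<omega> in M. norm (\<bar>y \<omega> k\<bar> ^ Suc r) \<le> norm (b \<omega>)"
            using le by (intro AE_I2) (smt (verit) real_norm_def zero_le_power abs_ge_zero)
        qed simp
        have "expectation (\<lambda>\<omega>. \<bar>y \<omega> k\<bar> ^ Suc r) \<le> expectation b"
          using int b_int le by (intro integral_mono_AE) auto
        also have "expectation b = (\<Sum>i<q. \<bar>w i\<bar> * expectation (\<lambda>\<omega>. \<bar>y \<omega> (k - 1 - int i)\<bar> ^ Suc r))
            + expectation (\<lambda>\<omega>. \<bar>u \<omega> k\<bar> ^ Suc r) / gap ^ r"
          unfolding b_def using past(1) uk(1)
          by (subst Bochner_Integration.integral_add)
            (auto intro!: Bochner_Integration.integrable_sum integrable_mult_right simp: Bochner_Integration.integral_sum)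
        also have "\<dots> \<le> (\<Sum>i<q. \<bar>w i\<bar> * D) + C / gap ^ r"
          using past(2) uk(2) gap by (intro add_mono sum_mono mult_left_mono divide_right_mono) auto
        also have "\<dots> = (1 - gap) * D + gap * D"
        proof -
          have "(\<Sum>i<q. \<bar>w i\<bar> * D) = (1 - gap) * D" by (simp add: gap_def sum_distrib_right)
          moreover have "C / gap ^ r = gap * D" using gap by (simp add: D_def)
          ultimately show ?thesis by simp
        qed
        also have "\<dots> = D" by (simp add: algebra_simps)
        finally show ?thesis using int by simp
      qed
    qed
  qed
  from this[of "nat k + 1"] show ?thesis unfolding D_def gap_def by (simp del: power_Suc)
qed

context iid_noise
begin

lemma past_times_V:
  assumes F: "F \<in> borel_measurable (past k)" "integrable M F" and k: "1 \<le> k"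
  shows "integrable M (\<lambda>\<omega>. F \<omega> * V k \<omega>)" "expectation (\<lambda>\<omega>. F \<omega> * V k \<omega>) = 0"
    "integrable M (\<lambda>\<omega>. F \<omega> * (V k \<omega>)\<^sup>2)" "expectation (\<lambda>\<omega>. F \<omega> * (V k \<omega>)\<^sup>2) = expectation F * s2"
proof -
  have ind: "indep_var borel F borel (V k)" by (rule past_indep_var[OF F(1) k])
  have "indep_var borel (id \<circ> F) borel ((\<lambda>z. z\<^sup>2) \<circ> V k)"
    by (rule indep_var_compose[OF ind]) auto
  then have ind2: "indep_var borel F borel (\<lambda>\<omega>. (V k \<omega>)\<^sup>2)" by (simp add: comp_def)
  note V = V_moments[OF k]
  show "integrable M (\<lambda>\<omega>. F \<omega> * V k \<omega>)" by (rule indep_var_integrable[OF ind F(2) V(1)])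
  show "expectation (\<lambda>\<omega>. F \<omega> * V k \<omega>) = 0"
    using indep_var_lebesgue_integral[OF ind F(2) V(1)] V_mean[OF k] by simp
  show "integrable M (\<lambda>\<omega>. F \<omega> * (V k \<omega>)\<^sup>2)" by (rule indep_var_integrable[OF ind2 F(2) V(2)])
  show "expectation (\<lambda>\<omega>. F \<omega> * (V k \<omega>)\<^sup>2) = expectation F * s2"
    using indep_var_lebesgue_integral[OF ind2 F(2) V(2)] V_var[OF k] by simp
qed

lemma expectation_V_cong:
  fixes g :: "real \<Rightarrow> real"
  assumes "1 \<le> k" "g \<in> borel_measurable borel"
  shows "expectation (\<lambda>\<omega>. g (V k \<omega>)) = expectation (\<lambda>\<omega>. g (V 1 \<omega>))"
  using integral_distr[OF V_measurable[OF assms(1)] assms(2)]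
    integral_distr[OF V_measurable[of 1] assms(2)] V_ident[OF assms(1)] by simp

text \<open>
  The innovations with initial value 0, as a causal path.
\<close>

definition w :: "'a \<Rightarrow> int \<Rightarrow> real" where
  "w \<omega> k = (if k \<le> 0 then 0 else V (nat k) \<omega>)"

lemma w_past: "k < int n \<Longrightarrow> (\<lambda>\<omega>. w \<omega> k) \<in> borel_measurable (past n)"
  by (cases "k \<le> 0") (auto simp: w_def intro!: V_past)

lemma ip_w: "ip (w \<omega>) g n = (\<Sum>k=1..n. V k \<omega> * g (int k))"
  by (simp add: ip_def w_def atMost_atLeast0 sum.atLeast_Suc_atMost)

text \<open>
  The variables \<open>V\<^sub>k\<^sup>2 - s2\<close> are orthogonal, and square integrable because the noise has a fourth moment.
\<close>

lemma noise_mean_square: "AE \<omega> in M. (\<lambda>n. ip (w \<omega>) (w \<omega>) n / real n) \<longlonglongrightarrow> s2"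
proof -
  define \<xi> where "\<xi> k \<omega> = (if k = 0 then 0 else (V k \<omega>)\<^sup>2 - s2)" for k \<omega>
  have past: "\<xi> k \<in> borel_measurable (past l)" if "k < l" for k l
    using V_past[of k l] that by (cases "k = 0") (auto simp: \<xi>_def[abs_def])
  have meas: "\<xi> k \<in> borel_measurable M" for k using past[of k "Suc k"] past_measurable_M by blast
  have sq: "integrable M (\<lambda>\<omega>. (\<xi> k \<omega>)\<^sup>2)" and int: "integrable M (\<xi> k)" for k
  proof -
    have "(\<xi> k \<omega>)\<^sup>2 = (if k = 0 then 0 else V k \<omega> ^ 4 - 2 * s2 * (V k \<omega>)\<^sup>2 + s2\<^sup>2)" for \<omega>
      by (simp add: \<xi>_def power2_eq_square power4_eq_xxxx algebra_simps)
    then show "integrable M (\<lambda>\<omega>. (\<xi> k \<omega>)\<^sup>2)" using V_4[of k] V_moments(2)[of k] by (cases "k = 0") auto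
    show "integrable M (\<xi> k)" using V_moments(2)[of k] by (cases "k = 0") (auto simp: \<xi>_def[abs_def])
  qed
  have C: "expectation (\<lambda>\<omega>. (\<xi> k \<omega>)\<^sup>2) \<le> expectation (\<lambda>\<omega>. ((V 1 \<omega>)\<^sup>2 - s2)\<^sup>2)" for k
    using expectation_V_cong[of k "\<lambda>z. (z\<^sup>2 - s2)\<^sup>2"] by (cases "k = 0") (auto simp: \<xi>_def)
  have orth1: "expectation (\<lambda>\<omega>. \<xi> k \<omega> * \<xi> l \<omega>) = 0" if "k < l" for k l
  proof -
    have "expectation (\<lambda>\<omega>. \<xi> k \<omega> * \<xi> l \<omega>) = expectation (\<lambda>\<omega>. \<xi> k \<omega> * (V l \<omega>)\<^sup>2 - s2 * \<xi> k \<omega>)"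
      using that by (intro Bochner_Integration.integral_cong) (auto simp: \<xi>_def algebra_simps)
    also have "\<dots> = 0"
      using past_times_V(3,4)[OF past[OF that] int, of] that int by (simp add: mult.commute)
    finally show ?thesis .
  qed
  have orth: "expectation (\<lambda>\<omega>. \<xi> k \<omega> * \<xi> l \<omega>) = 0" if "k \<noteq> l" for k l
    using orth1[of k l] orth1[of l k] that by (cases "k < l") (auto simp: mult.commute)
  have "AE \<omega> in M. negl (\<lambda>n. \<Sum>k\<le>n. \<xi> k \<omega>)" by (rule orthogonal_strong_law[OF meas sq C orth])
  then show ?thesis
  proof eventually_elim
    case (elim \<omega>)
    have "(\<Sum>k\<le>n. \<xi> k \<omega>) = ip (w \<omega>) (w \<omega>) n - s2 * real n" for n
      unfolding ip_w by (simp add: \<xi>_def w_def atMost_atLeast0 sum.atLeast_Suc_atMost power2_eq_square sum_subtractf)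
    then have "near (ip (w \<omega>) (w \<omega>)) (\<lambda>n. s2 * real n)" using elim by (simp add: near_def)
    then show ?case unfolding near_linear_iff .
  qed
qed

text \<open>
  For \<open>j \<ge> 1\<close> the products \<open>V\<^sub>k y\<^sub>k\<^sub>-\<^sub>j\<close> are orthogonal: the latest noise variable in a product of two of them is
  independent of the other factors and has mean zero.
\<close>

lemma cross_products:
  fixes y :: "'a \<Rightarrow> int \<Rightarrow> real"
  assumes past: "\<And>k n. k < int n \<Longrightarrow> (\<lambda>\<omega>. y \<omega> k) \<in> borel_measurable (past n)"
    and sq: "\<And>k. integrable M (\<lambda>\<omega>. (y \<omega> k)\<^sup>2)"
    and C: "\<And>k. expectation (\<lambda>\<omega>. (y \<omega> k)\<^sup>2) \<le> C"
    and j: "1 \<le> j"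
  shows "AE \<omega> in M. negl (ip (w \<omega>) (lag j (y \<omega>)))"
    "integrable M (\<lambda>\<omega>. (ip (w \<omega>) (lag j (y \<omega>)) n)\<^sup>2)"
    "expectation (\<lambda>\<omega>. (ip (w \<omega>) (lag j (y \<omega>)) n)\<^sup>2) \<le> C * s2 * real (Suc n)"
proof -
  define \<xi> where "\<xi> k \<omega> = w \<omega> (int k) * y \<omega> (int k - int j)" for k \<omega>
  have y_M: "(\<lambda>\<omega>. y \<omega> k) \<in> borel_measurable M" for k
    by (rule past_measurable_M[OF past[of k "nat k + 1"]]) simp
  have \<xi>_past: "\<xi> k \<in> borel_measurable (past l)" if "k < l" for k l
    unfolding \<xi>_def[abs_def] using that j by (intro borel_measurable_times w_past past) auto
  have meas: "\<xi> k \<in> borel_measurable M" for k using \<xi>_past[of k "Suc k"] past_measurable_M by blast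
  have C0: "0 \<le> C" using order_trans[OF Bochner_Integration.integral_nonneg C[of 0]] by simp
  have ypast2: "(\<lambda>\<omega>. (y \<omega> (int k - int j))\<^sup>2) \<in> borel_measurable (past k)" if "1 \<le> k" for k
    using past[of "int k - int j" k] j by (intro borel_measurable_power) auto
  have \<xi>2: "(\<xi> k \<omega>)\<^sup>2 = (if k = 0 then 0 else (y \<omega> (int k - int j))\<^sup>2 * (V k \<omega>)\<^sup>2)" for k \<omega>
    by (simp add: \<xi>_def w_def power_mult_distrib mult.commute)
  have \<xi>sq: "integrable M (\<lambda>\<omega>. (\<xi> k \<omega>)\<^sup>2)" and \<xi>C: "expectation (\<lambda>\<omega>. (\<xi> k \<omega>)\<^sup>2) \<le> C * s2" for k
  proof -
    show "integrable M (\<lambda>\<omega>. (\<xi> k \<omega>)\<^sup>2)"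
      unfolding \<xi>2 using past_times_V(3)[OF ypast2 sq, of k] by (cases "k = 0") auto
    show "expectation (\<lambda>\<omega>. (\<xi> k \<omega>)\<^sup>2) \<le> C * s2"
      unfolding \<xi>2 using past_times_V(4)[OF ypast2 sq, of k] C s2_pos C0 by (cases "k = 0") auto
  qed
  have orth1: "expectation (\<lambda>\<omega>. \<xi> k \<omega> * \<xi> l \<omega>) = 0" if "k < l" for k l
  proof -
    have F: "(\<lambda>\<omega>. \<xi> k \<omega> * y \<omega> (int l - int j)) \<in> borel_measurable (past l)"
      using that j by (intro borel_measurable_times \<xi>_past past) auto
    have "integrable M (\<lambda>\<omega>. \<xi> k \<omega> * y \<omega> (int l - int j))"
      by (rule integrable_mult_of_squares[OF meas y_M \<xi>sq sq])
    then have "expectation (\<lambda>\<omega>. \<xi> k \<omega> * y \<omega> (int l - int j) * V l \<omega>) = 0"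
      using past_times_V(2)[OF F, of] that by simp
    then show ?thesis using that by (simp add: \<xi>_def w_def mult_ac)
  qed
  have orth: "expectation (\<lambda>\<omega>. \<xi> k \<omega> * \<xi> l \<omega>) = 0" if "k \<noteq> l" for k l
    using orth1[of k l] orth1[of l k] that by (cases "k < l") (auto simp: mult.commute)
  have ip: "ip (w \<omega>) (lag j (y \<omega>)) n = (\<Sum>k\<le>n. \<xi> k \<omega>)" for \<omega> n
    by (simp add: ip_def \<xi>_def lag_def)
  show "AE \<omega> in M. negl (ip (w \<omega>) (lag j (y \<omega>)))"
    unfolding ip[abs_def] by (rule orthogonal_strong_law[OF meas \<xi>sq \<xi>C orth])
  have "integrable M (\<lambda>\<omega>. (\<Sum>k\<in>{..n}. \<xi> k \<omega>)\<^sup>2)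
      \<and> expectation (\<lambda>\<omega>. (\<Sum>k\<in>{..n}. \<xi> k \<omega>)\<^sup>2) \<le> C * s2 * real (card {..n})"
    by (rule expectation_sum_square_le[OF meas \<xi>sq \<xi>C orth]) simp_all
  then show "integrable M (\<lambda>\<omega>. (ip (w \<omega>) (lag j (y \<omega>)) n)\<^sup>2)"
    "expectation (\<lambda>\<omega>. (ip (w \<omega>) (lag j (y \<omega>)) n)\<^sup>2) \<le> C * s2 * real (Suc n)"
    unfolding ip by (simp_all del: of_nat_Suc)
qed

end

section \<open>Removing the initial value\<close>

text \<open>
  The response of the two recursions to a unit initial value.
\<close>

function impulse :: "nat \<Rightarrow> (nat \<Rightarrow> real) \<Rightarrow> real \<Rightarrow> nat \<Rightarrow> real" where
  "impulse p a \<rho> n = \<rho> ^ n + (\<Sum>i\<in>{i. i < p \<and> i < n}. a i * impulse p a \<rho> (n - 1 - i))"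
  by auto
termination by (relation "Wellfounded.measure (\<lambda>(p, a, \<rho>, n). n)") auto

declare impulse.simps [simp del]

locale random_autoregression = iid_noise M V s2 for M :: "'a measure" and V and s2 +
  fixes p :: nat and a :: "nat \<Rightarrow> real" and \<rho> :: real and X0 :: "'a \<Rightarrow> real"
    and x e :: "'a \<Rightarrow> int \<Rightarrow> real"
  assumes p_pos: "1 \<le> p"
    and a_norm: "(\<Sum>i<p. \<bar>a i\<bar>) < 1"
    and rho_lt: "\<bar>\<rho>\<bar> < 1"
    and X0_rv [measurable]: "X0 \<in> borel_measurable M"
    and X0_sq: "integrable M (\<lambda>\<omega>. (X0 \<omega>)\<^sup>2)"
    and x_path: "\<And>\<omega>. \<omega> \<in> space M \<Longrightarrow>
      autoregression p a \<rho> (x \<omega>) (e \<omega>) (\<lambda>k. if k = 0 then X0 \<omega> else w \<omega> k)"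
begin

text \<open>
  \<open>x = y + X0 d\<close>, where \<open>y\<close> solves the same recursions with initial value 0. Unlike \<open>x\<^sub>k\<close>, the variable \<open>y\<^sub>k\<close> is a
  function of \<open>V\<^sub>1, \<dots>, V\<^sub>k\<close>.
\<close>

definition d :: "int \<Rightarrow> real" where
  "d k = (if k < 0 then 0 else impulse p a \<rho> (nat k))"

definition g :: "int \<Rightarrow> real" where
  "g k = (if k < 0 then 0 else \<rho> ^ nat k)"

definition y :: "'a \<Rightarrow> int \<Rightarrow> real" where
  "y \<omega> k = x \<omega> k - X0 \<omega> * d k"

definition f :: "'a \<Rightarrow> int \<Rightarrow> real" where
  "f \<omega> k = e \<omega> k - X0 \<omega> * g k"

definition v :: "'a \<Rightarrow> int \<Rightarrow> real" where
  "v \<omega> k = (if k = 0 then X0 \<omega> else w \<omega> k)"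

lemma x_autoregression: "\<omega> \<in> space M \<Longrightarrow> autoregression p a \<rho> (x \<omega>) (e \<omega>) (v \<omega>)"
  using x_path[of \<omega>] by (simp add: v_def[abs_def])

lemma d_autoregression: "autoregression p a \<rho> d g (\<lambda>k. if k = 0 then 1 else 0)"
proof
  show "1 \<le> p" "(\<Sum>i<p. \<bar>a i\<bar>) < 1" "\<bar>\<rho>\<bar> < 1" by (rule p_pos a_norm rho_lt)+
  show "causal d" "causal g" "causal (\<lambda>k. if k = 0 then 1 else 0)"
    by (auto simp: causal_def d_def g_def)
  fix k :: int assume k: "0 \<le> k"
  have "(\<Sum>i<p. a i * d (k - 1 - int i)) = (\<Sum>i\<in>{i. i < p \<and> i < nat k}. a i * impulse p a \<rho> (nat k - 1 - i))"
  proof (rule sum.mono_neutral_cong_right)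
    show "\<forall>i\<in>{..<p} - {i. i < p \<and> i < nat k}. a i * d (k - 1 - int i) = 0"
      using k by (auto simp: d_def)
    fix i assume "i \<in> {i. i < p \<and> i < nat k}"
    then have "\<not> k - 1 - int i < 0" "nat (k - 1 - int i) = nat k - 1 - i" using k by auto
    then show "a i * d (k - 1 - int i) = a i * impulse p a \<rho> (nat k - 1 - i)" by (simp add: d_def)
  qed auto
  then show "d k = (\<Sum>i<p. a i * d (k - 1 - int i)) + g k"
    using k by (simp add: d_def g_def impulse.simps[of p a \<rho> "nat k"])
  show "g k = \<rho> * g (k - 1) + (if k = 0 then 1 else 0)"
  proof (cases "k = 0")
    case False
    then have "nat k = Suc (nat (k - 1))" using k by simp
    then show ?thesis using False k by (simp add: g_def)
  qed (simp add: g_def)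
qed

lemma y_autoregression:
  assumes "\<omega> \<in> space M"
  shows "autoregression p a \<rho> (y \<omega>) (f \<omega>) (w \<omega>)"
proof -
  interpret X: autoregression p a \<rho> "x \<omega>" "e \<omega>" "v \<omega>" by (rule x_autoregression[OF assms])
  interpret D: autoregression p a \<rho> d g "\<lambda>k. if k = 0 then 1 else 0" by (rule d_autoregression)
  show ?thesis
  proof
    show "1 \<le> p" "(\<Sum>i<p. \<bar>a i\<bar>) < 1" "\<bar>\<rho>\<bar> < 1" by (rule p_pos a_norm rho_lt)+
    show "causal (y \<omega>)" "causal (f \<omega>)" "causal (w \<omega>)"
      using X.causal_x D.causal_x X.causal_e D.causal_e by (auto simp: causal_def y_def f_def w_def)
    fix k :: int assume k: "0 \<le> k"
    show "y \<omega> k = (\<Sum>i<p. a i * y \<omega> (k - 1 - int i)) + f \<omega> k"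
      using X.x_rec[OF k] D.x_rec[OF k]
      by (simp add: y_def f_def algebra_simps sum_subtractf sum_distrib_left)
    show "f \<omega> k = \<rho> * f \<omega> (k - 1) + w \<omega> k"
      using X.e_rec[OF k] D.e_rec[OF k] by (simp add: f_def v_def w_def algebra_simps)
  qed
qed

lemma y_past: "k < int n \<Longrightarrow> (\<lambda>\<omega>. y \<omega> k) \<in> borel_measurable (past n)"
  and f_past: "k < int n \<Longrightarrow> (\<lambda>\<omega>. f \<omega> k) \<in> borel_measurable (past n)"
proof -
  have "(\<forall>k<int n. (\<lambda>\<omega>. f \<omega> k) \<in> borel_measurable (past n)) \<and> (\<forall>k<int n. (\<lambda>\<omega>. y \<omega> k) \<in> borel_measurable (past n))" for n
  proof (induction n)
    case 0
    have y0: "y \<omega> k = 0" and f0: "f \<omega> k = 0" if "\<omega> \<in> space M" "k < 0" for \<omega> k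
      using autoregression.causal_x[OF y_autoregression[OF that(1)]]
        autoregression.causal_e[OF y_autoregression[OF that(1)]] that(2) by (auto simp: causal_def)
    have "(\<lambda>\<omega>. y \<omega> k) \<in> borel_measurable (past 0)" if "k < 0" for k
      by (subst measurable_cong[where g = "\<lambda>_. 0"]) (use y0 that in auto)
    moreover have "(\<lambda>\<omega>. f \<omega> k) \<in> borel_measurable (past 0)" if "k < 0" for k
      by (subst measurable_cong[where g = "\<lambda>_. 0"]) (use f0 that in auto)
    ultimately show ?case by simp
  next
    case (Suc n)
    have fo: "(\<lambda>\<omega>. f \<omega> k) \<in> borel_measurable (past (Suc n))" if "k < int n" for k
      by (rule past_mono[of n "Suc n"]) (use Suc that in auto)
    have yo: "(\<lambda>\<omega>. y \<omega> k) \<in> borel_measurable (past (Suc n))" if "k < int n" for k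
      by (rule past_mono[of n "Suc n"]) (use Suc that in auto)
    have fS: "(\<lambda>\<omega>. f \<omega> k) \<in> borel_measurable (past (Suc n))" if "k < int (Suc n)" for k
    proof (cases "k < int n")
      case True
      then show ?thesis by (rule fo)
    next
      case False
      then have k: "k = int n" using that by simp
      have "(\<lambda>\<omega>. \<rho> * f \<omega> (k - 1) + w \<omega> k) \<in> borel_measurable (past (Suc n))"
        by (intro borel_measurable_add borel_measurable_times borel_measurable_const fo w_past) (use k in auto)
      then show ?thesis
        using autoregression.e_rec[OF y_autoregression] k
        by (subst measurable_cong[where g = "\<lambda>\<omega>. \<rho> * f \<omega> (k - 1) + w \<omega> k"]) auto
    qed
    have yS: "(\<lambda>\<omega>. y \<omega> k) \<in> borel_measurable (past (Suc n))" if "k < int (Suc n)" for k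
    proof (cases "k < int n")
      case True
      then show ?thesis by (rule yo)
    next
      case False
      then have k: "k = int n" using that by simp
      have "(\<lambda>\<omega>. (\<Sum>i<p. a i * y \<omega> (k - 1 - int i)) + f \<omega> k) \<in> borel_measurable (past (Suc n))"
        by (intro borel_measurable_add borel_measurable_sum borel_measurable_times borel_measurable_const yo fS)
          (use k in auto)
      then show ?thesis
        using autoregression.x_rec[OF y_autoregression] k
        by (subst measurable_cong[where g = "\<lambda>\<omega>. (\<Sum>i<p. a i * y \<omega> (k - 1 - int i)) + f \<omega> k"]) auto
    qed
    show ?case using fS yS by blast
  qed
  then show "k < int n \<Longrightarrow> (\<lambda>\<omega>. y \<omega> k) \<in> borel_measurable (past n)"
    "k < int n \<Longrightarrow> (\<lambda>\<omega>. f \<omega> k) \<in> borel_measurable (past n)" by auto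
qed

lemma y_M [measurable]: "(\<lambda>\<omega>. y \<omega> k) \<in> borel_measurable M"
  by (rule past_measurable_M[OF y_past[of k "nat k + 1"]]) simp

lemma f_M [measurable]: "(\<lambda>\<omega>. f \<omega> k) \<in> borel_measurable M"
  by (rule past_measurable_M[OF f_past[of k "nat k + 1"]]) simp

lemma x_M [measurable]: "(\<lambda>\<omega>. x \<omega> k) \<in> borel_measurable M"
proof -
  have "(\<lambda>\<omega>. x \<omega> k) = (\<lambda>\<omega>. y \<omega> k + X0 \<omega> * d k)" by (simp add: y_def)
  then show ?thesis by simp
qed

lemma y_moments:
  assumes "r \<le> 2"
  obtains C where "0 \<le> C" "\<And>k. integrable M (\<lambda>\<omega>. \<bar>y \<omega> k\<bar> ^ Suc r)"
    "\<And>k. expectation (\<lambda>\<omega>. \<bar>y \<omega> k\<bar> ^ Suc r) \<le> C"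
proof -
  define C0 where "C0 = expectation (\<lambda>\<omega>. \<bar>V 1 \<omega>\<bar> ^ Suc r)"
  have C0: "0 \<le> C0" unfolding C0_def by (rule Bochner_Integration.integral_nonneg) simp
  have r: "r = 0 \<or> r = 1 \<or> r = 2" using assms by auto
  have V: "integrable M (\<lambda>\<omega>. \<bar>V k \<omega>\<bar> ^ Suc r)" if "1 \<le> k" for k
    using r V_moments[OF that] by (auto simp: numeral_eq_Suc)
  have w: "integrable M (\<lambda>\<omega>. \<bar>w \<omega> k\<bar> ^ Suc r)" "expectation (\<lambda>\<omega>. \<bar>w \<omega> k\<bar> ^ Suc r) \<le> C0" for k
  proof -
    have "nat k \<ge> 1" if "k > 0" using that by simp
    then show "integrable M (\<lambda>\<omega>. \<bar>w \<omega> k\<bar> ^ Suc r)" "expectation (\<lambda>\<omega>. \<bar>w \<omega> k\<bar> ^ Suc r) \<le> C0"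
      using V[of "nat k"] expectation_V_cong[of "nat k" "\<lambda>z. \<bar>z\<bar> ^ Suc r"] C0
      by (cases "k > 0"; simp add: w_def C0_def del: power_Suc; simp)+
  qed
  have f: "integrable M (\<lambda>\<omega>. \<bar>f \<omega> k\<bar> ^ Suc r) \<and> expectation (\<lambda>\<omega>. \<bar>f \<omega> k\<bar> ^ Suc r)
      \<le> C0 / (1 - (\<Sum>i<1::nat. \<bar>\<rho>\<bar>)) ^ Suc r" for k
  proof (rule filter_moment_bound[where w = "\<lambda>_. \<rho>" and u = w and q = "1::nat"])
    fix \<omega> assume "\<omega> \<in> space M"
    then interpret Y: autoregression p a \<rho> "y \<omega>" "f \<omega>" "w \<omega>" by (rule y_autoregression)
    show "contractive_filter 1 (\<lambda>_. \<rho>) (f \<omega>) (w \<omega>)" by unfold_locales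
  qed (use w in \<open>simp_all del: power_Suc\<close>)
  define C1 where "C1 = C0 / (1 - (\<Sum>i<1::nat. \<bar>\<rho>\<bar>)) ^ Suc r"
  have y: "integrable M (\<lambda>\<omega>. \<bar>y \<omega> k\<bar> ^ Suc r) \<and> expectation (\<lambda>\<omega>. \<bar>y \<omega> k\<bar> ^ Suc r)
      \<le> C1 / (1 - (\<Sum>i<p. \<bar>a i\<bar>)) ^ Suc r" for k
  proof (rule filter_moment_bound[where w = a and u = f and q = p])
    fix \<omega> assume "\<omega> \<in> space M"
    then interpret Y: autoregression p a \<rho> "y \<omega>" "f \<omega>" "w \<omega>" by (rule y_autoregression)
    show "contractive_filter p a (y \<omega>) (f \<omega>)" by unfold_locales
  qed (use f in \<open>simp_all add: C1_def del: power_Suc\<close>)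
  show ?thesis
  proof (rule that[of "C1 / (1 - (\<Sum>i<p. \<bar>a i\<bar>)) ^ Suc r"])
    show "0 \<le> C1 / (1 - (\<Sum>i<p. \<bar>a i\<bar>)) ^ Suc r"
      using C0 a_norm rho_lt by (auto simp: C1_def intro!: divide_nonneg_nonneg mult_nonneg_nonneg)
  qed (use y in blast)+
qed

lemma y_square:
  obtains C where "0 \<le> C" "\<And>k. integrable M (\<lambda>\<omega>. (y \<omega> k)\<^sup>2)" "\<And>k. expectation (\<lambda>\<omega>. (y \<omega> k)\<^sup>2) \<le> C"
proof -
  obtain C where "0 \<le> C" "\<And>k. integrable M (\<lambda>\<omega>. \<bar>y \<omega> k\<bar> ^ Suc 1)" "\<And>k. expectation (\<lambda>\<omega>. \<bar>y \<omega> k\<bar> ^ Suc 1) \<le> C"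
    using y_moments[of 1] by auto
  then show ?thesis by (intro that[of C]) (simp_all add: power2_eq_square)
qed

lemma y_lln: "AE \<omega> in M. autoregression_lln p a \<rho> (y \<omega>) (f \<omega>) (w \<omega>) s2"
proof -
  obtain C where C: "\<And>k. integrable M (\<lambda>\<omega>. (y \<omega> k)\<^sup>2)" "\<And>k. expectation (\<lambda>\<omega>. (y \<omega> k)\<^sup>2) \<le> C"
    using y_square by metis
  have "AE \<omega> in M. \<forall>j\<in>{1..p + 1}. negl (ip (w \<omega>) (lag j (y \<omega>)))"
    by (rule AE_finite_allI) (auto intro!: cross_products(1)[OF y_past C])
  with noise_mean_square AE_space show ?thesis
  proof eventually_elim
    case (elim \<omega>)
    interpret Y: autoregression p a \<rho> "y \<omega>" "f \<omega>" "w \<omega>" by (rule y_autoregression[OF elim(2)])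
    show ?case by unfold_locales (use elim s2_pos in auto)
  qed
qed

lemma causal_d: "causal d"
  by (simp add: causal_def d_def)

lemma ip_lag_x:
  assumes "\<omega> \<in> space M" "1 \<le> j"
  shows "ip (v \<omega>) (lag j (x \<omega>)) n = ip (w \<omega>) (lag j (y \<omega>)) n + X0 \<omega> * ip (w \<omega>) (lag j d) n"
proof -
  have c: "causal (x \<omega>)" by (rule autoregression.causal_x[OF x_autoregression[OF assms(1)]])
  have "ip (v \<omega>) (lag j (x \<omega>)) n = ip (w \<omega>) (lag j (x \<omega>)) n"
    unfolding ip_def by (rule sum.cong) (use c assms(2) in \<open>auto simp: v_def w_def lag_def causal_def\<close>)
  moreover have lag: "lag j (x \<omega>) = (\<lambda>k. lag j (y \<omega>) k + X0 \<omega> * lag j d k)"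
    by (simp add: fun_eq_iff lag_def y_def)
  have "ip (w \<omega>) (lag j (x \<omega>)) n = ip (w \<omega>) (lag j (y \<omega>)) n + X0 \<omega> * ip (w \<omega>) (lag j d) n"
    unfolding lag by (simp add: ip_linear)
  ultimately show ?thesis by simp
qed

lemma d_summable:
  obtains C where "0 < C" "\<And>n. (\<Sum>k\<le>n. \<bar>d (int k)\<bar>) \<le> C" "\<And>n. ip d d n \<le> C"
proof -
  interpret D: autoregression p a \<rho> d g "\<lambda>k. if k = 0 then 1 else 0" by (rule d_autoregression)
  have one: "(\<Sum>k\<le>n. \<bar>if int k = 0 then 1 else 0 :: real\<bar>) = 1" for n
    by (induction n) auto
  have g: "(\<Sum>k\<le>n. \<bar>g (int k)\<bar>) \<le> 1 / D.fe.gap" for n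
    using D.fe.sum_power_le[where r = 0 and n = n] one[of n] by simp
  have "(\<Sum>k\<le>n. \<bar>d (int k)\<bar>) \<le> (1 / D.fe.gap) / D.fx.gap" for n
  proof -
    have "(\<Sum>k\<le>n. \<bar>d (int k)\<bar>) \<le> (\<Sum>k\<le>n. \<bar>g (int k)\<bar>) / D.fx.gap"
      using D.fx.sum_power_le[where r = 0 and n = n] by simp
    also have "\<dots> \<le> (1 / D.fe.gap) / D.fx.gap"
      using g D.fx.gap_pos by (intro divide_right_mono) auto
    finally show ?thesis .
  qed
  moreover have "ip (\<lambda>k. if k = 0 then 1 else 0) (\<lambda>k. if k = 0 then 1 else 0) n = 1" for n
    unfolding ip_def by (induction n) auto
  then have "ip d d n \<le> 1 / (D.fx.gap\<^sup>2 * D.fe.gap\<^sup>2)" for n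
    using D.ip_x_le[of n] by simp
  ultimately show ?thesis
    using D.fx.gap_pos D.fe.gap_pos
    by (intro that[of "max (1 / D.fe.gap / D.fx.gap) (1 / (D.fx.gap\<^sup>2 * D.fe.gap\<^sup>2))"])
      (auto simp: le_max_iff_disj less_max_iff_disj)
qed

text \<open>
  The contribution of the initial value to the cross products is \<open>O(\<surd>n)\<close>, by Cauchy-Schwarz and the square
  summability of the impulse response.
\<close>

lemma x_lln: "AE \<omega> in M. autoregression_lln p a \<rho> (x \<omega>) (e \<omega>) (v \<omega>) s2"
  using y_lln AE_space
proof eventually_elim
  case (elim \<omega>)
  interpret Y: autoregression_lln p a \<rho> "y \<omega>" "f \<omega>" "w \<omega>" s2 by (rule elim(1))
  interpret X: autoregression p a \<rho> "x \<omega>" "e \<omega>" "v \<omega>" by (rule x_autoregression[OF elim(2)])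
  obtain C where C: "0 < C" "\<And>n. ip d d n \<le> C" using d_summable by metis
  have dn: "negl (\<lambda>n. ip (lag j d) (lag j d) n)" for j
  proof (rule negl_bound[OF negl_const])
    show "\<bar>ip (lag j d) (lag j d) n\<bar> \<le> C" for n
      using order_trans[OF ip_lag_self_le[OF causal_d] C(2)] ip_self_nonneg by simp
  qed
  show ?case
  proof unfold_locales
    show "0 < s2" by (rule s2_pos)
    have "ip (v \<omega>) (v \<omega>) n = ip (w \<omega>) (w \<omega>) n + (X0 \<omega>)\<^sup>2" for n
      unfolding ip_def by (induction n) (auto simp: v_def w_def power2_eq_square)
    then have "near (ip (v \<omega>) (v \<omega>)) (ip (w \<omega>) (w \<omega>))" by (simp add: near_def)
    moreover have "near (ip (w \<omega>) (w \<omega>)) (\<lambda>n. s2 * real n)"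
      unfolding near_linear_iff by (rule Y.mean_square_v)
    ultimately have "near (ip (v \<omega>) (v \<omega>)) (\<lambda>n. s2 * real n)" by (rule near_trans)
    then show "(\<lambda>n. ip (v \<omega>) (v \<omega>) n / real n) \<longlonglongrightarrow> s2" unfolding near_linear_iff .
    fix j assume j: "1 \<le> j" "j \<le> p + 1"
    have "negl (\<lambda>n. ip (w \<omega>) (lag j d) n)"
      by (rule negl_ip_Cauchy_Schwarz[OF Y.mean_square_v dn])
    then have "negl (\<lambda>n. ip (w \<omega>) (lag j (y \<omega>)) n + X0 \<omega> * ip (w \<omega>) (lag j d) n)"
      using Y.v_orthogonal[OF j] by (intro negl_add negl_cmult[where c = "X0 \<omega>"])
    then show "negl (ip (v \<omega>) (lag j (x \<omega>)))"
      unfolding ip_lag_x[OF elim(2) j(1), abs_def] .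
  qed
qed

end

section \<open>The limit law under the null hypothesis\<close>

text \<open>
  A null sequence times a factor bounded in expectation does not change characteristic functions in the
  limit: where \<open>T \<le> R\<close> the difference tends to 0 boundedly, and \<open>T > R\<close> has probability at most \<open>C / R\<close>.
\<close>

lemma (in prob_space) char_close_of_tight_remainder:
  fixes G Z T :: "nat \<Rightarrow> 'a \<Rightarrow> real"
  assumes [measurable]: "\<And>n. G n \<in> borel_measurable M" "\<And>n. Z n \<in> borel_measurable M"
    and T_int: "\<And>n. integrable M (T n)" and T_nonneg: "\<And>n \<omega>. 0 \<le> T n \<omega>"
    and T_le: "\<And>n. 1 \<le> n \<Longrightarrow> expectation (T n) \<le> C"
    and small: "AE \<omega> in M. (\<lambda>n. \<bar>G n \<omega> - Z n \<omega>\<bar> / (1 + T n \<omega>)\<^sup>2) \<longlonglongrightarrow> 0"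
  shows "(\<lambda>n. expectation (\<lambda>\<omega>. iexp (t * G n \<omega>)) - expectation (\<lambda>\<omega>. iexp (t * Z n \<omega>))) \<longlonglongrightarrow> 0"
proof (rule tendsto_norm_zero_cancel, rule LIMSEQ_I)
  fix r :: real assume r: "0 < r"
  have C0: "0 \<le> C" using order_trans[OF Bochner_Integration.integral_nonneg T_le[of 1]] T_nonneg by simp
  define R where "R = 4 * C / r + 1"
  have R: "R > 0" using C0 r by (simp add: R_def add_nonneg_pos)
  have CR: "2 * C / R < r / 2 + r / 2 * (1 / 2) \<and> 2 * C / R \<le> r / 2"
    using C0 r R by (simp add: R_def divide_simps)
  note [measurable] = borel_measurable_integrable[OF T_int]
  define W where "W n \<omega> = \<bar>G n \<omega> - Z n \<omega>\<bar> / (1 + T n \<omega>)\<^sup>2" for n \<omega>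
  define b where "b n \<omega> = min 2 (\<bar>t\<bar> * (1 + R)\<^sup>2 * W n \<omega>)" for n \<omega>
  have W0: "0 \<le> W n \<omega>" for n \<omega> by (simp add: W_def)
  have b_M [measurable]: "b n \<in> borel_measurable M" for n unfolding b_def W_def by measurable
  have b_bound: "norm (b n \<omega>) \<le> 2" for n \<omega> using W0[of n \<omega>] by (simp add: b_def)
  have b_int: "integrable M (b n)" for n
    by (rule integrable_const_bound[where B = 2]) (use b_bound in auto)
  have "(\<lambda>n. expectation (b n)) \<longlonglongrightarrow> expectation (\<lambda>\<omega>. 0)"
  proof (rule integral_dominated_convergence[where w = "\<lambda>_. 2"])
    show "AE \<omega> in M. (\<lambda>n. b n \<omega>) \<longlonglongrightarrow> 0"
      using small
    proof eventually_elim
      case (elim \<omega>)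
      then have "(\<lambda>n. W n \<omega>) \<longlonglongrightarrow> 0" by (simp add: W_def)
      then have "(\<lambda>n. b n \<omega>) \<longlonglongrightarrow> min 2 (\<bar>t\<bar> * (1 + R)\<^sup>2 * 0)"
        unfolding b_def by (intro tendsto_min tendsto_mult tendsto_const)
      then show ?case by simp
    qed
  qed (use b_bound in auto)
  then have "(\<lambda>n. expectation (b n)) \<longlonglongrightarrow> 0" by simp
  from LIMSEQ_D[OF this, of "r / 2"] r obtain n0 where n0: "\<And>n. n \<ge> n0 \<Longrightarrow> \<bar>expectation (b n)\<bar> < r / 2" by auto
  have iexp_diff: "cmod (iexp (t * x) - iexp (t * y)) \<le> min 2 (\<bar>t\<bar> * \<bar>x - y\<bar>)" for x y :: real
  proof -
    have "iexp (t * x) - iexp (t * y) = iexp (t * y) * (iexp (t * (x - y)) - 1)"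
      by (simp add: algebra_simps flip: exp_add)
    then have "cmod (iexp (t * x) - iexp (t * y)) = cmod (iexp (t * (x - y)) - 1)"
      by (simp add: norm_mult)
    moreover have "cmod (iexp (t * (x - y)) - 1) \<le> \<bar>t * (x - y)\<bar>"
      using iexp_approx1[of "t * (x - y)" 0] by simp
    moreover have "cmod (iexp (t * (x - y)) - 1) \<le> 2"
      using norm_triangle_ineq4[of "iexp (t * (x - y))" 1] by simp
    ultimately show ?thesis by (simp add: abs_mult)
  qed
  have pointwise: "cmod (iexp (t * G n \<omega>) - iexp (t * Z n \<omega>)) \<le> b n \<omega> + 2 / R * T n \<omega>" for n \<omega>
  proof (cases "T n \<omega> \<le> R")
    case True
    have "1 + T n \<omega> > 0" using T_nonneg[of n \<omega>] by simp
    then have "\<bar>G n \<omega> - Z n \<omega>\<bar> = (1 + T n \<omega>)\<^sup>2 * W n \<omega>" by (simp add: W_def)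
    also have "\<dots> \<le> (1 + R)\<^sup>2 * W n \<omega>"
      using True T_nonneg[of n \<omega>] W0[of n \<omega>] by (intro mult_right_mono power_mono) auto
    finally have "\<bar>t\<bar> * \<bar>G n \<omega> - Z n \<omega>\<bar> \<le> \<bar>t\<bar> * ((1 + R)\<^sup>2 * W n \<omega>)" by (intro mult_left_mono) auto
    then have "cmod (iexp (t * G n \<omega>) - iexp (t * Z n \<omega>)) \<le> b n \<omega>"
      using iexp_diff[of "G n \<omega>" "Z n \<omega>"] unfolding b_def by (simp add: mult.assoc)
    moreover have "0 \<le> 2 / R * T n \<omega>" using R T_nonneg[of n \<omega>] by simp
    ultimately show ?thesis by linarith
  next
    case False
    then have "2 \<le> 2 / R * T n \<omega>" using R by (simp add: field_simps)
    moreover have "cmod (iexp (t * G n \<omega>) - iexp (t * Z n \<omega>)) \<le> 2" using iexp_diff[of "G n \<omega>" "Z n \<omega>"] by simp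
    moreover have "0 \<le> b n \<omega>" using W0[of n \<omega>] by (simp add: b_def)
    ultimately show ?thesis by linarith
  qed
  have I: "integrable M (\<lambda>\<omega>. iexp (t * G n \<omega>))" "integrable M (\<lambda>\<omega>. iexp (t * Z n \<omega>))" for n
    by (auto intro!: integrable_const_bound[where B = 1])
  have bound: "cmod (expectation (\<lambda>\<omega>. iexp (t * G n \<omega>)) - expectation (\<lambda>\<omega>. iexp (t * Z n \<omega>)))
      \<le> expectation (b n) + 2 / R * expectation (T n)" for n
  proof -
    have "cmod (expectation (\<lambda>\<omega>. iexp (t * G n \<omega>)) - expectation (\<lambda>\<omega>. iexp (t * Z n \<omega>)))
        = cmod (expectation (\<lambda>\<omega>. iexp (t * G n \<omega>) - iexp (t * Z n \<omega>)))"
      using I by simp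
    also have "\<dots> \<le> expectation (\<lambda>\<omega>. cmod (iexp (t * G n \<omega>) - iexp (t * Z n \<omega>)))"
      by (rule integral_norm_bound)
    also have "\<dots> \<le> expectation (\<lambda>\<omega>. b n \<omega> + 2 / R * T n \<omega>)"
      by (rule integral_mono[OF _ _ pointwise]) (use I b_int T_int in auto)
    also have "\<dots> = expectation (b n) + 2 / R * expectation (T n)" using b_int T_int by simp
    finally show ?thesis .
  qed
  show "\<exists>no. \<forall>n\<ge>no. norm (cmod (expectation (\<lambda>\<omega>. iexp (t * G n \<omega>)) - expectation (\<lambda>\<omega>. iexp (t * Z n \<omega>))) - 0) < r"
  proof (intro exI[of _ "max 1 n0"] allI impI)
    fix n assume n: "max 1 n0 \<le> n"
    have "2 / R * expectation (T n) \<le> 2 / R * C" using T_le[of n] n R by (intro mult_left_mono) auto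
    then have "2 / R * expectation (T n) \<le> r / 2" using CR by simp
    moreover have "expectation (b n) < r / 2" using n0[of n] n by auto
    ultimately show "norm (cmod (expectation (\<lambda>\<omega>. iexp (t * G n \<omega>)) - expectation (\<lambda>\<omega>. iexp (t * Z n \<omega>))) - 0) < r"
      using bound[of n] by simp
  qed
qed

context random_autoregression
begin

definition tcoef :: "nat \<Rightarrow> real" where
  "tcoef = autoregression.tc p a \<rho>"

text \<open>
  The backward prediction error of \<open>y\<close>; its value at time \<open>k\<close> depends only on \<open>V\<^sub>1, \<dots>, V\<^sub>k\<^sub>-\<^sub>1\<close>.
\<close>

definition By :: "'a \<Rightarrow> int \<Rightarrow> real" where
  "By \<omega> k = (\<Sum>l\<le>p. tcoef l * lag (p + 1 - l) (y \<omega>) k)"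

lemma By_eq: "\<omega> \<in> space M \<Longrightarrow> autoregression.B p a \<rho> (y \<omega>) = By \<omega>"
  by (simp add: fun_eq_iff By_def tcoef_def autoregression.B_def[OF y_autoregression])

lemma By_past: "(\<lambda>\<omega>. By \<omega> (int k)) \<in> borel_measurable (past k)"
  unfolding By_def lag_def
  by (intro borel_measurable_sum borel_measurable_times borel_measurable_const y_past) auto

lemma By_third_moment:
  obtains K where "\<And>k. integrable M (\<lambda>\<omega>. \<bar>By \<omega> k\<bar> ^ 3)" "\<And>k. expectation (\<lambda>\<omega>. \<bar>By \<omega> k\<bar> ^ 3) \<le> K"
proof -
  obtain C where C: "0 \<le> C" "\<And>k. integrable M (\<lambda>\<omega>. \<bar>y \<omega> k\<bar> ^ Suc 2)"
    "\<And>k. expectation (\<lambda>\<omega>. \<bar>y \<omega> k\<bar> ^ Suc 2) \<le> C"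
    using y_moments[of 2] by auto
  note C3 = C(2,3)[unfolded eval_nat_numeral(3)[symmetric]]
  define Q where "Q = 1 + (\<Sum>l\<le>p. \<bar>tcoef l\<bar>)"
  have Q: "Q \<ge> 1" by (simp add: Q_def sum_nonneg)
  define bd where "bd k \<omega> = 4 * Q\<^sup>2 * (\<Sum>l\<le>p. \<bar>tcoef l\<bar> * \<bar>y \<omega> (k - int (p + 1 - l))\<bar> ^ 3)" for k \<omega>
  have le: "\<bar>By \<omega> k\<bar> ^ 3 \<le> bd k \<omega>" for \<omega> k
  proof -
    (* Rescaling makes the coefficients contractive, so that the power inequality for contractions applies. *)
    define W where "W l = tcoef l / (2 * Q)" for l
    define z where "z l = 2 * Q * y \<omega> (k - int (p + 1 - l))" for l
    have sW: "(\<Sum>l\<le>p. \<bar>W l\<bar>) = (Q - 1) / (2 * Q)"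
      using Q by (simp add: W_def Q_def abs_mult flip: sum_divide_distrib)
    then have "(\<Sum>l\<le>p. \<bar>W l\<bar>) < 1" unfolding sW using Q by (simp add: divide_simps)
    from contraction_power_le[OF _ this, of z 0 2]
    have "\<bar>\<Sum>l\<le>p. W l * z l\<bar> ^ 3 \<le> (\<Sum>l\<le>p. \<bar>W l\<bar> * \<bar>z l\<bar> ^ 3)" by (simp add: numeral_3_eq_3)
    moreover have "(\<Sum>l\<le>p. W l * z l) = By \<omega> k" using Q by (simp add: W_def z_def By_def lag_def)
    moreover have "(\<Sum>l\<le>p. \<bar>W l\<bar> * \<bar>z l\<bar> ^ 3) = bd k \<omega>"
      unfolding bd_def sum_distrib_left W_def z_def using Q
      by (intro sum.cong) (auto simp: abs_mult power_mult_distrib power3_eq_cube power2_eq_square)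
    ultimately show ?thesis by simp
  qed
  have bd_int: "integrable M (bd k)" for k
    unfolding bd_def using C3(1) by (intro integrable_mult_right Bochner_Integration.integrable_sum) auto
  have By_M: "(\<lambda>\<omega>. By \<omega> k) \<in> borel_measurable M" for k unfolding By_def lag_def by measurable
  have int: "integrable M (\<lambda>\<omega>. \<bar>By \<omega> k\<bar> ^ 3)" for k
  proof (rule Bochner_Integration.integrable_bound[OF bd_int[of k]])
    show "(\<lambda>\<omega>. \<bar>By \<omega> k\<bar> ^ 3) \<in> borel_measurable M" using By_M by measurable
    show "AE \<omega> in M. norm (\<bar>By \<omega> k\<bar> ^ 3) \<le> norm (bd k \<omega>)"
      using le[of _ k] by (intro AE_I2) (smt (verit) real_norm_def zero_le_power abs_ge_zero)
  qed
  show ?thesis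
  proof (rule that[of "4 * Q\<^sup>2 * (\<Sum>l\<le>p. \<bar>tcoef l\<bar> * C)"])
    show "integrable M (\<lambda>\<omega>. \<bar>By \<omega> k\<bar> ^ 3)" for k by (rule int)
    fix k
    have "expectation (\<lambda>\<omega>. \<bar>By \<omega> k\<bar> ^ 3) \<le> expectation (bd k)"
      by (rule integral_mono[OF int bd_int le])
    also have "\<dots> = 4 * Q\<^sup>2 * (\<Sum>l\<le>p. \<bar>tcoef l\<bar> * expectation (\<lambda>\<omega>. \<bar>y \<omega> (k - int (p + 1 - l))\<bar> ^ 3))"
      unfolding bd_def using C3(1) by (simp add: Bochner_Integration.integral_sum)
    also have "\<dots> \<le> 4 * Q\<^sup>2 * (\<Sum>l\<le>p. \<bar>tcoef l\<bar> * C)"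
      using C3(2) by (intro mult_left_mono sum_mono) auto
    finally show "expectation (\<lambda>\<omega>. \<bar>By \<omega> k\<bar> ^ 3) \<le> 4 * Q\<^sup>2 * (\<Sum>l\<le>p. \<bar>tcoef l\<bar> * C)" .
  qed
qed

definition Zy :: "nat \<Rightarrow> 'a \<Rightarrow> real" where
  "Zy n \<omega> = ip (w \<omega>) (By \<omega>) n / (s2 * sqrt (real n))"

lemma w_M [measurable]: "(\<lambda>\<omega>. w \<omega> k) \<in> borel_measurable M"
  by (rule past_measurable_M[OF w_past[of k "nat k + 1"]]) simp

lemma Zy_M [measurable]: "Zy n \<in> borel_measurable M"
  unfolding Zy_def ip_def By_def lag_def by measurable

lemma Zy_clt:
  assumes "\<rho> = 0"
  shows "(\<lambda>n. expectation (\<lambda>\<omega>. iexp (t * Zy n \<omega>))) \<longlonglongrightarrow> of_real (exp (- (t\<^sup>2 / 2)))"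
proof -
  obtain K where K: "\<And>k. integrable M (\<lambda>\<omega>. \<bar>By \<omega> k\<bar> ^ 3)" "\<And>k. expectation (\<lambda>\<omega>. \<bar>By \<omega> k\<bar> ^ 3) \<le> K"
    using By_third_moment by metis
  have lln: "AE \<omega> in M. (\<lambda>n. (\<Sum>k=1..n. (By \<omega> (int k))\<^sup>2) / real n) \<longlonglongrightarrow> s2"
    using y_lln AE_space
  proof eventually_elim
    case (elim \<omega>)
    interpret Y: autoregression_lln p a \<rho> "y \<omega>" "f \<omega>" "w \<omega>" s2 by (rule elim(1))
    have c: "Y.c = 0" unfolding Y.c_def using assms by simp
    have B: "Y.B = By \<omega>" by (rule By_eq[OF elim(2)])
    have "near (ip Y.E Y.E) (\<lambda>n. s2 * real n)"
      using Y.E_mean_square unfolding near_linear_iff c by simp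
    then have "near (ip Y.B Y.B) (\<lambda>n. s2 * real n)" by (rule near_trans[OF Y.B_mean_square_near])
    then have lim: "(\<lambda>n. ip (By \<omega>) (By \<omega>) n / real n) \<longlonglongrightarrow> s2" unfolding near_linear_iff B .
    have "By \<omega> 0 = 0" using Y.causal_x by (simp add: By_def lag_def causal_def)
    then have "ip (By \<omega>) (By \<omega>) n = (\<Sum>k=1..n. (By \<omega> (int k))\<^sup>2)" for n
      by (simp add: ip_def atMost_atLeast0 sum.atLeast_Suc_atMost power2_eq_square)
    with lim show ?case by simp
  qed
  have "(\<lambda>n. expectation (\<lambda>\<omega>. iexp (t / s2 * ((\<Sum>k=1..n. V k \<omega> * By \<omega> (int k)) / sqrt (real n)))))
    \<longlonglongrightarrow> of_real (exp (- (s2 * s2 * (t / s2)\<^sup>2 / 2)))"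
    by (rule martingale_transform_clt[where K = K and H = "\<lambda>k \<omega>. By \<omega> (int k)", OF By_past K lln s2_pos])
  moreover have "t / s2 * ((\<Sum>k=1..n. V k \<omega> * By \<omega> (int k)) / sqrt (real n)) = t * Zy n \<omega>" for n \<omega>
    by (simp add: Zy_def ip_w)
  moreover have "s2 * s2 * (t / s2)\<^sup>2 / 2 = t\<^sup>2 / 2" using s2_pos by (simp add: power2_eq_square)
  ultimately show ?thesis by (simp only:)
qed

text \<open>
  A bound for \<open>T\<close> and for the contribution of the initial value to the leading term, in a form whose
  expectation can be computed. The first two sums come from \<open>\<bar>z\<bar> \<le> 1 + z\<^sup>2\<close> and from \<open>\<bar>z z'\<bar> \<le> z\<^sup>2 + z'\<^sup>2\<close>.
\<close>

definition U :: "nat \<Rightarrow> 'a \<Rightarrow> real" where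
  "U n \<omega> = (\<Sum>j=1..p + 1. 1 + (ip (w \<omega>) (lag j (y \<omega>)) n)\<^sup>2 / real n)
    + (\<Sum>j=1..p + 1. \<Sum>k\<le>n. \<bar>d (int k - int j)\<bar> * ((X0 \<omega>)\<^sup>2 + (w \<omega> (int k))\<^sup>2))
    + (1 + (w \<omega> (int n))\<^sup>2)"

lemma U_nonneg: "0 \<le> U n \<omega>"
  by (auto simp: U_def intro!: add_nonneg_nonneg sum_nonneg)

lemma w_square: "integrable M (\<lambda>\<omega>. (w \<omega> k)\<^sup>2)" "expectation (\<lambda>\<omega>. (w \<omega> k)\<^sup>2) \<le> s2"
proof -
  have "1 \<le> nat k" if "0 < k" using that by simp
  then show "integrable M (\<lambda>\<omega>. (w \<omega> k)\<^sup>2)" "expectation (\<lambda>\<omega>. (w \<omega> k)\<^sup>2) \<le> s2"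
    using V_moments(2)[of "nat k"] V_var[of "nat k"] s2_pos by (cases "0 < k"; simp add: w_def)+
qed

lemma U_tight:
  obtains C where "\<And>n. integrable M (U n)" "\<And>n. 1 \<le> n \<Longrightarrow> expectation (U n) \<le> C"
proof -
  obtain C where C: "0 \<le> C" "\<And>k. integrable M (\<lambda>\<omega>. (y \<omega> k)\<^sup>2)" "\<And>k. expectation (\<lambda>\<omega>. (y \<omega> k)\<^sup>2) \<le> C"
    using y_square by metis
  obtain D where D: "0 < D" "\<And>n. (\<Sum>k\<le>n. \<bar>d (int k)\<bar>) \<le> D" using d_summable by metis
  have cross: "integrable M (\<lambda>\<omega>. (ip (w \<omega>) (lag j (y \<omega>)) n)\<^sup>2)"
      "expectation (\<lambda>\<omega>. (ip (w \<omega>) (lag j (y \<omega>)) n)\<^sup>2) \<le> C * s2 * real (Suc n)" if "1 \<le> j" for j n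
    using cross_products(2,3)[OF y_past C(2,3) that] by auto
  note ints = cross(1) X0_sq w_square(1)
  have int1: "integrable M (\<lambda>\<omega>. \<Sum>j=1..p + 1. 1 + (ip (w \<omega>) (lag j (y \<omega>)) n)\<^sup>2 / real n)" for n
    using ints by (intro Bochner_Integration.integrable_sum Bochner_Integration.integrable_add integrable_divide_zero) auto
  have int2: "integrable M (\<lambda>\<omega>. \<Sum>j=1..p + 1. \<Sum>k\<le>n. \<bar>d (int k - int j)\<bar> * ((X0 \<omega>)\<^sup>2 + (w \<omega> (int k))\<^sup>2))" for n
    using ints by (intro Bochner_Integration.integrable_sum Bochner_Integration.integrable_add integrable_mult_right) auto
  have int3: "integrable M (\<lambda>\<omega>. 1 + (w \<omega> (int n))\<^sup>2)" for n using ints by simp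
  have U_int: "integrable M (U n)" for n
    unfolding U_def
    by (rule Bochner_Integration.integrable_add[OF Bochner_Integration.integrable_add[OF int1 int2] int3])
  define x2 where "x2 = expectation (\<lambda>\<omega>. (X0 \<omega>)\<^sup>2)"
  have x2: "0 \<le> x2" unfolding x2_def by (rule Bochner_Integration.integral_nonneg) simp
  have "expectation (U n) \<le> (\<Sum>j=1..p + 1. 1 + 2 * (C * s2)) + (\<Sum>j=1..p + 1. D * (x2 + s2)) + (1 + s2)"
    if n: "1 \<le> n" for n
  proof -
    have "expectation (U n) = expectation (\<lambda>\<omega>. \<Sum>j=1..p + 1. 1 + (ip (w \<omega>) (lag j (y \<omega>)) n)\<^sup>2 / real n)
        + expectation (\<lambda>\<omega>. \<Sum>j=1..p + 1. \<Sum>k\<le>n. \<bar>d (int k - int j)\<bar> * ((X0 \<omega>)\<^sup>2 + (w \<omega> (int k))\<^sup>2))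
        + expectation (\<lambda>\<omega>. 1 + (w \<omega> (int n))\<^sup>2)"
      unfolding U_def Bochner_Integration.integral_add[OF Bochner_Integration.integrable_add[OF int1 int2] int3]
        Bochner_Integration.integral_add[OF int1 int2] by (rule refl)
    also have "expectation (\<lambda>\<omega>. \<Sum>j=1..p + 1. 1 + (ip (w \<omega>) (lag j (y \<omega>)) n)\<^sup>2 / real n)
        = (\<Sum>j=1..p + 1. 1 + expectation (\<lambda>\<omega>. (ip (w \<omega>) (lag j (y \<omega>)) n)\<^sup>2) / real n)"
      using ints by (subst Bochner_Integration.integral_sum) (auto simp: prob_space intro!: sum.cong)
    also have "\<dots> \<le> (\<Sum>j=1..p + 1. 1 + 2 * (C * s2))"
    proof (intro sum_mono add_left_mono)
      fix j assume j: "j \<in> {1..p + 1}"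
      have "expectation (\<lambda>\<omega>. (ip (w \<omega>) (lag j (y \<omega>)) n)\<^sup>2) / real n \<le> C * s2 * real (Suc n) / real n"
        using cross(2)[of j n] j by (intro divide_right_mono) auto
      also have "\<dots> \<le> C * s2 * (2 * real n) / real n"
        using C(1) s2_pos n by (intro divide_right_mono mult_left_mono) auto
      also have "\<dots> = 2 * (C * s2)" using n by simp
      finally show "expectation (\<lambda>\<omega>. (ip (w \<omega>) (lag j (y \<omega>)) n)\<^sup>2) / real n \<le> 2 * (C * s2)" .
    qed
    also have "expectation (\<lambda>\<omega>. \<Sum>j=1..p + 1. \<Sum>k\<le>n. \<bar>d (int k - int j)\<bar> * ((X0 \<omega>)\<^sup>2 + (w \<omega> (int k))\<^sup>2))
        = (\<Sum>j=1..p + 1. \<Sum>k\<le>n. \<bar>d (int k - int j)\<bar> * (x2 + expectation (\<lambda>\<omega>. (w \<omega> (int k))\<^sup>2)))"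
      using ints unfolding x2_def by (simp add: Bochner_Integration.integral_sum)
    also have "\<dots> \<le> (\<Sum>j=1..p + 1. D * (x2 + s2))"
    proof (intro sum_mono)
      fix j assume "j \<in> {1..p + 1}"
      have "(\<Sum>k\<le>n. \<bar>d (int k - int j)\<bar> * (x2 + expectation (\<lambda>\<omega>. (w \<omega> (int k))\<^sup>2)))
          \<le> (\<Sum>k\<le>n. \<bar>d (int k - int j)\<bar> * (x2 + s2))"
        using w_square(2) by (intro sum_mono mult_left_mono add_left_mono) auto
      also have "\<dots> = (\<Sum>k\<le>n. \<bar>d (int k - int j)\<bar>) * (x2 + s2)" by (simp add: sum_distrib_right)
      also have "\<dots> \<le> D * (x2 + s2)"
      proof (rule mult_right_mono)
        have "(\<Sum>k\<le>n. \<bar>d (int k - int j)\<bar>) \<le> (\<Sum>k\<le>n. \<bar>d (int k)\<bar>)"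
          by (rule sum_shift_le) (auto simp: d_def)
        also have "\<dots> \<le> D" by (rule D(2))
        finally show "(\<Sum>k\<le>n. \<bar>d (int k - int j)\<bar>) \<le> D" .
      qed (use x2 s2_pos in simp)
      finally show "(\<Sum>k\<le>n. \<bar>d (int k - int j)\<bar> * (x2 + expectation (\<lambda>\<omega>. (w \<omega> (int k))\<^sup>2))) \<le> D * (x2 + s2)" .
    qed
    also have "expectation (\<lambda>\<omega>. 1 + (w \<omega> (int n))\<^sup>2) \<le> 1 + s2"
      using ints w_square(2)[of "int n"] by (simp add: prob_space)
    finally show ?thesis by simp
  qed
  with U_int show ?thesis by (rule that)
qed

lemma U_bounds:
  assumes "1 \<le> n"
  shows "(\<Sum>j=1..p + 1. \<bar>ip (w \<omega>) (lag j (y \<omega>)) n\<bar> / sqrt (real n))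
      + (\<Sum>j=1..p + 1. \<bar>X0 \<omega> * ip (w \<omega>) (lag j d) n\<bar>) + \<bar>w \<omega> (int n)\<bar> \<le> U n \<omega>"
proof -
  have sq: "\<bar>z\<bar> \<le> 1 + z\<^sup>2" for z :: real
    using zero_le_power2[of "\<bar>z\<bar> - 1"] by (simp add: power2_diff)
  have xy: "\<bar>a * b\<bar> \<le> a\<^sup>2 + b\<^sup>2" for a b :: real
    using sum_squares_bound[of "\<bar>a\<bar>" "\<bar>b\<bar>"] mult_nonneg_nonneg[of "\<bar>a\<bar>" "\<bar>b\<bar>"]
    unfolding abs_mult power2_abs by linarith
  have 1: "\<bar>ip (w \<omega>) (lag j (y \<omega>)) n\<bar> / sqrt (real n) \<le> 1 + (ip (w \<omega>) (lag j (y \<omega>)) n)\<^sup>2 / real n" for j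
    using sq[of "ip (w \<omega>) (lag j (y \<omega>)) n / sqrt (real n)"] by (simp add: power_divide)
  have 2: "\<bar>X0 \<omega> * ip (w \<omega>) (lag j d) n\<bar> \<le> (\<Sum>k\<le>n. \<bar>d (int k - int j)\<bar> * ((X0 \<omega>)\<^sup>2 + (w \<omega> (int k))\<^sup>2))" for j
  proof -
    have "X0 \<omega> * ip (w \<omega>) (lag j d) n = (\<Sum>k\<le>n. d (int k - int j) * (X0 \<omega> * w \<omega> (int k)))"
      by (simp add: ip_def lag_def sum_distrib_left mult_ac)
    also have "\<bar>\<dots>\<bar> \<le> (\<Sum>k\<le>n. \<bar>d (int k - int j) * (X0 \<omega> * w \<omega> (int k))\<bar>)" by (rule sum_abs)
    also have "\<dots> \<le> (\<Sum>k\<le>n. \<bar>d (int k - int j)\<bar> * ((X0 \<omega>)\<^sup>2 + (w \<omega> (int k))\<^sup>2))"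
      unfolding abs_mult[of "d _"] by (intro sum_mono mult_left_mono xy) auto
    finally show ?thesis .
  qed
  show ?thesis unfolding U_def by (intro add_mono sum_mono 1 2 sq)
qed

end

lemma weak_conv_power2:
  assumes dist: "\<And>n. real_distribution (\<mu> n)" "real_distribution \<nu>" and conv: "weak_conv_m \<mu> \<nu>"
  shows "weak_conv_m (\<lambda>n. distr (\<mu> n) borel (\<lambda>x. x\<^sup>2)) (distr \<nu> borel (\<lambda>x. x\<^sup>2))"
proof (rule integral_bdd_continuous_conv_imp_weak_conv)
  show "real_distribution (distr (\<mu> n) borel (\<lambda>x. x\<^sup>2))" for n
  proof -
    interpret real_distribution "\<mu> n" by (rule dist)
    show ?thesis by (rule real_distribution_distr) simp
  qed
  show "real_distribution (distr \<nu> borel (\<lambda>x. x\<^sup>2))"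
  proof -
    interpret real_distribution \<nu> by (rule dist)
    show ?thesis by (rule real_distribution_distr) simp
  qed
  fix f :: "real \<Rightarrow> real"
  assume f: "\<And>x. isCont f x" "\<And>x. \<bar>f x\<bar> \<le> 1"
  have f_M [measurable]: "f \<in> borel_measurable borel"
    by (rule borel_measurable_continuous_onI) (simp add: continuous_on_eq_continuous_at f(1))
  have sets: "sets (\<mu> n) = sets borel" "sets \<nu> = sets borel" for n
    using dist by (simp_all add: real_distribution.events_eq_borel)
  have *: "(\<integral>x. f x \<partial>distr \<kappa> borel (\<lambda>x. x\<^sup>2)) = (\<integral>x. f (x\<^sup>2) \<partial>\<kappa>)" if "sets \<kappa> = sets borel" for \<kappa> :: "real measure"
    using that by (subst integral_distr) (simp_all cong: measurable_cong_sets)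
  have "(\<lambda>n. \<integral>x. f (x\<^sup>2) \<partial>\<mu> n) \<longlonglongrightarrow> (\<integral>x. f (x\<^sup>2) \<partial>\<nu>)"
  proof (rule weak_conv_imp_integral_bdd_continuous_conv[OF dist conv])
    show "isCont (\<lambda>x. f (x\<^sup>2)) x" for x
      by (rule isCont_o2[OF _ f(1)]) simp
    show "norm (f (x\<^sup>2)) \<le> 1" for x using f(2) by simp
  qed
  then show "(\<lambda>n. \<integral>x. f x \<partial>distr (\<mu> n) borel (\<lambda>x. x\<^sup>2)) \<longlonglongrightarrow> (\<integral>x. f x \<partial>distr \<nu> borel (\<lambda>x. x\<^sup>2))"
    by (simp add: * sets)
qed

section \<open>Least squares residuals of the random autoregression\<close>

locale random_least_squares = random_autoregression M V s2 p a \<rho> X0 x e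
  for M :: "'a measure" and V s2 p a \<rho> X0 x e +
  fixes S0 :: "nat \<Rightarrow> nat \<Rightarrow> real" and th :: "'a \<Rightarrow> nat \<Rightarrow> nat \<Rightarrow> real"
  assumes S0_nonneg: "\<And>u. 0 \<le> (\<Sum>i<p. u i * (\<Sum>j<p. S0 i j * u j))"
    and normal_eq: "\<And>\<omega> n i. \<omega> \<in> space M \<Longrightarrow> 1 \<le> n \<Longrightarrow> i < p \<Longrightarrow>
      (\<Sum>j<p. (ip (lag (Suc i) (x \<omega>)) (lag (Suc j) (x \<omega>)) n + S0 i j) * th \<omega> n j)
        = ip (lag (Suc i) (x \<omega>)) (x \<omega>) n"
    and th_M: "\<And>n i. i < p \<Longrightarrow> (\<lambda>\<omega>. th \<omega> n i) \<in> borel_measurable M"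
begin

definition rsd :: "'a \<Rightarrow> nat \<Rightarrow> int \<Rightarrow> real" where
  "rsd \<omega> n k = x \<omega> k - (\<Sum>i<p. th \<omega> n i * x \<omega> (k - 1 - int i))"

definition dw :: "'a \<Rightarrow> nat \<Rightarrow> real" where
  "dw \<omega> n = inverse (ip (rsd \<omega> n) (rsd \<omega> n) n) * (\<Sum>k = 1..n. (rsd \<omega> n (int k) - rsd \<omega> n (int k - 1))\<^sup>2)"

lemma least_squares_path:
  "AE \<omega> in M. least_squares_path p a \<rho> (x \<omega>) (e \<omega>) (v \<omega>) s2 S0 (th \<omega>)"
  using x_lln AE_space
proof eventually_elim
  case (elim \<omega>)
  then interpret X: autoregression_lln p a \<rho> "x \<omega>" "e \<omega>" "v \<omega>" s2 by simp
  show ?case by unfold_locales (use S0_nonneg normal_eq[OF elim(2)] in auto)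
qed

lemma dw_path:
  assumes "least_squares_path p a \<rho> (x \<omega>) (e \<omega>) (v \<omega>) s2 S0 (th \<omega>)"
  shows "least_squares_path.D p (x \<omega>) (th \<omega>) = dw \<omega>"
proof -
  interpret L: least_squares_path p a \<rho> "x \<omega>" "e \<omega>" "v \<omega>" s2 S0 "th \<omega>" by (rule assms)
  have "L.res = rsd \<omega>" by (simp add: fun_eq_iff L.res_def rsd_def)
  then show ?thesis by (intro ext) (simp only: L.D_def L.J_def dw_def)
qed

theorem statistic_diverges_almost_surely:
  assumes "\<rho> \<noteq> 0" "a (p - 1) \<noteq> 0" "autoregression.ts p a \<rho> (p - 1) \<noteq> 0"
  shows "AE \<omega> in M. filterlim (\<lambda>n. real n / (4 * (th \<omega> n (p - 1))\<^sup>2) * (dw \<omega> n - 2)\<^sup>2) at_top sequentially"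
  using least_squares_path
proof eventually_elim
  case (elim \<omega>)
  interpret L: least_squares_path p a \<rho> "x \<omega>" "e \<omega>" "v \<omega>" s2 S0 "th \<omega>" by (rule elim)
  have "L.c \<noteq> 0" unfolding L.c_def using assms by simp
  from L.statistic_diverges[OF this assms(3)] show ?case unfolding dw_path[OF elim] .
qed

definition G :: "nat \<Rightarrow> 'a \<Rightarrow> real" where
  "G n \<omega> = sqrt (real n) * (dw \<omega> n - 2) / (2 * th \<omega> n (p - 1))"

lemma dw_M: "(\<lambda>\<omega>. dw \<omega> n) \<in> borel_measurable M"
proof -
  have [measurable]: "(\<lambda>\<omega>. rsd \<omega> n k) \<in> borel_measurable M" for k
    unfolding rsd_def
    by (intro borel_measurable_diff borel_measurable_sum borel_measurable_times x_M th_M) auto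
  show ?thesis unfolding dw_def ip_def by measurable
qed

lemma G_M [measurable]: "G n \<in> borel_measurable M"
  unfolding G_def using p_pos
  by (intro borel_measurable_divide borel_measurable_times borel_measurable_diff borel_measurable_const dw_M th_M) auto

text \<open>
  Combines the expansion of the studentized statistic of \<open>x\<close> with the passage from \<open>x\<close> to \<open>y\<close> in its leading
  term, which costs \<open>U / \<surd>n\<close>.
\<close>

lemma G_near_Zy:
  assumes "\<rho> = 0" "autoregression.ts p a \<rho> (p - 1) \<noteq> 0"
  shows "AE \<omega> in M. (\<lambda>n. \<bar>G n \<omega> - Zy n \<omega>\<bar> / (1 + U n \<omega>)\<^sup>2) \<longlonglongrightarrow> 0"
  using least_squares_path AE_space
proof eventually_elim
  case (elim \<omega>)
  interpret L: least_squares_path p a \<rho> "x \<omega>" "e \<omega>" "v \<omega>" s2 S0 "th \<omega>" by (rule elim(1))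
  obtain \<epsilon> where \<epsilon>: "\<epsilon> \<longlonglongrightarrow> 0" "\<forall>\<^sub>F n in sequentially.
    \<bar>sqrt (real n) * (L.D n - 2) / (2 * th \<omega> n (p - 1)) - L.Z n\<bar> \<le> \<epsilon> n * (1 + L.T n)\<^sup>2"
    using assms by (rule L.studentized_statistic_expansion)
  define Q where "Q = (\<Sum>l\<le>p. \<bar>tcoef l\<bar>)"
  have Q: "0 \<le> Q" by (simp add: Q_def sum_nonneg)
  have tc: "L.tc = tcoef" by (simp add: tcoef_def)
  have lim: "(\<lambda>n. \<bar>\<epsilon> n\<bar> + Q / s2 / sqrt (real n)) \<longlonglongrightarrow> 0"
    using tendsto_add[OF tendsto_rabs[OF \<epsilon>(1)] L.inverse_sqrt_tendsto[of "Q / s2"]] by simp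
  show ?case
  proof (rule tendsto_sandwich[OF _ _ tendsto_const lim])
    show "\<forall>\<^sub>F n in sequentially. \<bar>G n \<omega> - Zy n \<omega>\<bar> / (1 + U n \<omega>)\<^sup>2 \<le> \<bar>\<epsilon> n\<bar> + Q / s2 / sqrt (real n)"
      using \<epsilon>(2) eventually_ge_at_top[of 1]
    proof eventually_elim
      case (elim n)
      define q where "q = sqrt (real n)"
      have q: "1 \<le> q" using elim(2) by (simp add: q_def)
      define I where "I j = ip (w \<omega>) (lag j (y \<omega>)) n" for j
      define K where "K j = X0 \<omega> * ip (w \<omega>) (lag j d) n" for j
      have x: "ip (v \<omega>) (lag j (x \<omega>)) n = I j + K j" if "1 \<le> j" for j
        unfolding I_def K_def by (rule ip_lag_x[OF \<open>\<omega> \<in> space M\<close> that])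
      have U: "(\<Sum>j=1..p + 1. \<bar>I j\<bar> / q) + (\<Sum>j=1..p + 1. \<bar>K j\<bar>) + \<bar>w \<omega> (int n)\<bar> \<le> U n \<omega>"
        unfolding I_def K_def q_def by (rule U_bounds[OF elim(2)])
      have sI: "0 \<le> (\<Sum>j=1..p + 1. \<bar>I j\<bar> / q)" using q by (intro sum_nonneg) auto
      have T: "L.T n \<le> U n \<omega>"
      proof -
        have "(\<Sum>j=1..p + 1. \<bar>ip (v \<omega>) (lag j (x \<omega>)) n\<bar>) / q = (\<Sum>j=1..p + 1. \<bar>I j + K j\<bar> / q)"
          unfolding sum_divide_distrib by (rule sum.cong) (auto simp: x)
        also have "\<dots> \<le> (\<Sum>j=1..p + 1. \<bar>I j\<bar> / q + \<bar>K j\<bar>)"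
        proof (rule sum_mono)
          fix j
          have "\<bar>I j + K j\<bar> / q \<le> (\<bar>I j\<bar> + \<bar>K j\<bar>) / q" using q by (intro divide_right_mono) auto
          also have "\<dots> = \<bar>I j\<bar> / q + \<bar>K j\<bar> / q" by (rule add_divide_distrib)
          also have "\<bar>K j\<bar> / q \<le> \<bar>K j\<bar> / 1" using q by (intro divide_left_mono) auto
          finally show "\<bar>I j + K j\<bar> / q \<le> \<bar>I j\<bar> / q + \<bar>K j\<bar>" by simp
        qed
        also have "\<dots> = (\<Sum>j=1..p + 1. \<bar>I j\<bar> / q) + (\<Sum>j=1..p + 1. \<bar>K j\<bar>)" by (rule sum.distrib)
        finally have "L.T n \<le> (\<Sum>j=1..p + 1. \<bar>I j\<bar> / q) + (\<Sum>j=1..p + 1. \<bar>K j\<bar>) + \<bar>w \<omega> (int n)\<bar>"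
          using elim(2) unfolding L.T_def q_def[symmetric] by (simp only: v_def) simp
        with U show ?thesis by simp
      qed
      have Z: "\<bar>L.Z n - Zy n \<omega>\<bar> \<le> Q / s2 / q * U n \<omega>"
      proof -
        have "ip (v \<omega>) L.B n = (\<Sum>l\<le>p. tcoef l * (I (p + 1 - l) + K (p + 1 - l)))"
          unfolding L.B_ip tc by (rule sum.cong) (auto simp: x)
        moreover have "ip (w \<omega>) (By \<omega>) n = (\<Sum>l\<le>p. tcoef l * I (p + 1 - l))"
          unfolding By_def[abs_def] I_def by (rule ip_sum_right)
        ultimately have diff: "ip (v \<omega>) L.B n - ip (w \<omega>) (By \<omega>) n = (\<Sum>l\<le>p. tcoef l * K (p + 1 - l))"
          by (simp add: distrib_left sum.distrib)
        have "\<bar>\<Sum>l\<le>p. tcoef l * K (p + 1 - l)\<bar> \<le> (\<Sum>l\<le>p. \<bar>tcoef l * K (p + 1 - l)\<bar>)" by (rule sum_abs)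
        also have "\<dots> \<le> (\<Sum>l\<le>p. \<bar>tcoef l\<bar> * U n \<omega>)"
        proof (rule sum_mono)
          fix l assume l: "l \<in> {..p}"
          have "\<bar>K (p + 1 - l)\<bar> \<le> (\<Sum>j=1..p + 1. \<bar>K j\<bar>)"
            using l by (intro member_le_sum[of "p + 1 - l" _ "\<lambda>j. \<bar>K j\<bar>"]) auto
          also have "\<dots> \<le> U n \<omega>" using U sI by linarith
          finally show "\<bar>tcoef l * K (p + 1 - l)\<bar> \<le> \<bar>tcoef l\<bar> * U n \<omega>"
            unfolding abs_mult by (intro mult_left_mono) auto
        qed
        also have "\<dots> = Q * U n \<omega>" by (simp add: Q_def sum_distrib_right)
        finally have le: "\<bar>ip (v \<omega>) L.B n - ip (w \<omega>) (By \<omega>) n\<bar> \<le> Q * U n \<omega>" unfolding diff .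
        have "L.Z n - Zy n \<omega> = (ip (v \<omega>) L.B n - ip (w \<omega>) (By \<omega>) n) / (s2 * q)"
          by (simp add: L.Z_def Zy_def q_def diff_divide_distrib)
        then have "\<bar>L.Z n - Zy n \<omega>\<bar> = \<bar>ip (v \<omega>) L.B n - ip (w \<omega>) (By \<omega>) n\<bar> / (s2 * q)"
          using s2_pos q by (simp add: abs_divide abs_mult)
        also have "\<dots> \<le> Q * U n \<omega> / (s2 * q)" using le s2_pos q by (intro divide_right_mono) auto
        finally show ?thesis by simp
      qed
      define t where "t = 1 + U n \<omega>"
      have t: "1 \<le> t" using U_nonneg[of n \<omega>] by (simp add: t_def)
      have tt: "U n \<omega> \<le> t\<^sup>2" using t self_le_power[of t 2] by (simp add: t_def)
      have "\<bar>G n \<omega> - L.Z n\<bar> \<le> \<bar>\<epsilon> n\<bar> * t\<^sup>2"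
      proof -
        have "\<bar>G n \<omega> - L.Z n\<bar> \<le> \<epsilon> n * (1 + L.T n)\<^sup>2"
          using elim(1) unfolding G_def dw_path[OF L.least_squares_path_axioms] .
        also have "\<dots> \<le> \<bar>\<epsilon> n\<bar> * (1 + L.T n)\<^sup>2" by (intro mult_right_mono) auto
        also have "\<dots> \<le> \<bar>\<epsilon> n\<bar> * t\<^sup>2"
          using T L.T_nonneg[of n] by (intro mult_left_mono power_mono) (auto simp: t_def)
        finally show ?thesis .
      qed
      moreover have "\<bar>L.Z n - Zy n \<omega>\<bar> \<le> Q / s2 / q * t\<^sup>2"
        using Z mult_left_mono[OF tt, of "Q / s2 / q"] Q s2_pos q by (simp add: divide_nonneg_pos)
      ultimately have "\<bar>G n \<omega> - Zy n \<omega>\<bar> \<le> (\<bar>\<epsilon> n\<bar> + Q / s2 / q) * t\<^sup>2"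
        unfolding distrib_right by linarith
      then show ?case using t unfolding t_def q_def by (simp add: divide_le_eq)
    qed
  qed (intro always_eventually allI divide_nonneg_nonneg, auto)
qed

theorem studentized_statistic_asymptotically_normal:
  assumes "\<rho> = 0" "autoregression.ts p a \<rho> (p - 1) \<noteq> 0"
  shows "weak_conv_m (\<lambda>n. distr M borel (G n)) std_normal_distribution"
proof (rule levy_continuity)
  show "real_distribution (distr M borel (G n))" for n by (rule real_distribution_distr) simp
  show "real_distribution std_normal_distribution" by (rule real_dist_normal_dist)
  fix t :: real
  obtain C where C: "\<And>n. integrable M (U n)" "\<And>n. 1 \<le> n \<Longrightarrow> expectation (U n) \<le> C"
    using U_tight by metis
  have char: "char (distr M borel (G n)) t = expectation (\<lambda>\<omega>. iexp (t * G n \<omega>))" for n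
    unfolding char_def by (subst integral_distr) auto
  have "(\<lambda>n. expectation (\<lambda>\<omega>. iexp (t * G n \<omega>)) - expectation (\<lambda>\<omega>. iexp (t * Zy n \<omega>))) \<longlonglongrightarrow> 0"
    by (rule char_close_of_tight_remainder[OF G_M Zy_M C(1) U_nonneg C(2) G_near_Zy[OF assms]])
  from tendsto_add[OF this Zy_clt[OF assms(1), of t]]
  show "(\<lambda>n. char (distr M borel (G n)) t) \<longlonglongrightarrow> char std_normal_distribution t"
    unfolding char char_std_normal_distribution by simp
qed

theorem squared_statistic_limit:
  assumes "\<rho> = 0" "autoregression.ts p a \<rho> (p - 1) \<noteq> 0"
  shows "weak_conv_m (\<lambda>n. distr M borel (\<lambda>\<omega>. real n / (4 * (th \<omega> n (p - 1))\<^sup>2) * (dw \<omega> n - 2)\<^sup>2))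
    (distr std_normal_distribution borel (\<lambda>z. z\<^sup>2))"
proof -
  have "weak_conv_m (\<lambda>n. distr (distr M borel (G n)) borel (\<lambda>z. z\<^sup>2)) (distr std_normal_distribution borel (\<lambda>z. z\<^sup>2))"
    by (rule weak_conv_power2[OF _ real_dist_normal_dist studentized_statistic_asymptotically_normal[OF assms]])
      (rule real_distribution_distr, simp)
  moreover have "distr (distr M borel (G n)) borel (\<lambda>z. z\<^sup>2)
      = distr M borel (\<lambda>\<omega>. real n / (4 * (th \<omega> n (p - 1))\<^sup>2) * (dw \<omega> n - 2)\<^sup>2)" for n
    by (subst distr_distr) (auto simp: comp_def G_def power_mult_distrib power_divide mult_ac)
  ultimately show ?thesis by simp
qed

end

section \<open>Positive definite matrices and their inverses\<close>

lemma pos_def_imp_det_nonzero: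
  assumes "pos_def_mat p A"
  shows "Determinant.det A \<noteq> 0"
proof
  have A: "A \<in> carrier_mat p p" using assms by (simp add: pos_def_mat_def)
  assume "Determinant.det A = 0"
  then obtain u where u: "u \<in> carrier_vec p" "u \<noteq> 0\<^sub>v p" "A *\<^sub>v u = 0\<^sub>v p"
    using det_0_iff_vec_prod_zero[OF A] by auto
  then have "u \<bullet> (A *\<^sub>v u) = 0" by simp
  then show False using assms u unfolding pos_def_mat_def by fastforce
qed

text \<open>
  The explicit inverse shows that the estimator depends measurably on the observations.
\<close>

lemma mat_inverse_eq_adj_mat:
  fixes A :: "real mat"
  assumes A: "A \<in> carrier_mat p p" and det: "Determinant.det A \<noteq> 0"
  shows "mat_inverse A = Some ((1 / Determinant.det A) \<cdot>\<^sub>m adj_mat A)"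
proof -
  define C where "C = (1 / Determinant.det A) \<cdot>\<^sub>m adj_mat A"
  have C: "C \<in> carrier_mat p p" using adj_mat(1)[OF A] by (simp add: C_def)
  have unit: "(1 / Determinant.det A) \<cdot>\<^sub>m (Determinant.det A \<cdot>\<^sub>m 1\<^sub>m p) = 1\<^sub>m p"
    by (rule eq_matI) (use det in auto)
  have AC: "A * C = 1\<^sub>m p"
    unfolding C_def mult_smult_distrib[OF A adj_mat(1)[OF A]] adj_mat(2)[OF A] by (rule unit)
  have CA: "C * A = 1\<^sub>m p"
    unfolding C_def mult_smult_assoc_mat[OF adj_mat(1)[OF A] A] adj_mat(3)[OF A] by (rule unit)
  have "A \<in> Units (ring_mat TYPE(real) p ())"
    using A C AC CA by (auto simp: Units_def ring_mat_def)
  then obtain B where B: "mat_inverse A = Some B"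
    using mat_inverse(1)[OF A, where b = "()"] by (cases "mat_inverse A") auto
  have AB: "A * B = 1\<^sub>m p" "B * A = 1\<^sub>m p" and Bc: "B \<in> carrier_mat p p" using mat_inverse(2)[OF A B] by auto
  have "B = B * (A * C)" using AC Bc by simp
  also have "\<dots> = (B * A) * C" using A Bc C by (simp add: assoc_mult_mat)
  also have "\<dots> = C" using AB C by simp
  finally show ?thesis using B by (simp add: C_def)
qed

lemma measurable_det:
  fixes F :: "'a \<Rightarrow> real mat"
  assumes F: "\<And>\<omega>. F \<omega> \<in> carrier_mat n n"
    and meas: "\<And>i j. i < n \<Longrightarrow> j < n \<Longrightarrow> (\<lambda>\<omega>. F \<omega> $$ (i, j)) \<in> borel_measurable M"
  shows "(\<lambda>\<omega>. Determinant.det (F \<omega>)) \<in> borel_measurable M"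
  unfolding det_def'[OF F]
proof (intro borel_measurable_sum borel_measurable_times borel_measurable_const borel_measurable_prod)
  fix \<pi> i assume "\<pi> \<in> {\<pi>. \<pi> permutes {0..<n}}" "i \<in> {0..<n}"
  then show "(\<lambda>\<omega>. F \<omega> $$ (i, \<pi> i)) \<in> borel_measurable M"
    using permutes_in_image[of \<pi> "{0..<n}" i] by (intro meas) auto
qed

lemma measurable_adj_mat:
  fixes F :: "'a \<Rightarrow> real mat"
  assumes F: "\<And>\<omega>. F \<omega> \<in> carrier_mat n n"
    and meas: "\<And>i j. i < n \<Longrightarrow> j < n \<Longrightarrow> (\<lambda>\<omega>. F \<omega> $$ (i, j)) \<in> borel_measurable M"
    and i: "i < n" and j: "j < n"
  shows "(\<lambda>\<omega>. adj_mat (F \<omega>) $$ (i, j)) \<in> borel_measurable M"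
proof -
  have dims: "dim_row (F \<omega>) = n" "dim_col (F \<omega>) = n" for \<omega> using F[of \<omega>] by auto
  have "(\<lambda>\<omega>. Determinant.det (mat_delete (F \<omega>) j i)) \<in> borel_measurable M"
  proof (rule measurable_det)
    show "mat_delete (F \<omega>) j i \<in> carrier_mat (n - 1) (n - 1)" for \<omega> by (rule mat_delete_carrier[OF F])
    fix k l assume "k < n - 1" "l < n - 1"
    then show "(\<lambda>\<omega>. mat_delete (F \<omega>) j i $$ (k, l)) \<in> borel_measurable M"
      by (auto simp: mat_delete_def dims intro!: meas)
  qed
  then show ?thesis
    using i j by (simp add: adj_mat_def dims cofactor_def)
qed

lemma quadratic_form_eq_sum:
  fixes A :: "real mat"
  assumes A: "A \<in> carrier_mat p p" and u: "u \<in> carrier_vec p"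
  shows "u \<bullet> (A *\<^sub>v u) = (\<Sum>i<p. u $ i * (\<Sum>j<p. A $$ (i, j) * u $ j))"
  using A u by (simp add: scalar_prod_def mult_mat_vec_def atLeast0LessThan)

text \<open>
  The Gram part contributes a sum of squares to the quadratic form.
\<close>

lemma pos_def_S_mat:
  assumes S: "pos_def_mat p S"
  shows "pos_def_mat p (S_mat p S \<xi> n)"
proof -
  have Sc: "S \<in> carrier_mat p p" and St: "transpose_mat S = S" using S by (auto simp: pos_def_mat_def)
  define A where "A = Matrix.mat p p (\<lambda>(i, j). \<Sum>k = 0..n. Phi p \<xi> k $ i * Phi p \<xi> k $ j)"
  have A: "A \<in> carrier_mat p p" by (simp add: A_def)
  have At: "transpose_mat A = A" by (rule eq_matI) (auto simp: A_def mult.commute)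
  have eq: "S_mat p S \<xi> n = A + S" by (simp add: S_mat_def A_def)
  have t: "transpose_mat (A + S) = A + S" using At St A Sc by (simp add: transpose_add)
  have pos: "0 < u \<bullet> ((A + S) *\<^sub>v u)" if u: "u \<in> carrier_vec p" "u \<noteq> 0\<^sub>v p" for u
  proof -
    have "u \<bullet> (A *\<^sub>v u) = (\<Sum>k=0..n. (\<Sum>i<p. u $ i * Phi p \<xi> k $ i)\<^sup>2)"
    proof -
      have "u \<bullet> (A *\<^sub>v u) = (\<Sum>i<p. \<Sum>j<p. \<Sum>k=0..n. (u $ i * Phi p \<xi> k $ i) * (u $ j * Phi p \<xi> k $ j))"
        unfolding quadratic_form_eq_sum[OF A u(1)]
        by (simp add: A_def sum_distrib_left sum_distrib_right mult_ac)
      also have "\<dots> = (\<Sum>i<p. \<Sum>k=0..n. \<Sum>j<p. (u $ i * Phi p \<xi> k $ i) * (u $ j * Phi p \<xi> k $ j))"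
        by (intro sum.cong refl sum.swap)
      also have "\<dots> = (\<Sum>k=0..n. \<Sum>i<p. \<Sum>j<p. (u $ i * Phi p \<xi> k $ i) * (u $ j * Phi p \<xi> k $ j))"
        by (rule sum.swap)
      finally show ?thesis by (simp add: power2_eq_square sum_product)
    qed
    then have "0 \<le> u \<bullet> (A *\<^sub>v u)" by (simp add: sum_nonneg)
    moreover have "0 < u \<bullet> (S *\<^sub>v u)" using S u by (simp add: pos_def_mat_def)
    moreover have "u \<bullet> ((A + S) *\<^sub>v u) = u \<bullet> (A *\<^sub>v u) + u \<bullet> (S *\<^sub>v u)"
      using A Sc u(1) by (simp add: add_mult_distrib_mat_vec scalar_prod_add_distrib[of _ p])
    ultimately show ?thesis by simp
  qed
  show ?thesis unfolding eq pos_def_mat_def using A Sc t pos by auto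
qed

lemma pos_def_sum_nonneg:
  assumes S: "pos_def_mat p S"
  shows "0 \<le> (\<Sum>i<p. u i * (\<Sum>j<p. S $$ (i, j) * u j))"
proof -
  define z where "z = Matrix.vec p u"
  have z: "z \<in> carrier_vec p" by (simp add: z_def)
  have Sc: "S \<in> carrier_mat p p" using S by (simp add: pos_def_mat_def)
  have "0 \<le> z \<bullet> (S *\<^sub>v z)"
  proof (cases "z = 0\<^sub>v p")
    case True
    then show ?thesis using Sc by simp
  next
    case False
    then show ?thesis using S z by (simp add: pos_def_mat_def less_imp_le)
  qed
  then show ?thesis unfolding quadratic_form_eq_sum[OF Sc z] by (simp add: z_def)
qed

lemma theta_hat_eq:
  assumes S: "pos_def_mat p S"
  shows "theta_hat p S \<xi> n = ((1 / Determinant.det (S_mat p S \<xi> (n - 1))) \<cdot>\<^sub>m adj_mat (S_mat p S \<xi> (n - 1)))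
    *\<^sub>v Matrix.vec p (\<lambda>i. \<Sum>k = 1..n. Phi p \<xi> (k - 1) $ i * \<xi> (int k))"
proof -
  have P: "pos_def_mat p (S_mat p S \<xi> (n - 1))" by (rule pos_def_S_mat[OF S])
  then have "S_mat p S \<xi> (n - 1) \<in> carrier_mat p p" by (simp add: pos_def_mat_def)
  from mat_inverse_eq_adj_mat[OF this pos_def_imp_det_nonzero[OF P]]
  show ?thesis by (simp add: theta_hat_def)
qed

lemma theta_hat_dim: "pos_def_mat p S \<Longrightarrow> dim_vec (theta_hat p S \<xi> n) = p"
  using pos_def_S_mat[of p S \<xi> "n - 1"] adj_mat(1)[of "S_mat p S \<xi> (n - 1)" p]
  by (auto simp: theta_hat_eq pos_def_mat_def)

lemma theta_hat_normal_eq: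
  assumes S: "pos_def_mat p S" and i: "i < p"
  shows "(\<Sum>j<p. S_mat p S \<xi> (n - 1) $$ (i, j) * theta_hat p S \<xi> n $ j)
    = (\<Sum>k = 1..n. Phi p \<xi> (k - 1) $ i * \<xi> (int k))"
proof -
  define A where "A = S_mat p S \<xi> (n - 1)"
  define b where "b = Matrix.vec p (\<lambda>i. \<Sum>k = 1..n. Phi p \<xi> (k - 1) $ i * \<xi> (int k))"
  have P: "pos_def_mat p A" unfolding A_def by (rule pos_def_S_mat[OF S])
  have A: "A \<in> carrier_mat p p" using P by (simp add: pos_def_mat_def)
  have inv: "mat_inverse A = Some ((1 / Determinant.det A) \<cdot>\<^sub>m adj_mat A)"
    by (rule mat_inverse_eq_adj_mat[OF A pos_def_imp_det_nonzero[OF P]])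
  define B where "B = (1 / Determinant.det A) \<cdot>\<^sub>m adj_mat A"
  have B: "A * B = 1\<^sub>m p" "B \<in> carrier_mat p p" using mat_inverse(2)[OF A inv] by (auto simp: B_def)
  have th: "theta_hat p S \<xi> n = B *\<^sub>v b" unfolding theta_hat_eq[OF S] B_def b_def A_def ..
  have bc: "b \<in> carrier_vec p" by (simp add: b_def)
  have "A *\<^sub>v theta_hat p S \<xi> n = (A * B) *\<^sub>v b"
    unfolding th by (rule assoc_mult_mat_vec[OF A B(2) bc, symmetric])
  then have "(A *\<^sub>v theta_hat p S \<xi> n) $ i = b $ i" using B bc by simp
  moreover have "(A *\<^sub>v theta_hat p S \<xi> n) $ i = (\<Sum>j<p. A $$ (i, j) * theta_hat p S \<xi> n $ j)"
    using A i theta_hat_dim[OF S, of \<xi> n] by (simp add: scalar_prod_def atLeast0LessThan)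
  ultimately show ?thesis using i by (simp add: A_def b_def)
qed

lemma theta_hat_measurable:
  assumes S: "pos_def_mat p S" and i: "i < p"
    and X: "\<And>k. - int p \<le> k \<Longrightarrow> (\<lambda>\<omega>. X k \<omega>) \<in> borel_measurable M"
  shows "(\<lambda>\<omega>. theta_hat p S (\<lambda>k. X k \<omega>) n $ i) \<in> borel_measurable M"
proof -
  define F where "F \<omega> = S_mat p S (\<lambda>k. X k \<omega>) (n - 1)" for \<omega>
  have F: "F \<omega> \<in> carrier_mat p p" for \<omega>
    using pos_def_S_mat[OF S] unfolding F_def pos_def_mat_def by blast
  have Sc: "S \<in> carrier_mat p p" using S by (simp add: pos_def_mat_def)
  have Phi: "(\<lambda>\<omega>. Phi p (\<lambda>k. X k \<omega>) k $ i) \<in> borel_measurable M" if "i < p" for i k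
    using that X[of "int k - int i"] by (simp add: Phi_def)
  have F_M: "(\<lambda>\<omega>. F \<omega> $$ (i, j)) \<in> borel_measurable M" if "i < p" "j < p" for i j
  proof -
    have "F \<omega> $$ (i, j) = (\<Sum>k = 0..n - 1. Phi p (\<lambda>k. X k \<omega>) k $ i * Phi p (\<lambda>k. X k \<omega>) k $ j) + S $$ (i, j)" for \<omega>
      using that Sc by (simp add: F_def S_mat_def)
    then show ?thesis using Phi that by simp
  qed
  note [measurable] = measurable_det[OF F F_M] measurable_adj_mat[OF F F_M]
  have "theta_hat p S (\<lambda>k. X k \<omega>) n $ i
      = (\<Sum>j<p. 1 / Determinant.det (F \<omega>) * adj_mat (F \<omega>) $$ (i, j) * (\<Sum>k = 1..n. Phi p (\<lambda>k. X k \<omega>) (k - 1) $ j * X (int k) \<omega>))" for \<omega>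
    unfolding theta_hat_eq[OF S] F_def[symmetric]
    using i adj_mat(1)[OF F, of \<omega>] by (simp add: scalar_prod_def atLeast0LessThan)
  moreover have "(\<lambda>\<omega>. \<Sum>j<p. 1 / Determinant.det (F \<omega>) * adj_mat (F \<omega>) $$ (i, j)
      * (\<Sum>k = 1..n. Phi p (\<lambda>k. X k \<omega>) (k - 1) $ j * X (int k) \<omega>)) \<in> borel_measurable M"
    using i by (intro borel_measurable_sum borel_measurable_times borel_measurable_divide borel_measurable_const
        measurable_det[OF F F_M] measurable_adj_mat[OF F F_M] Phi X) auto
  ultimately show ?thesis by simp
qed

lemma mult_mat_vec_entry:
  fixes A :: "real mat"
  assumes "A \<in> carrier_mat p p" "u \<in> carrier_vec p" "i < p"
  shows "(A *\<^sub>v u) $ i = (\<Sum>j<p. A $$ (i, j) * u $ j)"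
  using assms by (simp add: scalar_prod_def atLeast0LessThan)

section \<open>The Durbin-Watson test\<close>

lemma chi_square_one: "chi_square_distribution 1 = distr std_normal_distribution borel (\<lambda>z. z\<^sup>2)"
proof -
  interpret real_distribution std_normal_distribution by (rule real_dist_normal_dist)
  interpret product_prob_space "\<lambda>_. std_normal_distribution" "{..<1::nat}" ..
  have comp: "distr (PiM {..<1::nat} (\<lambda>_. std_normal_distribution)) std_normal_distribution (\<lambda>z. z 0) = std_normal_distribution"
    by (rule PiM_component) simp
  have "chi_square_distribution 1
      = distr (PiM {..<1::nat} (\<lambda>_. std_normal_distribution)) borel ((\<lambda>z. z\<^sup>2) \<circ> (\<lambda>z. z 0))"
    by (simp add: chi_square_distribution_def comp_def)
  also have "\<dots> = distr (distr (PiM {..<1::nat} (\<lambda>_. std_normal_distribution)) std_normal_distribution (\<lambda>z. z 0)) borel (\<lambda>z. z\<^sup>2)"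
    by (rule distr_distr[symmetric]) auto
  finally show ?thesis unfolding comp .
qed

text \<open>
  The last row of the matrix \<open>1\<^sub>m p - (\<theta>\<^sub>p \<rho>) \<cdot>\<^sub>m exchange_mat p\<close> involves only the first and the last entry of \<open>\<beta>\<close>.
\<close>

lemma ts_eq_theta_star:
  assumes auto: "autoregression p (\<lambda>i. \<theta> $ i) \<rho> x e v" and \<theta>: "\<theta> \<in> carrier_vec p"
  shows "autoregression.ts p (\<lambda>i. \<theta> $ i) \<rho> (p - 1) = theta_star p \<theta> \<rho> $ (p - 1)"
proof -
  interpret autoregression p "\<lambda>i. \<theta> $ i" \<rho> x e v by (rule auto)
  define t where "t = \<theta> $ (p - 1)"
  define \<beta> where "\<beta> = beta_vec p \<theta> \<rho>"
  define A where "A = 1\<^sub>m p - (t * \<rho>) \<cdot>\<^sub>m exchange_mat p"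
  have i: "p - 1 < p" "0 < p" using p_pos by auto
  have \<beta>: "\<beta> $ i = b i" if "i < p" for i
    using that by (simp add: \<beta>_def beta_vec_def b_def mult.commute)
  have \<beta>c: "\<beta> \<in> carrier_vec p" by (simp add: \<beta>_def beta_vec_def)
  have A: "A \<in> carrier_mat p p" unfolding A_def exchange_mat_def by (rule minus_carrier_mat) simp
  have "(A *\<^sub>v \<beta>) $ (p - 1) = (\<Sum>j<p. A $$ (p - 1, j) * \<beta> $ j)"
    by (rule mult_mat_vec_entry[OF A \<beta>c i(1)])
  also have "\<dots> = (\<Sum>j<p. (if j = p - 1 then b j else 0) - (if j = 0 then t * \<rho> * b j else 0))"
    using i by (intro sum.cong) (auto simp: A_def exchange_mat_def \<beta> left_diff_distrib)
  also have "\<dots> = b (p - 1) - t * \<rho> * b 0"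
    using i by (simp add: sum_subtractf)
  finally have "theta_star p \<theta> \<rho> $ (p - 1) = 1 / ((1 - t * \<rho>) * (1 + t * \<rho>)) * (b (p - 1) - t * \<rho> * b 0)"
    using A i unfolding theta_star_def Let_def t_def[symmetric] \<beta>_def[symmetric] A_def[symmetric] by simp
  moreover have "(1 - t * \<rho>) * (1 + t * \<rho>) = 1 - c\<^sup>2"
    by (simp add: c_def t_def power2_eq_square algebra_simps)
  moreover have "t * \<rho> = c" by (simp add: c_def t_def)
  ultimately show ?thesis by (simp add: ts_def)
qed

context ar_process
begin

text \<open>
  The observed path and its noise, set to 0 at all negative times. The statistics read the observations from
  time \<open>- p\<close> on only, where \<open>path\<close> agrees with \<open>X\<close>.
\<close>

definition path :: "'a \<Rightarrow> int \<Rightarrow> real" where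
  "path \<omega> k = (if k < 0 then 0 else X k \<omega>)"

definition noise :: "'a \<Rightarrow> int \<Rightarrow> real" where
  "noise \<omega> k = (if k < 0 then 0 else \<epsilon> (nat k) \<omega>)"

lemma path_eq:
  assumes "\<omega> \<in> space M" "- int p \<le> k"
  shows "X k \<omega> = path \<omega> k"
proof (cases "k < 0")
  case True
  then have "nat (- k) \<in> {1..p}" "- int (nat (- k)) = k" using assms(2) by auto
  with X_neg[OF this(1) assms(1)] show ?thesis using True by (simp only: path_def if_True)
qed (simp add: path_def)

lemma path_autoregression:
  assumes \<omega>: "\<omega> \<in> space M"
  shows "autoregression p (\<lambda>i. \<theta> $ i) \<rho> (path \<omega>) (noise \<omega>) (\<lambda>k. if k = 0 then X 0 \<omega> else if k \<le> 0 then 0 else V (nat k) \<omega>)"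
proof
  show "1 \<le> p" "\<bar>\<rho>\<bar> < 1" by (rule p_ge_1, rule rho)
  have reindex: "(\<Sum>i = 1..p. F (i - 1)) = (\<Sum>i<p. F i)" for F :: "nat \<Rightarrow> real"
    by (rule sum.reindex_bij_witness[of _ Suc "\<lambda>i. i - 1"]) auto
  show "(\<Sum>i<p. \<bar>\<theta> $ i\<bar>) < 1" using theta_norm reindex[of "\<lambda>i. \<bar>\<theta> $ i\<bar>"] by simp
  show "causal (path \<omega>)" "causal (noise \<omega>)" "causal (\<lambda>k. if k = 0 then X 0 \<omega> else if k \<le> 0 then 0 else V (nat k) \<omega>)"
    by (auto simp: causal_def path_def noise_def)
  fix k :: int assume k: "0 \<le> k"
  show "path \<omega> k = (\<Sum>i<p. \<theta> $ i * path \<omega> (k - 1 - int i)) + noise \<omega> k"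
  proof (cases "k = 0")
    case True
    then show ?thesis using X_0_eps[OF \<omega>] by (simp add: path_def noise_def)
  next
    case False
    then have n: "1 \<le> nat k" "int (nat k) = k" using k by auto
    have "(\<Sum>i = 1..p. \<theta> $ (i - 1) * X (int (nat k) - int i) \<omega>)
        = (\<Sum>i = 1..p. \<theta> $ (i - 1) * path \<omega> (k - 1 - int (i - 1)))"
    proof (rule sum.cong)
      fix i assume i: "i \<in> {1..p}"
      then have "k - 1 - int (i - 1) = int (nat k) - int i" using n by auto
      then show "\<theta> $ (i - 1) * X (int (nat k) - int i) \<omega> = \<theta> $ (i - 1) * path \<omega> (k - 1 - int (i - 1))"
        using path_eq[OF \<omega>, of "int (nat k) - int i"] i n by auto
    qed simp
    also have "\<dots> = (\<Sum>i<p. \<theta> $ i * path \<omega> (k - 1 - int i))" by (rule reindex)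
    finally show ?thesis using X_rec[OF n(1) \<omega>] n k False by (simp add: path_def noise_def)
  qed
  show "noise \<omega> k = \<rho> * noise \<omega> (k - 1) + (if k = 0 then X 0 \<omega> else if k \<le> 0 then 0 else V (nat k) \<omega>)"
  proof (cases "k = 0")
    case True
    then show ?thesis using X_0_eps[OF \<omega>] by (simp add: noise_def)
  next
    case False
    then have n: "1 \<le> nat k" "nat k - 1 = nat (k - 1)" using k by auto
    show ?thesis using eps_rec[OF n(1) \<omega>] n(2) k False by (simp add: noise_def)
  qed
qed

lemma Phi_entry: "\<omega> \<in> space M \<Longrightarrow> i < p \<Longrightarrow> Phi p (\<lambda>i. X i \<omega>) k $ i = path \<omega> (int k - int i)"
  by (simp add: Phi_def path_eq)

lemma sum_lagged: "(\<Sum>k = 1..n. F (int (k - 1))) = (\<Sum>k\<le>n. F (int k - 1))"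
  if "F (-1) = 0" for F :: "int \<Rightarrow> real"
proof -
  have "(\<Sum>k\<le>n. F (int k - 1)) = (\<Sum>k = 1..n. F (int k - 1))"
    using that by (simp add: atMost_atLeast0 sum.atLeast_Suc_atMost)
  also have "\<dots> = (\<Sum>k = 1..n. F (int (k - 1)))" by (rule sum.cong) (auto simp: of_nat_diff)
  finally show ?thesis by simp
qed

lemma path_normal_eq:
  assumes \<omega>: "\<omega> \<in> space M" and n: "1 \<le> n" and i: "i < p"
  shows "(\<Sum>j<p. (ip (lag (Suc i) (path \<omega>)) (lag (Suc j) (path \<omega>)) n + S $$ (i, j)) * theta_hat p S (\<lambda>i. X i \<omega>) n $ j)
    = ip (lag (Suc i) (path \<omega>)) (path \<omega>) n"
proof -
  have Sc: "S \<in> carrier_mat p p" using S_pos_def by (simp add: pos_def_mat_def)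
  have gram: "ip (lag (Suc i) (path \<omega>)) (lag (Suc j) (path \<omega>)) n + S $$ (i, j) = S_mat p S (\<lambda>i. X i \<omega>) (n - 1) $$ (i, j)"
    if j: "j < p" for j
  proof -
    have "S_mat p S (\<lambda>i. X i \<omega>) (n - 1) $$ (i, j)
        = (\<Sum>k = 0..n - 1. path \<omega> (int k - int i) * path \<omega> (int k - int j)) + S $$ (i, j)"
      using Sc i j by (simp add: S_mat_def Phi_entry[OF \<omega>])
    also have "(\<Sum>k = 0..n - 1. path \<omega> (int k - int i) * path \<omega> (int k - int j))
        = (\<Sum>k = 1..n. path \<omega> (int (k - 1) - int i) * path \<omega> (int (k - 1) - int j))"
      by (rule sum.reindex_bij_witness[of _ "\<lambda>k. k - 1" Suc]) (use n in auto)
    also have "\<dots> = (\<Sum>k\<le>n. path \<omega> (int k - 1 - int i) * path \<omega> (int k - 1 - int j))"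
      by (rule sum_lagged) (simp add: path_def)
    also have "\<dots> = ip (lag (Suc i) (path \<omega>)) (lag (Suc j) (path \<omega>)) n"
      by (simp add: ip_def lag_def algebra_simps)
    finally show ?thesis by simp
  qed
  have "(\<Sum>j<p. (ip (lag (Suc i) (path \<omega>)) (lag (Suc j) (path \<omega>)) n + S $$ (i, j)) * theta_hat p S (\<lambda>i. X i \<omega>) n $ j)
      = (\<Sum>j<p. S_mat p S (\<lambda>i. X i \<omega>) (n - 1) $$ (i, j) * theta_hat p S (\<lambda>i. X i \<omega>) n $ j)"
    by (rule sum.cong) (simp_all add: gram)
  also have "\<dots> = (\<Sum>k = 1..n. Phi p (\<lambda>i. X i \<omega>) (k - 1) $ i * X (int k) \<omega>)"
    by (rule theta_hat_normal_eq[OF S_pos_def i])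
  also have "\<dots> = (\<Sum>k = 1..n. path \<omega> (int (k - 1) - int i) * path \<omega> (int (k - 1) + 1))"
    using i by (intro sum.cong) (auto simp: Phi_entry[OF \<omega>] path_def of_nat_diff)
  also have "\<dots> = (\<Sum>k\<le>n. path \<omega> (int k - 1 - int i) * path \<omega> (int k - 1 + 1))"
    by (rule sum_lagged[of "\<lambda>k. path \<omega> (k - int i) * path \<omega> (k + 1)"]) (simp add: path_def)
  also have "\<dots> = ip (lag (Suc i) (path \<omega>)) (path \<omega>) n"
    by (simp add: ip_def lag_def algebra_simps)
  finally show ?thesis .
qed

lemma residual_eq:
  assumes \<omega>: "\<omega> \<in> space M"
  shows "eps_hat p S (\<lambda>i. X i \<omega>) n k
    = path \<omega> (int k) - (\<Sum>i<p. theta_hat p S (\<lambda>i. X i \<omega>) n $ i * path \<omega> (int k - 1 - int i))"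
proof (cases "k = 0")
  case True
  then show ?thesis by (simp add: eps_hat_def path_def)
next
  case False
  then have "theta_hat p S (\<lambda>i. X i \<omega>) n \<bullet> Phi p (\<lambda>i. X i \<omega>) (k - 1)
      = (\<Sum>i<p. theta_hat p S (\<lambda>i. X i \<omega>) n $ i * path \<omega> (int k - 1 - int i))"
    by (simp add: scalar_prod_def Phi_entry[OF \<omega>] atLeast0LessThan of_nat_diff Phi_def[THEN arg_cong[where f = dim_vec]])
  then show ?thesis using False by (simp add: eps_hat_def path_def)
qed

end

theorem theorem4p4:
  fixes M :: "'a measure" and p :: nat and \<theta> :: "real vec" and \<rho> \<sigma> :: real
    and S :: "real mat" and X :: "int \<Rightarrow> 'a \<Rightarrow> real" and \<epsilon> V :: "nat \<Rightarrow> 'a \<Rightarrow> real"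
  assumes "ar_process M p \<theta> \<rho> \<sigma> S X \<epsilon> V"
    and "\<And>n. 1 \<le> n \<Longrightarrow> integrable M (\<lambda>\<omega>. V n \<omega> ^ 4)"
    and "\<theta> $ (p - 1) \<noteq> 0"
    and "theta_star p \<theta> \<rho> $ (p - 1) \<noteq> 0"
  shows "(\<rho> = 0 \<longrightarrow>
            weak_conv_m (\<lambda>n. distr M borel (\<lambda>\<omega>. dw_test p S (\<lambda>i. X i \<omega>) n))
              (chi_square_distribution 1)) \<and>
         (\<rho> \<noteq> 0 \<longrightarrow>
            (AE \<omega> in M. filterlim (\<lambda>n. dw_test p S (\<lambda>i. X i \<omega>) n) at_top sequentially))"
proof -
  interpret ar_process M p \<theta> \<rho> \<sigma> S X \<epsilon> V by (rule assms(1))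
  interpret I: iid_noise M V "\<sigma>\<^sup>2"
  proof
    show "expectation (\<lambda>\<omega>. (V k \<omega>)\<^sup>2) = \<sigma>\<^sup>2" if "1 \<le> k" for k
      using V_variance[OF that] V_mean[OF that] by simp
  qed (fact V_indep V_ident V_mean sigma_pos assms(2))+
  interpret A: random_autoregression M V "\<sigma>\<^sup>2" p "\<lambda>i. \<theta> $ i" \<rho> "X 0" path noise
  proof (intro random_autoregression.intro random_autoregression_axioms.intro I.iid_noise_axioms)
    show "autoregression p (\<lambda>i. \<theta> $ i) \<rho> (path \<omega>) (noise \<omega>) (\<lambda>k. if k = 0 then X 0 \<omega> else I.w \<omega> k)"
      if "\<omega> \<in> space M" for \<omega>
      unfolding I.w_def by (rule path_autoregression[OF that])
    obtain \<omega>0 where "\<omega>0 \<in> space M" using not_empty by auto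
    then show "(\<Sum>i<p. \<bar>\<theta> $ i\<bar>) < 1" by (rule autoregression.a_norm[OF path_autoregression])
  qed (use p_ge_1 rho X_0_rv X_0_square in auto)
  define th where "th \<omega> n i = theta_hat p S (\<lambda>i. X i \<omega>) n $ i" for \<omega> n i
  have X_M: "(\<lambda>\<omega>. X k \<omega>) \<in> borel_measurable M" if "- int p \<le> k" for k
    by (subst measurable_cong[where g = "\<lambda>\<omega>. path \<omega> k"]) (use path_eq that A.x_M in auto)
  interpret L: random_least_squares M V "\<sigma>\<^sup>2" p "\<lambda>i. \<theta> $ i" \<rho> "X 0" path noise "\<lambda>i j. S $$ (i, j)" th
  proof
    show "0 \<le> (\<Sum>i<p. u i * (\<Sum>j<p. S $$ (i, j) * u j))" for u
      by (rule pos_def_sum_nonneg[OF S_pos_def])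
    show "(\<lambda>\<omega>. th \<omega> n i) \<in> borel_measurable M" if "i < p" for n i
      unfolding th_def by (rule theta_hat_measurable[OF S_pos_def that X_M])
  qed (use path_normal_eq in \<open>simp add: th_def\<close>)
  have stat: "dw_test p S (\<lambda>i. X i \<omega>) n = real n / (4 * (th \<omega> n (p - 1))\<^sup>2) * (L.dw \<omega> n - 2)\<^sup>2"
    if \<omega>: "\<omega> \<in> space M" for \<omega> n
  proof -
    have res: "eps_hat p S (\<lambda>i. X i \<omega>) n k = L.rsd \<omega> n (int k)" for k
      by (simp add: residual_eq[OF \<omega>] L.rsd_def th_def)
    have "durbin_watson p S (\<lambda>i. X i \<omega>) n = L.dw \<omega> n"
      unfolding durbin_watson_def L.dw_def res ip_def
      by (intro arg_cong2[where f = "(*)"] arg_cong[where f = inverse] sum.cong)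
        (auto simp: power2_eq_square of_nat_diff)
    then show ?thesis by (simp add: dw_test_def th_def)
  qed
  obtain \<omega>0 where \<omega>0: "\<omega>0 \<in> space M" using not_empty by auto
  have ts: "autoregression.ts p (\<lambda>i. \<theta> $ i) \<rho> (p - 1) \<noteq> 0"
    using assms(4) ts_eq_theta_star[OF path_autoregression[OF \<omega>0] theta_carrier] by simp
  show ?thesis
  proof (intro conjI impI)
    assume "\<rho> = 0"
    from L.squared_statistic_limit[OF this ts]
    have "weak_conv_m (\<lambda>n. distr M borel (\<lambda>\<omega>. real n / (4 * (th \<omega> n (p - 1))\<^sup>2) * (L.dw \<omega> n - 2)\<^sup>2))
        (chi_square_distribution 1)"
      unfolding chi_square_one .
    moreover have "distr M borel (\<lambda>\<omega>. dw_test p S (\<lambda>i. X i \<omega>) n)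
        = distr M borel (\<lambda>\<omega>. real n / (4 * (th \<omega> n (p - 1))\<^sup>2) * (L.dw \<omega> n - 2)\<^sup>2)" for n
      by (rule distr_cong) (auto simp: stat)
    ultimately show "weak_conv_m (\<lambda>n. distr M borel (\<lambda>\<omega>. dw_test p S (\<lambda>i. X i \<omega>) n)) (chi_square_distribution 1)"
      by simp
  next
    assume "\<rho> \<noteq> 0"
    from L.statistic_diverges_almost_surely[OF this assms(3) ts] AE_space
    show "AE \<omega> in M. filterlim (\<lambda>n. dw_test p S (\<lambda>i. X i \<omega>) n) at_top sequentially"
      by eventually_elim (simp add: stat)
  qed
qed

end
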